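(* Let $n,d\ge1$ be integers and let $B^n\subset\mathbb{R}^n$ be the closed unit ball. Let $f:B^n\to\mathbb{R}$ be a $C^{d+1}$-smooth function with $M_0(f)=1$, such that $f$ does not vanish outside the concentric ball $B^n_{1/2}$ of radius $\frac12$, and such that for a certain $\gamma$ with $0<\gamma<1$, zero is a $\gamma$-regular value of $f$. Let $Y_0(f)=\{x\in B^n: f(x)=0\}$ and let $q$ be the number of its connected components. If $Y_0(f)$ is not smoothly isotopic to any union $W=\bigcup_{i=1}^q W_i$ of smooth connected components $W_i$ of an algebraic hypersurface $Y_0(P)=\{x\in B^n:P(x)=0\}$ with $P$ a polynomial of degree $d$, then $$M_{d+1}(f)\ge T=T(\gamma)=\min\left\{1,\frac{d!\,\gamma^2}{4C_3}\right\},$$ where $C_3=C_3(n,d)$ is the constant defined in the context.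
   Context: "Polynomial of degree $d$" means degree at most $d$. For a $C^{d+1}$ function $f:B^n\to\mathbb{R}$ and $l=0,1,\dots,d+1$, $M_l(f)=\max_{z\in B^n}\|f^{(l)}(z)\|$, where the norm of the $l$-th derivative is the sum of the absolute values of all partial derivatives of $f$ of order $l$. For $\gamma>0$, a real number $c$ is a $\gamma$-regular value of $f$ if $\|\operatorname{grad} f(x)\|\ge\gamma$ for each $x\in B^n$ with $f(x)=c$; when zero is a $\gamma$-regular value and $f$ does not vanish outside $B^n_{1/2}$, $Y_0(f)$ is a compact smooth hypersurface in $B^n_{1/2}$. Constants: let $\bar C(n,d)$ be a fixed constant such that $M_k(P)\le\bar C(n,d)M_0(P)$ for all real polynomials $P$ of degree at most $d$ in $n$ variables and all $k=1,\dots,d$ (it exists by equivalence of norms on a finite-dimensional space). Put $C_1(n,d)=\bar C(n,d)$, $C_2(n,d)=\frac{\bar C(n,d)}{(d+1)!}+1$, so that $M_k(f)\le C_1(n,d)M_0(f)+C_2(n,d)M_{d+1}(f)$ for every $C^{d+1}$ function $f$ on $B^n$ and all $k=1,\dots,d$; and $C_3(n,d)=C_1(n,d)+C_2(n,d)$. *)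

theory Defs
  imports "HOL-Analysis.Analysis"
begin

section \<open>Functions of class C^k on a set\<close>

text \<open>
  Partial derivatives are taken \<^emph>\<open>within\<close> the set \<open>S\<close>, so that they make sense at the boundary
  points of the closed unit ball without choosing an extension of the function, and depend only on
  the values on \<open>S\<close>. They are well defined whenever \<open>S\<close> is open, or convex with nonempty interior
  (lemma \<open>partial_on_eq\<close>); every use below is of one of these two kinds.
\<close>

definition partial_on ::
    "'a::euclidean_space set \<Rightarrow> 'a \<Rightarrow> ('a \<Rightarrow> 'b::real_normed_vector) \<Rightarrow> 'a \<Rightarrow> 'b" where
  "partial_on S b f x = frechet_derivative f (at x within S) b"

primrec Ck_on ::
    "nat \<Rightarrow> 'a::euclidean_space set \<Rightarrow> ('a \<Rightarrow> 'b::real_normed_vector) \<Rightarrow> bool" where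
  "Ck_on 0 S f \<longleftrightarrow> continuous_on S f"
| "Ck_on (Suc k) S f \<longleftrightarrow> f differentiable_on S \<and> (\<forall>b\<in>Basis. Ck_on k S (partial_on S b f))"

lemma has_derivative_within_convex_unique:
  fixes f :: "'a::euclidean_space \<Rightarrow> 'b::real_normed_vector"
  assumes S: "convex S" "interior S \<noteq> {}" and x: "x \<in> S"
    and f': "(f has_derivative f') (at x within S)"
    and f'': "(f has_derivative f'') (at x within S)"
  shows "f' = f''"
proof -
  obtain c r where r: "r > 0" "ball c r \<subseteq> S"
    using S(2) by (metis ex_in_conv mem_interior)
  have lin: "linear f'" "linear f''"
    using f' f'' has_derivative_linear by blast+
  have eq: "f' (u - x) = f'' (u - x)" if u: "u \<in> ball c r" for u
  proof -
    define p where "p = (\<lambda>t::real. x + t *\<^sub>R (u - x))"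
    have pS: "p ` {0..1} \<subseteq> S"
    proof
      fix y assume "y \<in> p ` {0..1}"
      then obtain t where t: "0 \<le> t" "t \<le> 1" "y = x + t *\<^sub>R (u - x)" by (auto simp: p_def)
      have "y = (1 - t) *\<^sub>R x + t *\<^sub>R u" using t by (simp add: algebra_simps)
      then show "y \<in> S" using t S(1) x u r(2) by (simp add: convexD_alt subset_iff)
    qed
    have p: "(p has_derivative (\<lambda>t. t *\<^sub>R (u - x))) (at 0 within {0..1})"
      unfolding p_def by (auto intro!: derivative_eq_intros)
    have *: "((\<lambda>t. f (p t)) has_vector_derivative g (u - x)) (at 0 within {0..1})"
      if g: "(f has_derivative g) (at x within S)" for g
    proof -
      have "(f has_derivative g) (at (p 0) within p ` {0..1})"
        using has_derivative_subset[OF g pS] by (simp add: p_def)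
      from diff_chain_within[OF p this] show ?thesis
        using has_derivative_linear[OF g]
        by (simp add: has_vector_derivative_def o_def linear_cmul)
    qed
    show ?thesis
      using vector_derivative_unique_within_closed_interval[of 0 1 0, unfolded cbox_interval,
          OF _ _ *[OF f'] *[OF f'']]
      by simp
  qed
  show ?thesis
  proof
    fix v
    show "f' v = f'' v"
    proof (cases "v = 0")
      case True
      then show ?thesis using lin by (simp add: linear_0)
    next
      case False
      define s where "s = r / (2 * norm v)"
      have s: "s > 0" using r False by (simp add: s_def)
      have "c + s *\<^sub>R v \<in> ball c r" using r False by (simp add: dist_norm s_def)
      then have e: "f' ((c + s *\<^sub>R v) - x) - f' (c - x) = f'' ((c + s *\<^sub>R v) - x) - f'' (c - x)"
        using eq[of "c + s *\<^sub>R v"] eq[of c] r(1) by (simp only: centre_in_ball)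
      have "g ((c + s *\<^sub>R v) - x) - g (c - x) = s *\<^sub>R g v" if "linear g" for g :: "'a \<Rightarrow> 'b"
      proof -
        have "g ((c + s *\<^sub>R v) - x) - g (c - x) = g (s *\<^sub>R v)"
          by (subst linear_diff[OF that, symmetric]) simp
        then show ?thesis by (simp only: linear_cmul[OF that])
      qed
      then have "s *\<^sub>R f' v = s *\<^sub>R f'' v" using e lin by metis
      then show ?thesis using s by simp
    qed
  qed
qed

lemma partial_on_eq:
  fixes f :: "'a::euclidean_space \<Rightarrow> 'b::real_normed_vector"
  assumes "convex S \<and> interior S \<noteq> {} \<or> open S" "x \<in> S"
    and f': "(f has_derivative f') (at x within S)"
  shows "partial_on S b f x = f' b"
proof -
  have fd: "(f has_derivative frechet_derivative f (at x within S)) (at x within S)"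
    using f' frechet_derivative_works differentiableI by blast
  have "frechet_derivative f (at x within S) = f'"
    using assms(1)
  proof
    assume "convex S \<and> interior S \<noteq> {}"
    then show ?thesis
      using has_derivative_within_convex_unique[OF _ _ \<open>x \<in> S\<close> fd f'] by simp
  next
    assume "open S"
    then have "at x within S = at x" using \<open>x \<in> S\<close> by (rule at_within_open[rotated])
    then show ?thesis using fd f' by (metis has_derivative_unique)
  qed
  then show ?thesis by (simp add: partial_on_def)
qed

definition grad_on :: "(real^'n) set \<Rightarrow> (real^'n \<Rightarrow> real) \<Rightarrow> real^'n \<Rightarrow> real^'n" where
  "grad_on S f x = (\<chi> i. partial_on S (axis i 1) f x)"


section \<open>The norms of the derivatives on the unit ball\<close>

text \<open>\<open>iter_partial [i\<^sub>1, \<dots>, i\<^sub>l] f\<close> is the iterated partial derivative in the coordinates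
  \<open>i\<^sub>1, \<dots>, i\<^sub>l\<close> on the closed unit ball.\<close>

primrec iter_partial :: "'n list \<Rightarrow> (real^'n \<Rightarrow> real) \<Rightarrow> real^'n \<Rightarrow> real" where
  "iter_partial [] f = f"
| "iter_partial (i # js) f = partial_on (cball 0 1) (axis i 1) (iter_partial js f)"

text \<open>The norm of the \<open>l\<close>-th derivative sums over all index sequences of length \<open>l\<close>, that is, over
  the entries of the symmetric tensor of \<open>l\<close>-th partial derivatives (mixed derivatives are counted
  once for each order of differentiation). With this convention Taylor's formula on the unit ball
  gives the factor \<open>1 / (d + 1)!\<close> in the constant \<open>C2\<close> below. The supremum is a maximum when \<open>f\<close>
  is of class \<open>C^l\<close>.\<close>

definition Mnorm :: "nat \<Rightarrow> (real^'n \<Rightarrow> real) \<Rightarrow> real" where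
  "Mnorm l f = (SUP z\<in>cball 0 1. \<Sum>js | length js = l. \<bar>iter_partial js f z\<bar>)"


section \<open>Zero sets, regular values, polynomials\<close>

definition zero_set :: "(real^'n \<Rightarrow> real) \<Rightarrow> (real^'n) set" where
  "zero_set f = {x \<in> cball 0 1. f x = 0}"

definition regular_value :: "real \<Rightarrow> (real^'n \<Rightarrow> real) \<Rightarrow> real \<Rightarrow> bool" where
  "regular_value \<gamma> f c \<longleftrightarrow> (\<forall>x\<in>cball 0 1. f x = c \<longrightarrow> norm (grad_on (cball 0 1) f x) \<ge> \<gamma>)"

definition poly_fun :: "nat \<Rightarrow> (real^'n \<Rightarrow> real) \<Rightarrow> bool" where
  "poly_fun d P \<longleftrightarrow>
    (\<exists>c :: ('n \<Rightarrow> nat) \<Rightarrow> real. \<forall>x. P x = (\<Sum>\<alpha> | sum \<alpha> UNIV \<le> d. c \<alpha> * (\<Prod>i\<in>UNIV. x $ i ^ \<alpha> i)))"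

lemma finite_exponents: "finite {\<alpha> :: 'n::finite \<Rightarrow> nat. sum \<alpha> UNIV \<le> d}"
proof (rule finite_subset)
  show "{\<alpha> :: 'n \<Rightarrow> nat. sum \<alpha> UNIV \<le> d} \<subseteq> PiE UNIV (\<lambda>_. {..d})"
  proof
    fix \<alpha> :: "'n \<Rightarrow> nat" assume "\<alpha> \<in> {\<alpha>. sum \<alpha> UNIV \<le> d}"
    moreover have "\<alpha> i \<le> sum \<alpha> UNIV" for i by (rule member_le_sum) auto
    ultimately show "\<alpha> \<in> PiE UNIV (\<lambda>_. {..d})" by (auto intro: order_trans)
  qed
  show "finite (PiE (UNIV :: 'n set) (\<lambda>_. {..d}))"
    by (intro finite_PiE) auto
qed


section \<open>Smooth hypersurfaces and smooth isotopy\<close>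

definition smooth_hypersurface :: "(real^'n) set \<Rightarrow> bool" where
  "smooth_hypersurface W \<longleftrightarrow>
    (\<forall>p\<in>W. \<exists>U g. open U \<and> p \<in> U \<and> (\<forall>k. Ck_on k U g) \<and>
       (\<forall>x\<in>U. grad_on U g x \<noteq> 0) \<and> W \<inter> U = {x \<in> U. g x = 0})"

definition Ck_diffeo :: "nat \<Rightarrow> 'a::euclidean_space set \<Rightarrow> ('a \<Rightarrow> 'a) \<Rightarrow> bool" where
  "Ck_diffeo k S h \<longleftrightarrow> bij_betw h S S \<and> Ck_on k S h \<and> Ck_on k S (inv_into S h)"

text \<open>Isotopy of subsets of \<open>S\<close> by an ambient isotopy of \<open>S\<close>, of class \<open>C^k\<close> jointly in time and
  space. For the zero set of a function of class \<open>C^(d+1)\<close>, which is in general only a hypersurface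
  of class \<open>C^(d+1)\<close>, smooth isotopy in the ball means \<open>k = d + 1\<close> and \<open>S = cball 0 1\<close>.\<close>

definition Ck_isotopic :: "nat \<Rightarrow> 'a::euclidean_space set \<Rightarrow> 'a set \<Rightarrow> 'a set \<Rightarrow> bool" where
  "Ck_isotopic k S Y W \<longleftrightarrow>
    (\<exists>H :: real \<times> 'a \<Rightarrow> 'a.
       Ck_on k ({0..1} \<times> S) H \<and>
       (\<forall>t\<in>{0..1}. Ck_diffeo k S (\<lambda>x. H (t, x))) \<and>
       (\<forall>x\<in>S. H (0, x) = x) \<and>
       (\<lambda>x. H (1, x)) ` Y = W)"


section \<open>The constants\<close>

text \<open>\<open>Cbar\<close> is any constant with \<open>Mnorm k P \<le> Cbar * Mnorm 0 P\<close> for all polynomials \<open>P\<close> of degree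
  at most \<open>d\<close> in the given number of variables and all \<open>k = 1, \<dots>, d\<close>.\<close>

definition C1 :: "real \<Rightarrow> real" where
  "C1 Cbar = Cbar"

definition C2 :: "real \<Rightarrow> nat \<Rightarrow> real" where
  "C2 Cbar d = Cbar / fact (d + 1) + 1"

definition C3 :: "real \<Rightarrow> nat \<Rightarrow> real" where
  "C3 Cbar d = C1 Cbar + C2 Cbar d"

end

theory Submission
  imports Defs
begin

text \<open>
  Let \<open>P\<close> be the Taylor polynomial of degree \<open>d\<close> of \<open>f\<close> at \<open>0\<close>. If \<open>M\<^sub>d\<^sub>+\<^sub>1(f) < T\<close>, then the values
  and the gradients of \<open>f\<close> and \<open>P\<close> differ by less than \<open>\<gamma>\<^sup>2 / (8 C\<^sub>3)\<close> and \<open>\<gamma> / 4\<close>, and the second derivative of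
  \<open>f\<close> is at most \<open>C\<^sub>3\<close>. If \<open>x\<close> has distance \<open>s\<close> to \<open>Y\<^sub>0(f)\<close>, then \<open>x - y\<close> is parallel to the gradient of \<open>f\<close>
  at a nearest zero \<open>y\<close>, so \<open>|f x| \<ge> \<gamma> s - C\<^sub>3 s\<^sup>2 / 2\<close>. Hence all zeros of the functions
  \<open>f + s (P - f)\<close>, \<open>0 \<le> s \<le> 1\<close>, in the neighbourhood of \<open>Y\<^sub>0(f)\<close> of radius \<open>\<gamma> / (2 C\<^sub>3)\<close> lie in the
  one of radius \<open>\<gamma> / (4 C\<^sub>3)\<close>, and they are regular. The zero sets in such a family are isotopic.

  Integrating a vector field would lose one derivative. Instead the isotopy is composed of moves
  supported in small balls, each of which slides points along a fixed direction \<open>e\<close> transversal to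
  the zero set so that the values of one function become those of another; by the implicit
  function theorem such a move is as smooth as the two functions.
\<close>

section \<open>Calculus of functions of class C^k\<close>

text \<open>The bound \<open>T\<close> is shaped by three demands. The values of \<open>f\<close>
  and \<open>P\<close> differ by at most \<open>M_(d+1)(f) / (d+1)!\<close>; since
  \<open>(d+1)! = (d+1) d!\<close> and \<open>d \<ge> 1\<close>, the second term of the minimum
  turns this into \<open>\<gamma>^2 / (8 C3)\<close>. For the gradients the divisor is
  \<open>d!\<close>, which leaves \<open>\<gamma>^2 / (4 C3)\<close>, and this is at most
  \<open>\<gamma> / 4\<close> because \<open>\<gamma> < 1\<close> and \<open>C3 \<ge> 1\<close>. The
  term 1 of the minimum bounds the contribution of the derivative of order \<open>d + 1\<close> to
  the second derivative, so that the latter stays below \<open>C3 = C1 + C2\<close>. The polynomial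
  may have further zeros far from the zero set of \<open>f\<close>, where the estimates say nothing
  about its gradient. Therefore only its zeros in the neighbourhood are compared. They are trapped
  in a compact subset of an open set, so they are open and closed in \<open>Y_0(P)\<close>, and this
  is what makes them a union of components.\<close>

abbreviation good_domain :: "'a::euclidean_space set \<Rightarrow> bool" where
  "good_domain S \<equiv> convex S \<and> interior S \<noteq> {} \<or> open S"

text \<open>\<open>frechet_derivative\<close> selects from the set of derivatives within
  \<open>S\<close>, and this set depends only on the values on \<open>S\<close>. So the partial
  derivatives of \<open>f\<close> and \<open>g\<close> agree on \<open>S\<close>, and the induction
  continues with them.\<close>

lemma Ck_on_cong:
  assumes "\<And>x. x \<in> S \<Longrightarrow> f x = g x"
  shows "Ck_on k S f \<longleftrightarrow> Ck_on k S g"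
  using assms
proof (induction k arbitrary: f g)
  case 0
  then show ?case by (simp cong: continuous_on_cong)
next
  case (Suc k)
  have d: "(f has_derivative f') (at x within S) \<longleftrightarrow> (g has_derivative f') (at x within S)"
    if "x \<in> S" for x f'
  proof
    show "(g has_derivative f') (at x within S)" if "(f has_derivative f') (at x within S)"
      by (rule has_derivative_transform[OF \<open>x \<in> S\<close> _ that]) (simp add: Suc.prems)
    show "(f has_derivative f') (at x within S)" if "(g has_derivative f') (at x within S)"
      by (rule has_derivative_transform[OF \<open>x \<in> S\<close> _ that]) (simp add: Suc.prems)
  qed
  have "f differentiable_on S \<longleftrightarrow> g differentiable_on S"
    by (simp add: differentiable_on_def differentiable_def d)
  moreover have "Ck_on k S (partial_on S b f) \<longleftrightarrow> Ck_on k S (partial_on S b g)" for b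
    by (rule Suc.IH) (simp add: partial_on_def frechet_derivative_def d)
  ultimately show ?case by simp
qed

lemma Ck_on_has_derivative:
  assumes "Ck_on (Suc k) S f" "x \<in> S"
  shows "(f has_derivative (\<lambda>v. partial_on S v f x)) (at x within S)"
proof -
  have "f differentiable (at x within S)" using assms by (simp add: differentiable_on_def)
  then have "(f has_derivative frechet_derivative f (at x within S)) (at x within S)"
    by (simp add: frechet_derivative_works)
  then show ?thesis by (simp add: partial_on_def)
qed

text \<open>The rule for computing: on a good domain derivatives are unique, so any explicit formula
  may replace the derivative selected by \<open>partial_on\<close>.\<close>

lemma Ck_on_SucI:
  assumes "good_domain S"
    and "\<And>x. x \<in> S \<Longrightarrow> (f has_derivative f' x) (at x within S)"
    and "\<And>b. b \<in> Basis \<Longrightarrow> Ck_on k S (\<lambda>x. f' x b)"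
  shows "Ck_on (Suc k) S f"
proof -
  have "partial_on S b f x = f' x b" if "x \<in> S" for x b
    using partial_on_eq[OF assms(1) that assms(2)[OF that]] .
  then have "Ck_on k S (partial_on S b f)" if "b \<in> Basis" for b
    using assms(3)[OF that] by (subst Ck_on_cong[where g = "\<lambda>x. f' x b"]) auto
  moreover have "f differentiable_on S"
    using assms(2) by (auto simp: differentiable_on_def differentiable_def)
  ultimately show ?thesis by simp
qed

lemma Ck_on_SucD: "Ck_on (Suc k) S f \<Longrightarrow> Ck_on k S f"
  by (induction k arbitrary: f) (auto intro: differentiable_imp_continuous_on)

lemma Ck_on_mono: "Ck_on k S f \<Longrightarrow> j \<le> k \<Longrightarrow> Ck_on j S f"
  by (induction k) (auto simp: le_Suc_eq dest: Ck_on_SucD simp del: Ck_on.simps(2))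

lemma Ck_on_continuous: "Ck_on k S f \<Longrightarrow> continuous_on S f"
  using Ck_on_mono[of k S f 0] by simp

lemma Ck_on_partial: "Ck_on (Suc k) S f \<Longrightarrow> b \<in> Basis \<Longrightarrow> Ck_on k S (partial_on S b f)"
  by simp

lemma partial_on_subset:
  assumes "good_domain S" "S \<subseteq> T" "x \<in> S" "Ck_on (Suc k) T f"
  shows "partial_on S b f x = partial_on T b f x"
proof -
  have "x \<in> T" using assms by auto
  from has_derivative_subset[OF Ck_on_has_derivative[OF assms(4) this] assms(2)]
  show ?thesis by (rule partial_on_eq[OF assms(1,3)])
qed

lemma Ck_on_subset:
  assumes "good_domain S" "S \<subseteq> T" "Ck_on k T f"
  shows "Ck_on k S f"
  using assms(3)
proof (induction k arbitrary: f)
  case 0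
  then show ?case using assms(2) by (auto intro: continuous_on_subset)
next
  case (Suc k)
  show ?case
  proof (rule Ck_on_SucI[OF assms(1)])
    fix x assume "x \<in> S"
    then show "(f has_derivative (\<lambda>v. partial_on T v f x)) (at x within S)"
      using Ck_on_has_derivative[OF Suc.prems] assms(2) has_derivative_subset by blast
  next
    fix b :: 'a assume "b \<in> Basis"
    then show "Ck_on k S (partial_on T b f)"
      using Suc.prems by (intro Suc.IH) simp
  qed
qed

text \<open>Serves to glue a move inside a ball with the identity off a smaller closed set. Openness
  makes the derivative within the union equal to the one within either piece.\<close>

lemma Ck_on_open_Un:
  assumes "open S" "open T" "Ck_on k S f" "Ck_on k T f"
  shows "Ck_on k (S \<union> T) f"
  using assms(3,4)
proof (induction k arbitrary: f)
  case 0
  then show ?case using assms by (simp add: continuous_on_open_Un)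
next
  case (Suc k)
  have *: "partial_on (S \<union> T) b f x = partial_on A b f x" if "x \<in> A" "open A" "A \<subseteq> S \<union> T" for A b x
    using at_within_open[OF that(1,2)] at_within_open[of x "S \<union> T"] that open_Un[OF assms(1,2)]
    by (auto simp: partial_on_def)
  have "f differentiable_on (S \<union> T)"
    using Suc.prems assms(1,2) open_Un[OF assms(1,2)]
    by (auto simp: differentiable_on_eq_differentiable_at)
  moreover have "Ck_on k (S \<union> T) (partial_on (S \<union> T) b f)" if "b \<in> Basis" for b
  proof (rule Suc.IH)
    show "Ck_on k S (partial_on (S \<union> T) b f)"
      using Suc.prems(1) that * assms(1)
      by (subst Ck_on_cong[where g = "partial_on S b f"]) auto
    show "Ck_on k T (partial_on (S \<union> T) b f)"
      using Suc.prems(2) that * assms(2)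
      by (subst Ck_on_cong[where g = "partial_on T b f"]) auto
  qed
  ultimately show ?case by simp
qed

lemma Ck_on_const: "good_domain S \<Longrightarrow> Ck_on k S (\<lambda>_. c)"
proof (induction k arbitrary: c)
  case (Suc k)
  then show ?case by (intro Ck_on_SucI[where f' = "\<lambda>_ _. 0"]) auto
qed simp

lemma Ck_on_bounded_linear:
  assumes "good_domain S" "bounded_linear f"
  shows "Ck_on k S f"
proof (cases k)
  case 0
  then show ?thesis using assms by (simp add: linear_continuous_on)
next
  case (Suc j)
  have "Ck_on (Suc j) S f"
    using assms by (intro Ck_on_SucI[where f' = "\<lambda>_. f"] Ck_on_const) (auto intro: bounded_linear_imp_has_derivative)
  then show ?thesis using Suc by simp
qed

lemma Ck_on_add:
  assumes "good_domain S" "Ck_on k S f" "Ck_on k S g"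
  shows "Ck_on k S (\<lambda>x. f x + g x)"
  using assms(2,3)
proof (induction k arbitrary: f g)
  case 0
  then show ?case by (simp add: continuous_on_add)
next
  case (Suc k)
  show ?case
  proof (rule Ck_on_SucI[OF assms(1)])
    fix x assume "x \<in> S"
    then show "((\<lambda>x. f x + g x) has_derivative
        (\<lambda>v. partial_on S v f x + partial_on S v g x)) (at x within S)"
      by (intro has_derivative_add Ck_on_has_derivative[OF Suc.prems(1)]
          Ck_on_has_derivative[OF Suc.prems(2)])
  qed (use Suc in auto)
qed

lemma Ck_on_bounded_bilinear:
  assumes "good_domain S" "bounded_bilinear B" "Ck_on k S f" "Ck_on k S g"
  shows "Ck_on k S (\<lambda>x. B (f x) (g x))"
  using assms(3,4)
proof (induction k arbitrary: f g)
  case 0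
  then show ?case using assms(2) by (simp add: bounded_bilinear.continuous_on)
next
  case (Suc k)
  show ?case
  proof (rule Ck_on_SucI[OF assms(1)])
    fix x assume "x \<in> S"
    then show "((\<lambda>x. B (f x) (g x)) has_derivative
        (\<lambda>v. B (f x) (partial_on S v g x) + B (partial_on S v f x) (g x))) (at x within S)"
      by (intro bounded_bilinear.FDERIV[OF assms(2)] Ck_on_has_derivative[OF Suc.prems(1)]
          Ck_on_has_derivative[OF Suc.prems(2)])
  next
    fix b :: 'a assume "b \<in> Basis"
    then show "Ck_on k S (\<lambda>x. B (f x) (partial_on S b g x) + B (partial_on S b f x) (g x))"
      using Suc by (intro Ck_on_add assms(1) Suc.IH) (auto dest: Ck_on_SucD simp del: Ck_on.simps(2) intro: Ck_on_partial)
  qed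
qed

lemma Ck_on_scaleR:
  assumes "good_domain S" "Ck_on k S f" "Ck_on k S g"
  shows "Ck_on k S (\<lambda>x. f x *\<^sub>R g x)"
  by (rule Ck_on_bounded_bilinear[OF assms(1) bounded_bilinear_scaleR assms(2,3)])

lemma Ck_on_mult:
  fixes f g :: "'a::euclidean_space \<Rightarrow> real"
  assumes "good_domain S" "Ck_on k S f" "Ck_on k S g"
  shows "Ck_on k S (\<lambda>x. f x * g x)"
  using Ck_on_scaleR[OF assms] by simp

lemma Ck_on_cmult:
  fixes f :: "'a::euclidean_space \<Rightarrow> real"
  assumes "good_domain S" "Ck_on k S f"
  shows "Ck_on k S (\<lambda>x. c * f x)"
  by (intro Ck_on_mult Ck_on_const assms)

lemma Ck_on_minus:
  assumes "good_domain S" "Ck_on k S f"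
  shows "Ck_on k S (\<lambda>x. - f x)"
  using Ck_on_scaleR[OF assms(1) Ck_on_const[OF assms(1), of k "-1::real"] assms(2)] by simp

lemma Ck_on_diff:
  assumes "good_domain S" "Ck_on k S f" "Ck_on k S g"
  shows "Ck_on k S (\<lambda>x. f x - g x)"
  using Ck_on_add[OF assms(1,2) Ck_on_minus[OF assms(1,3)]] by simp

lemma Ck_on_sum:
  assumes "good_domain S" "\<And>i. i \<in> I \<Longrightarrow> Ck_on k S (f i)"
  shows "Ck_on k S (\<lambda>x. \<Sum>i\<in>I. f i x)"
  using assms(2)
  by (induction I rule: infinite_finite_induct) (auto intro!: Ck_on_const Ck_on_add assms(1))

lemma Ck_on_prod:
  fixes f :: "_ \<Rightarrow> _ \<Rightarrow> real"
  assumes "good_domain S" "\<And>i. i \<in> I \<Longrightarrow> Ck_on k S (f i)"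
  shows "Ck_on k S (\<lambda>x. \<Prod>i\<in>I. f i x)"
  using assms(2)
  by (induction I rule: infinite_finite_induct) (auto intro!: Ck_on_const Ck_on_mult assms(1))

lemma Ck_on_power:
  fixes f :: "'a::euclidean_space \<Rightarrow> real"
  assumes "good_domain S" "Ck_on k S f"
  shows "Ck_on k S (\<lambda>x. f x ^ n)"
  by (induction n) (auto intro!: Ck_on_const Ck_on_mult assms)

lemma Ck_on_inner:
  assumes "good_domain S" "Ck_on k S f"
  shows "Ck_on k S (\<lambda>x. f x \<bullet> c)"
  by (rule Ck_on_bounded_bilinear[OF assms(1) bounded_bilinear_inner assms(2) Ck_on_const[OF assms(1)]])

lemma Ck_on_inverse:
  fixes f :: "'a::euclidean_space \<Rightarrow> real"
  assumes "good_domain S" "Ck_on k S f" "\<And>x. x \<in> S \<Longrightarrow> f x \<noteq> 0"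
  shows "Ck_on k S (\<lambda>x. inverse (f x))"
  using assms(2)
proof (induction k)
  case 0
  then show ?case using assms(3) by (simp add: continuous_on_inverse)
next
  case (Suc k)
  show ?case
  proof (rule Ck_on_SucI[OF assms(1)])
    fix x assume "x \<in> S"
    then show "((\<lambda>x. inverse (f x)) has_derivative
        (\<lambda>v. - (inverse (f x) * partial_on S v f x * inverse (f x)))) (at x within S)"
      by (intro Deriv.has_derivative_inverse Ck_on_has_derivative[OF Suc.prems] assms(3))
  next
    fix b :: 'a assume "b \<in> Basis"
    then show "Ck_on k S (\<lambda>x. - (inverse (f x) * partial_on S b f x * inverse (f x)))"
      using Suc by (intro Ck_on_minus Ck_on_mult assms(1) Suc.IH)
        (auto dest: Ck_on_SucD simp del: Ck_on.simps(2) intro: Ck_on_partial)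
  qed
qed

lemma partial_on_sum_Basis:
  assumes "Ck_on (Suc k) S f" "x \<in> S"
  shows "partial_on S v f x = (\<Sum>c\<in>Basis. (v \<bullet> c) *\<^sub>R partial_on S c f x)"
proof -
  interpret g: bounded_linear "\<lambda>v. partial_on S v f x"
    by (rule has_derivative_bounded_linear[OF Ck_on_has_derivative[OF assms]])
  have "partial_on S v f x = partial_on S (\<Sum>c\<in>Basis. (v \<bullet> c) *\<^sub>R c) f x"
    by (simp add: euclidean_representation)
  also have "\<dots> = (\<Sum>c\<in>Basis. (v \<bullet> c) *\<^sub>R partial_on S c f x)"
    by (simp only: g.sum g.scaleR)
  finally show ?thesis .
qed

text \<open>A partial derivative of the composition is a sum of products of partials of
  \<open>f\<close> with partials of \<open>g\<close> taken at \<open>f x\<close>. The latter are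
  again compositions with the same \<open>f\<close>, so the induction varies \<open>g\<close> and
  keeps \<open>f\<close>.\<close>

lemma Ck_on_compose:
  fixes f :: "'a::euclidean_space \<Rightarrow> 'c::euclidean_space" and g :: "'c \<Rightarrow> 'b::real_normed_vector"
  assumes "good_domain S" "f ` S \<subseteq> T" "Ck_on k S f" "Ck_on k T g"
  shows "Ck_on k S (\<lambda>x. g (f x))"
  using assms(3,4)
proof (induction k arbitrary: g)
  case 0
  then show ?case using assms(2) by (auto intro: continuous_on_compose2)
next
  case (Suc k)
  show ?case
  proof (rule Ck_on_SucI[OF assms(1)])
    fix x assume x: "x \<in> S"
    then have fx: "f x \<in> T" using assms(2) by auto
    have g: "(g has_derivative (\<lambda>v. partial_on T v g (f x))) (at (f x) within T)"
      by (rule Ck_on_has_derivative[OF Suc.prems(2) fx])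
    have "((\<lambda>x. g (f x)) has_derivative (\<lambda>v. partial_on T (partial_on S v f x) g (f x))) (at x within S)"
      by (rule has_derivative_in_compose[OF Ck_on_has_derivative[OF Suc.prems(1) x]
            has_derivative_subset[OF g assms(2)]])
    then show "((\<lambda>x. g (f x)) has_derivative
        (\<lambda>v. \<Sum>c\<in>Basis. (partial_on S v f x \<bullet> c) *\<^sub>R partial_on T c g (f x))) (at x within S)"
      by (subst (asm) partial_on_sum_Basis[OF Suc.prems(2) fx])
  next
    fix b :: 'a assume "b \<in> Basis"
    then show "Ck_on k S (\<lambda>x. \<Sum>c\<in>Basis. (partial_on S b f x \<bullet> c) *\<^sub>R partial_on T c g (f x))"
      using Suc by (intro Ck_on_sum Ck_on_scaleR Ck_on_inner assms(1) Suc.IH)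
        (auto dest: Ck_on_SucD simp del: Ck_on.simps(2) intro: Ck_on_partial)
  qed
qed

lemma Ck_on_Pair:
  assumes "good_domain S" "Ck_on k S f" "Ck_on k S g"
  shows "Ck_on k S (\<lambda>x. (f x, g x))"
  using assms(2,3)
proof (induction k arbitrary: f g)
  case 0
  then show ?case by (simp add: continuous_on_Pair)
next
  case (Suc k)
  show ?case
  proof (rule Ck_on_SucI[OF assms(1)])
    fix x assume "x \<in> S"
    then show "((\<lambda>x. (f x, g x)) has_derivative
        (\<lambda>v. (partial_on S v f x, partial_on S v g x))) (at x within S)"
      by (intro has_derivative_Pair Ck_on_has_derivative[OF Suc.prems(1)]
          Ck_on_has_derivative[OF Suc.prems(2)])
  qed (use Suc in auto)
qed

lemma Ck_on_id: "good_domain S \<Longrightarrow> Ck_on k S (\<lambda>x. x)"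
  by (intro Ck_on_bounded_linear bounded_linear_ident)

lemma Ck_on_fst: "good_domain S \<Longrightarrow> Ck_on k S fst"
  and Ck_on_snd: "good_domain S \<Longrightarrow> Ck_on k S snd"
  by (intro Ck_on_bounded_linear bounded_linear_fst bounded_linear_snd; assumption)+

section \<open>Cutoff functions of class C^k\<close>

text \<open>Only finitely many derivatives are asked for, so a power of the positive part can
  replace \<open>exp (- 1 / t)\<close>. Its derivative is a multiple of the next lower power, which
  drives the induction.\<close>

lemma Ck_on_pos_part_power: "Ck_on k UNIV (\<lambda>t::real. max 0 t ^ Suc k)"
proof (induction k)
  case 0
  show ?case by (simp add: continuous_on_max continuous_on_id)
next
  case (Suc k)
  show ?case
  proof (rule Ck_on_SucI[where f' = "\<lambda>t v. (real (Suc (Suc k)) * max 0 t ^ Suc k) * v"])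
    fix t :: real
    have "((\<lambda>t. max 0 t ^ Suc (Suc k)) has_real_derivative real (Suc (Suc k)) * max 0 t ^ Suc k) (at t)"
    proof (rule linorder_cases[of t 0])
      assume "t < 0"
      moreover have "((\<lambda>_. 0) has_real_derivative real (Suc (Suc k)) * max 0 t ^ Suc k) (at t)"
        using \<open>t < 0\<close> by (simp add: max_def)
      ultimately show ?thesis
        by (elim has_field_derivative_transform_within_open[where S = "{..<0}"]) (auto simp: max_def)
    next
      assume "t > 0"
      moreover have "((\<lambda>s. s ^ Suc (Suc k)) has_real_derivative real (Suc (Suc k)) * max 0 t ^ Suc k) (at t)"
        using \<open>t > 0\<close> DERIV_pow[of "Suc (Suc k)" t] by (simp add: max_def)
      ultimately show ?thesis
        by (elim has_field_derivative_transform_within_open[where S = "{0<..}"]) (auto simp: max_def)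
    next
      assume t: "t = 0"
      have "((\<lambda>h::real. max 0 h ^ Suc k) \<longlongrightarrow> max 0 0 ^ Suc k) (at 0)"
        by (intro tendsto_intros)
      then have "((\<lambda>h::real. max 0 h ^ Suc k) \<longlongrightarrow> 0) (at 0)" by simp
      moreover have "eventually (\<lambda>h::real. max 0 h ^ Suc k = (max 0 (0 + h) ^ Suc (Suc k) - max 0 0 ^ Suc (Suc k)) / h) (at 0)"
        by (rule eventually_mono[OF eventually_neq_at_within[of 0]]) (auto simp: max_def)
      ultimately have "((\<lambda>h::real. (max 0 (0 + h) ^ Suc (Suc k) - max 0 0 ^ Suc (Suc k)) / h) \<longlongrightarrow> 0) (at 0)"
        by (rule Lim_transform_eventually)
      then show ?thesis by (simp add: t has_field_derivative_iff DERIV_def)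
    qed
    then show "((\<lambda>t. max 0 t ^ Suc (Suc k)) has_derivative (\<lambda>v. (real (Suc (Suc k)) * max 0 t ^ Suc k) * v)) (at t)"
      by (simp only: has_field_derivative_def)
  next
    fix b :: real
    assume "b \<in> Basis"
    then show "Ck_on k UNIV (\<lambda>t. real (Suc (Suc k)) * max 0 t ^ Suc k * b)"
      using Suc by (intro Ck_on_mult Ck_on_const) auto
  qed auto
qed

text \<open>With \<open>h t = max 0 t ^ Suc k\<close>, the step is \<open>1 - h (1 - h t)\<close>:
  the inner \<open>h\<close> makes it constant for \<open>t \<le> 0\<close>, the outer one as soon
  as \<open>h t \<ge> 1\<close>.\<close>

lemma Ck_step_exists:
  obtains \<theta> :: "real \<Rightarrow> real" where "Ck_on k UNIV \<theta>" "\<And>t. 0 \<le> \<theta> t" "\<And>t. \<theta> t \<le> 1"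
    "\<And>t. t \<le> 0 \<Longrightarrow> \<theta> t = 0" "\<And>t. t \<ge> 1 \<Longrightarrow> \<theta> t = 1"
proof
  let ?h = "\<lambda>t::real. max 0 t ^ Suc k"
  let ?\<theta> = "\<lambda>t. 1 - ?h (1 - ?h t)"
  have h: "Ck_on k UNIV ?h" by (rule Ck_on_pos_part_power)
  show "Ck_on k UNIV ?\<theta>"
    by (intro Ck_on_diff Ck_on_const Ck_on_compose[OF _ _ _ h] h) auto
  have "0 \<le> ?h t" for t by simp
  have le: "?h t \<le> 1" if "t \<le> 1" for t
    using that by (intro power_le_one) auto
  show "?\<theta> t \<le> 1" for t by simp
  show "0 \<le> ?\<theta> t" for t using le[of "1 - ?h t"] by simp
  show "?\<theta> t = 0" if "t \<le> 0" for t using that by (simp add: max_def)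
  show "?\<theta> t = 1" if "t \<ge> 1" for t
  proof -
    have "?h t \<ge> 1" using that by (simp add: max_def del: power_Suc)
    then show ?thesis by (simp add: max_def)
  qed
qed

lemma Ck_bump_exists:
  fixes p :: "'a::euclidean_space"
  assumes "r > 0"
  obtains \<phi> :: "'a \<Rightarrow> real" where "Ck_on k UNIV \<phi>" "\<And>x. 0 \<le> \<phi> x" "\<And>x. \<phi> x \<le> 1"
    "\<And>x. x \<in> ball p r \<Longrightarrow> \<phi> x = 1" "\<And>x. x \<notin> cball p (2 * r) \<Longrightarrow> \<phi> x = 0"
proof -
  obtain \<theta> :: "real \<Rightarrow> real" where \<theta>: "Ck_on k UNIV \<theta>" "\<And>t. 0 \<le> \<theta> t" "\<And>t. \<theta> t \<le> 1"
    "\<And>t. t \<le> 0 \<Longrightarrow> \<theta> t = 0" "\<And>t. t \<ge> 1 \<Longrightarrow> \<theta> t = 1"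
    using Ck_step_exists by blast
  \<comment> \<open>\<open>?q x\<close> is \<open>2 - (dist p x / r)^2\<close>, at least 1 within
    distance \<open>r\<close> and negative beyond \<open>2 r\<close>. The squared distance is
    expanded in coordinates so that the rules for sums, powers and inner products prove it
    smooth.\<close>
  let ?q = "\<lambda>x. 2 - (\<Sum>b\<in>Basis. ((x - p) \<bullet> b)\<^sup>2) * (1 / r\<^sup>2)"
  have q: "?q x = 2 - (dist p x)\<^sup>2 / r\<^sup>2" for x
  proof -
    have "(dist p x)\<^sup>2 = (x - p) \<bullet> (x - p)"
      by (simp add: dist_norm norm_minus_commute[of p] power2_norm_eq_inner)
    also have "\<dots> = (\<Sum>b\<in>Basis. ((x - p) \<bullet> b)\<^sup>2)"
      by (subst euclidean_inner) (simp add: power2_eq_square)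
    finally show ?thesis by simp
  qed
  show ?thesis
  proof
    show "Ck_on k UNIV (\<lambda>x. \<theta> (?q x))"
      by (intro Ck_on_compose[OF _ _ _ \<theta>(1)] Ck_on_diff Ck_on_const Ck_on_mult Ck_on_sum
          Ck_on_power Ck_on_inner Ck_on_id) auto
    show "\<theta> (?q x) = 1" if "x \<in> ball p r" for x
    proof (rule \<theta>(5))
      have "(dist p x)\<^sup>2 \<le> r\<^sup>2" using that by (intro power_mono) auto
      then show "1 \<le> ?q x" unfolding q using assms by (simp add: divide_simps)
    qed
    show "\<theta> (?q x) = 0" if "x \<notin> cball p (2 * r)" for x
    proof (rule \<theta>(4))
      have "(2 * r)\<^sup>2 \<le> (dist p x)\<^sup>2" using that assms by (intro power_mono) auto
      then have "4 * r\<^sup>2 \<le> (dist p x)\<^sup>2" by (simp add: power_mult_distrib)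
      then have "2 * r\<^sup>2 \<le> (dist p x)\<^sup>2" using zero_le_power2[of r] by linarith
      then show "?q x \<le> 0" unfolding q using assms by (simp add: divide_simps)
    qed
  qed (use \<theta> in auto)
qed

section \<open>Pushing level sets along a direction\<close>

lemma Ck_on_partial_any:
  assumes "good_domain S" "Ck_on (Suc k) S f"
  shows "Ck_on k S (partial_on S v f)"
  using assms
  by (subst Ck_on_cong[OF partial_on_sum_Basis[OF assms(2)]])
    (auto intro!: Ck_on_sum Ck_on_scaleR Ck_on_const)

lemma Ck_on_open_has_derivative:
  assumes "open S" "Ck_on (Suc k) S f" "x \<in> S"
  shows "(f has_derivative (\<lambda>v. partial_on S v f x)) (at x)"
  using Ck_on_has_derivative[OF assms(2,3)] at_within_open[OF assms(3,1)] by simp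

text \<open>The inverse function theorem yields only differentiability of \<open>T\<close>, together
  with a formula for the derivative. That formula involves the first partials of \<alpha> at
  \<open>w\<close> and of \<beta> at \<open>T w\<close>, which are of class C^k. Hence if
  \<open>T\<close> is of class C^j with \<open>j \<le> k\<close>, so is its derivative, and the
  regularity climbs to \<open>Suc k\<close>.\<close>

lemma Ck_on_level_transport:
  fixes \<alpha> \<beta> :: "'a::euclidean_space \<Rightarrow> real"
  assumes Om: "open \<Omega>" and e: "norm e = 1"
    and ab: "Ck_on (Suc k) \<Omega> \<alpha>" "Ck_on (Suc k) \<Omega> \<beta>"
    and T: "\<And>w. w \<in> \<Omega> \<Longrightarrow> T w \<in> \<Omega>" "\<And>w. w \<in> \<Omega> \<Longrightarrow> T w = w + \<tau> w *\<^sub>R e"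
      "\<And>w. w \<in> \<Omega> \<Longrightarrow> \<beta> (T w) = \<alpha> w"
    and inj: "\<And>w s. w \<in> \<Omega> \<Longrightarrow> w + s *\<^sub>R e \<in> \<Omega> \<Longrightarrow> \<beta> (w + s *\<^sub>R e) = \<beta> w \<Longrightarrow> s = 0"
    and nz: "\<And>w. w \<in> \<Omega> \<Longrightarrow> partial_on \<Omega> e \<beta> w \<noteq> 0"
  shows "Ck_on (Suc k) \<Omega> T"
proof -
  \<comment> \<open>\<open>\<Psi> \<beta>\<close> replaces the \<open>e\<close>-coordinate by \<open>\<beta>\<close>, so that \<open>T\<close> is the inverse of \<open>\<Psi> \<beta>\<close> after \<open>\<Psi> \<alpha>\<close>.\<close>
  define \<Psi> where "\<Psi> = (\<lambda>(\<gamma>::'a \<Rightarrow> real) w. w + (\<gamma> w - w \<bullet> e) *\<^sub>R e)"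
  have ee: "e \<bullet> e = 1" using e by (simp add: norm_eq_1)
  have \<Psi>e: "\<Psi> \<gamma> w \<bullet> e = \<gamma> w" for \<gamma> w
    by (simp add: \<Psi>_def inner_add_left ee)
  have injP: "inj_on (\<Psi> \<beta>) \<Omega>"
  proof (rule inj_onI)
    fix w w' assume w: "w \<in> \<Omega>" "w' \<in> \<Omega>" "\<Psi> \<beta> w = \<Psi> \<beta> w'"
    define s where "s = (\<beta> w - w \<bullet> e) - (\<beta> w' - w' \<bullet> e)"
    have w': "w' = w + s *\<^sub>R e" using w(3) by (simp add: \<Psi>_def s_def algebra_simps)
    moreover have "\<beta> w' = \<beta> w" using \<Psi>e[of \<beta>] w(3) by metis
    ultimately have "s = 0" using inj[of w s] w by simp
    then show "w = w'" using w' by simp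
  qed
  define g where "g = inv_into \<Omega> (\<Psi> \<beta>)"
  have gT: "T w = g (\<Psi> \<alpha> w)" if "w \<in> \<Omega>" for w
  proof -
    have "\<Psi> \<beta> (T w) = \<Psi> \<alpha> w"
      using T(2,3)[OF that] by (simp add: \<Psi>_def inner_add_left ee algebra_simps)
    then show ?thesis using injP T(1)[OF that] by (metis g_def inv_into_f_f)
  qed
  \<comment> \<open>Obtained by differentiating
    \<open>\<beta> (w + \<tau> w *\<^sub>R e) = \<alpha> w\<close> in direction \<open>v\<close> and
    solving for the derivative of \<tau>.\<close>
  let ?T' = "\<lambda>w v. v + ((partial_on \<Omega> v \<alpha> w - partial_on \<Omega> v \<beta> (T w)) / partial_on \<Omega> e \<beta> (T w)) *\<^sub>R e"
  have deriv: "(T has_derivative ?T' w) (at w)" if w: "w \<in> \<Omega>" for w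
  proof -
    let ?b = "\<lambda>v. partial_on \<Omega> v \<beta> (T w)" and ?a = "\<lambda>v. partial_on \<Omega> v \<alpha> w"
    have D: "(\<beta> has_derivative ?b) (at (T w))" "(\<alpha> has_derivative ?a) (at w)"
      using Ck_on_open_has_derivative Om ab T(1) w by blast+
    interpret b: bounded_linear ?b by (rule has_derivative_bounded_linear[OF D(1)])
    let ?B = "\<lambda>v. v + (?b v - v \<bullet> e) *\<^sub>R e" and ?A = "\<lambda>v. v + (?a v - v \<bullet> e) *\<^sub>R e"
    \<comment> \<open>The inverse of \<open>?B\<close>: since \<open>?B\<close> replaces the
      \<open>e\<close>-component of its argument by \<open>?b\<close>, the multiple \<open>s\<close>
      of \<open>e\<close> to be added to \<open>u\<close> solves
      \<open>?b u + s * ?b e = u \<bullet> e\<close>.\<close>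
    let ?g' = "\<lambda>u. u + ((u \<bullet> e - ?b u) / ?b e) *\<^sub>R e"
    have "(\<Psi> \<beta> has_derivative ?B) (at (T w))"
      unfolding \<Psi>_def by (auto intro!: derivative_eq_intros D(1))
    moreover have "continuous_on \<Omega> (\<Psi> \<beta>)"
      unfolding \<Psi>_def using Ck_on_continuous[OF ab(2)] by (intro continuous_intros)
    moreover have "?B \<circ> ?g' = id"
    proof
      fix u
      have "?b e \<noteq> 0" using nz T(1) w by blast
      then show "(?B \<circ> ?g') u = id u"
        by (simp add: b.add b.scaleR inner_add_left ee)
    qed
    ultimately have "(g has_derivative ?g') (at (\<Psi> \<beta> (T w)))"
      by (intro has_derivative_inverse_strong[OF Om T(1)[OF w], where f = "\<Psi> \<beta>" and f' = ?B])
        (auto simp: g_def injP)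
    moreover have "\<Psi> \<beta> (T w) = \<Psi> \<alpha> w"
      using T(2,3)[OF w] by (simp add: \<Psi>_def inner_add_left ee algebra_simps)
    moreover have "(\<Psi> \<alpha> has_derivative ?A) (at w)"
      unfolding \<Psi>_def by (auto intro!: derivative_eq_intros D(2))
    ultimately have "((\<lambda>w. g (\<Psi> \<alpha> w)) has_derivative (\<lambda>v. ?g' (?A v))) (at w)"
      using has_derivative_compose[of "\<Psi> \<alpha>" ?A w UNIV g ?g'] by simp
    moreover have "?g' (?A v) = ?T' w v" for v
    proof -
      have "?b e \<noteq> 0" using nz T(1) w by blast
      then have "((?A v \<bullet> e - ?b (?A v)) / ?b e) = (?a v - ?b v) / ?b e - (?a v - v \<bullet> e)"
        by (simp add: b.add b.scaleR inner_add_left ee divide_simps)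
      then show ?thesis by (simp add: scaleR_left_diff_distrib)
    qed
    ultimately have "((\<lambda>w. g (\<Psi> \<alpha> w)) has_derivative ?T' w) (at w)" by (simp only:)
    then show ?thesis
      by (rule has_derivative_transform_within_open[OF _ Om w]) (simp add: gT)
  qed
  have "Ck_on j \<Omega> T" if "j \<le> Suc k" for j
    using that
  proof (induction j)
    case 0
    then show ?case
      using deriv by (auto intro!: continuous_at_imp_continuous_on has_derivative_continuous)
  next
    case (Suc j)
    show ?case
    proof (rule Ck_on_SucI)
      show "(T has_derivative ?T' w) (at w within \<Omega>)" if "w \<in> \<Omega>" for w
        using deriv[OF that] by (rule has_derivative_at_withinI)
      fix b :: 'a assume "b \<in> Basis"
      have T: "Ck_on j \<Omega> T" "T ` \<Omega> \<subseteq> \<Omega>" using Suc T(1) by auto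
      have p: "Ck_on j \<Omega> (partial_on \<Omega> v \<alpha>)" "Ck_on j \<Omega> (partial_on \<Omega> v \<beta>)" for v
        using Suc.prems Om ab by (auto intro!: Ck_on_partial_any intro: Ck_on_mono simp del: Ck_on.simps(2))
      show "Ck_on j \<Omega> (\<lambda>w. ?T' w b)"
        unfolding divide_inverse using Om nz T
        by (intro Ck_on_add Ck_on_const Ck_on_scaleR Ck_on_mult Ck_on_diff Ck_on_inverse p
          Ck_on_compose[OF _ T(2,1) p(2)]) auto
    qed (use Om in auto)
  qed
  then show ?thesis by blast
qed

lemma Ck_on_line_DERIV:
  fixes f :: "'a::euclidean_space \<Rightarrow> real"
  assumes "Ck_on (Suc k) S f" "w + t *\<^sub>R e \<in> interior S"
  shows "((\<lambda>t. f (w + t *\<^sub>R e)) has_real_derivative partial_on S e f (w + t *\<^sub>R e)) (at t)"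
proof -
  have "(f has_derivative (\<lambda>v. partial_on S v f (w + t *\<^sub>R e))) (at (w + t *\<^sub>R e) within S)"
    using assms interior_subset by (intro Ck_on_has_derivative) auto
  then have D: "(f has_derivative (\<lambda>v. partial_on S v f (w + t *\<^sub>R e))) (at (w + t *\<^sub>R e))"
    by (simp add: at_within_interior[OF assms(2)])
  have "((\<lambda>t. f (w + t *\<^sub>R e)) has_derivative (\<lambda>h. partial_on S (h *\<^sub>R e) f (w + t *\<^sub>R e))) (at t)"
    by (rule has_derivative_compose[of "\<lambda>t. w + t *\<^sub>R e", OF _ D]) (auto intro!: derivative_eq_intros)
  then show ?thesis
    by (simp add: linear_cmul[OF has_derivative_linear[OF D]] has_field_derivative_def mult_commute_abs)
qed

lemma line_strict_mono:
  fixes \<beta> :: "'a::euclidean_space \<Rightarrow> real"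
  assumes "open \<Omega>" "convex \<Omega>" "Ck_on (Suc k) \<Omega> \<beta>"
    and "\<And>w. w \<in> \<Omega> \<Longrightarrow> partial_on \<Omega> e \<beta> w > 0"
    and w: "w + a *\<^sub>R e \<in> \<Omega>" "w + b *\<^sub>R e \<in> \<Omega>" "a < b"
  shows "\<beta> (w + a *\<^sub>R e) < \<beta> (w + b *\<^sub>R e)"
proof (rule DERIV_pos_imp_increasing[OF w(3)])
  fix t assume t: "a \<le> t" "t \<le> b"
  define u where "u = (t - a) / (b - a)"
  have u: "t = a + u * (b - a)" "0 \<le> u" "u \<le> 1" using w(3) t by (auto simp: u_def)
  have "w + t *\<^sub>R e = (1 - u) *\<^sub>R (w + a *\<^sub>R e) + u *\<^sub>R (w + b *\<^sub>R e)"
    by (simp add: u(1) algebra_simps)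
  then have "w + t *\<^sub>R e \<in> \<Omega>"
    using u w convexD_alt[OF assms(2), of "w + a *\<^sub>R e" "w + b *\<^sub>R e" u] by simp
  then show "\<exists>y. ((\<lambda>t. \<beta> (w + t *\<^sub>R e)) has_real_derivative y) (at t) \<and> 0 < y"
    using Ck_on_line_DERIV[OF assms(3), of w t e] assms(1,4) by (auto simp: interior_open)
qed

text \<open>Every line in direction \<open>e\<close> meets \<open>\<Omega> - C\<close> on both sides
  of \<open>w\<close>. There \<alpha> and \<beta> agree, and \<alpha> increases along the line, so
  the values of \<beta> at these two points enclose \<open>\<alpha> w\<close>; the intermediate
  value theorem and monotonicity of \<beta> give exactly one point of the line with
  \<open>\<beta> = \<alpha> w\<close>. Off \<open>C\<close> that point is \<open>w\<close> itself,
  so \<open>T\<close> extends by the identity. The last conclusion records the uniqueness, by which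
  the transport with \<alpha> and \<beta> exchanged will be recognised as the inverse of
  \<open>T\<close>.\<close>

lemma level_transport_exists:
  fixes \<alpha> \<beta> :: "'a::euclidean_space \<Rightarrow> real"
  assumes Om: "open \<Omega>" "convex \<Omega>" and C: "closed C" "C \<subseteq> \<Omega>" and e: "norm e = 1"
    and ab: "Ck_on (Suc k) \<Omega> \<alpha>" "Ck_on (Suc k) \<Omega> \<beta>"
    and pos: "\<And>w. w \<in> \<Omega> \<Longrightarrow> partial_on \<Omega> e \<alpha> w > 0" "\<And>w. w \<in> \<Omega> \<Longrightarrow> partial_on \<Omega> e \<beta> w > 0"
    and eq: "\<And>w. w \<in> \<Omega> - C \<Longrightarrow> \<alpha> w = \<beta> w"
    and exit: "\<And>w. w \<in> \<Omega> \<Longrightarrow> \<exists>a>0. w + a *\<^sub>R e \<in> \<Omega> - C" "\<And>w. w \<in> \<Omega> \<Longrightarrow> \<exists>a<0. w + a *\<^sub>R e \<in> \<Omega> - C"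
  obtains T where "Ck_on (Suc k) UNIV T" "\<And>w. \<exists>s. T w = w + s *\<^sub>R e"
    "\<And>w. w \<notin> \<Omega> \<Longrightarrow> T w = w" "\<And>w. w \<in> \<Omega> \<Longrightarrow> T w \<in> \<Omega>" "\<And>w. w \<in> \<Omega> \<Longrightarrow> \<beta> (T w) = \<alpha> w"
    "\<And>w s. w \<in> \<Omega> \<Longrightarrow> w + s *\<^sub>R e \<in> \<Omega> \<Longrightarrow> \<beta> (w + s *\<^sub>R e) = \<alpha> w \<Longrightarrow> T w = w + s *\<^sub>R e"
proof -
  note mono = line_strict_mono[OF Om(1,2) ab(2) pos(2)]
  note mono\<alpha> = line_strict_mono[OF Om(1,2) ab(1) pos(1)]
  have uniq: "s = s'" if "w \<in> \<Omega>" "w + s *\<^sub>R e \<in> \<Omega>" "w + s' *\<^sub>R e \<in> \<Omega>" "\<beta> (w + s *\<^sub>R e) = \<beta> (w + s' *\<^sub>R e)" for w s s'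
    using mono[of w s s'] mono[of w s' s] that by (cases s s' rule: linorder_cases) auto
  have ex: "\<exists>s. w + s *\<^sub>R e \<in> \<Omega> \<and> \<beta> (w + s *\<^sub>R e) = \<alpha> w" if w: "w \<in> \<Omega>" for w
  proof -
    obtain a b where a: "a < 0" "w + a *\<^sub>R e \<in> \<Omega> - C" and b: "b > 0" "w + b *\<^sub>R e \<in> \<Omega> - C"
      using exit w by meson
    have seg: "w + t *\<^sub>R e \<in> \<Omega>" if "t \<in> {a..b}" for t
    proof -
      have "(\<lambda>t. w + t *\<^sub>R e) -` \<Omega> = (\<lambda>t. t *\<^sub>R e) -` ((+) (-w) ` \<Omega>)"
        by (auto simp: image_iff algebra_simps)
      moreover have "convex ((\<lambda>t. t *\<^sub>R e) -` ((+) (-w) ` \<Omega>))"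
        using Om(2) by (intro convex_linear_vimage convex_translation) (auto intro: linearI simp: algebra_simps)
      ultimately have "convex ((\<lambda>t. w + t *\<^sub>R e) -` \<Omega>)" by simp
      then have "is_interval ((\<lambda>t. w + t *\<^sub>R e) -` \<Omega>)" by (simp add: is_interval_convex_1)
      then show ?thesis using a b that unfolding is_interval_1 by auto
    qed
    have "\<beta> (w + a *\<^sub>R e) \<le> \<alpha> w" "\<alpha> w \<le> \<beta> (w + b *\<^sub>R e)"
      using eq[OF a(2)] eq[OF b(2)] mono\<alpha>[of w a 0] mono\<alpha>[of w 0 b] a b w by auto
    moreover have "continuous_on {a..b} (\<lambda>t. \<beta> (w + t *\<^sub>R e))"
      by (rule continuous_on_compose2[OF Ck_on_continuous[OF ab(2)]])
        (auto intro!: continuous_intros simp: seg)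
    ultimately obtain s where "s \<in> {a..b}" "\<beta> (w + s *\<^sub>R e) = \<alpha> w"
      using IVT'[of "\<lambda>t. \<beta> (w + t *\<^sub>R e)" a "\<alpha> w" b] a b by force
    then show ?thesis using seg by blast
  qed
  define \<tau> where "\<tau> w = (SOME s. w + s *\<^sub>R e \<in> \<Omega> \<and> \<beta> (w + s *\<^sub>R e) = \<alpha> w)" for w
  have \<tau>: "w + \<tau> w *\<^sub>R e \<in> \<Omega>" "\<beta> (w + \<tau> w *\<^sub>R e) = \<alpha> w" if "w \<in> \<Omega>" for w
    using someI_ex[OF ex[OF that]] by (auto simp: \<tau>_def)
  define T where "T w = (if w \<in> \<Omega> then w + \<tau> w *\<^sub>R e else w)" for w
  have T: "w \<in> \<Omega> \<Longrightarrow> w + s *\<^sub>R e \<in> \<Omega> \<Longrightarrow> \<beta> (w + s *\<^sub>R e) = \<alpha> w \<Longrightarrow> T w = w + s *\<^sub>R e" for w s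
    using uniq[of w "\<tau> w" s] \<tau> by (simp add: T_def)
  have id: "T w = w" if "w \<in> - C" for w
    using T[of w 0] eq that by (cases "w \<in> \<Omega>") (auto simp: T_def)
  have "Ck_on (Suc k) \<Omega> T"
  proof (rule Ck_on_level_transport[OF Om(1) e ab])
    show "s = 0" if "w \<in> \<Omega>" "w + s *\<^sub>R e \<in> \<Omega>" "\<beta> (w + s *\<^sub>R e) = \<beta> w" for w s
      using uniq[of w s 0] that by simp
    show "partial_on \<Omega> e \<beta> w \<noteq> 0" if "w \<in> \<Omega>" for w using pos(2)[OF that] by simp
  qed (auto simp: T_def \<tau>)
  moreover have "Ck_on (Suc k) (- C) T"
    using C(1) id by (subst Ck_on_cong[of _ _ "\<lambda>w. w"]) (auto intro!: Ck_on_id simp del: Ck_on.simps)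
  ultimately have "Ck_on (Suc k) (\<Omega> \<union> - C) T"
    using Om C by (intro Ck_on_open_Un) auto
  moreover have "\<Omega> \<union> - C = UNIV" using C by auto
  moreover have "\<exists>s. T w = w + s *\<^sub>R e" for w
  proof (cases "w \<in> \<Omega>")
    case True
    then show ?thesis by (auto simp: T_def)
  next
    case False
    then have "T w = w + 0 *\<^sub>R e" by (simp add: T_def)
    then show ?thesis by blast
  qed
  ultimately show ?thesis
    using T \<tau> by (intro that[of T]) (auto simp: T_def)
qed

section \<open>Ambient isotopies\<close>

text \<open>The ambient isotopies are defined for all times and on the whole space, and come with
  the inverse isotopy \<open>K\<close>: this makes isotopy an equivalence relation without reparametrizing time.\<close>

definition ambient_isotopic :: "nat \<Rightarrow> 'a::euclidean_space set \<Rightarrow> 'a set \<Rightarrow> bool" where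
  "ambient_isotopic k Y W \<longleftrightarrow> (\<exists>H K. Ck_on k UNIV H \<and> Ck_on k UNIV K \<and>
    (\<forall>t::real. \<forall>x. H (t, K (t, x)) = x \<and> K (t, H (t, x)) = x) \<and> (\<forall>x. H (0, x) = x) \<and>
    (\<forall>t x. x \<notin> ball 0 1 \<longrightarrow> H (t, x) = x) \<and> (\<lambda>x. H (1, x)) ` Y = W)"

lemma ambient_isotopicI:
  assumes "Ck_on k UNIV H" "Ck_on k UNIV K" "\<And>t x. H (t::real, K (t, x)) = x"
    "\<And>t x. K (t, H (t, x)) = x" "\<And>x. H (0, x) = x" "\<And>t x. x \<notin> ball 0 1 \<Longrightarrow> H (t, x) = x"
    "(\<lambda>x. H (1, x)) ` Y = W"
  shows "ambient_isotopic k Y W"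
  unfolding ambient_isotopic_def using assms by blast

lemma ambient_isotopicE:
  assumes "ambient_isotopic k Y W"
  obtains H K where "Ck_on k UNIV H" "Ck_on k UNIV K" "\<And>t x. H (t::real, K (t, x)) = x"
    "\<And>t x. K (t, H (t, x)) = x" "\<And>x. H (0, x) = x" "\<And>x. K (0, x) = x"
    "\<And>t x. x \<notin> ball 0 1 \<Longrightarrow> H (t, x) = x" "\<And>t x. x \<notin> ball 0 1 \<Longrightarrow> K (t, x) = x"
    "(\<lambda>x. H (1, x)) ` Y = W" "(\<lambda>x. K (1, x)) ` W = Y"
proof -
  obtain H K where *: "Ck_on k UNIV H" "Ck_on k UNIV K" "\<And>t x. H (t::real, K (t, x)) = x"
    "\<And>t x. K (t, H (t, x)) = x" "\<And>x. H (0, x) = x"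
    "\<And>t x. x \<notin> ball 0 1 \<Longrightarrow> H (t, x) = x" "(\<lambda>x. H (1, x)) ` Y = W"
    using assms unfolding ambient_isotopic_def by auto
  have "(\<lambda>x. K (1, x)) ` W = Y"
    by (simp add: *(7)[symmetric] image_image *(4))
  moreover have "K (0, x) = x" for x using *(4)[of 0 x] by (simp add: *(5))
  moreover have "K (t, x) = x" if "x \<notin> ball 0 1" for t x using *(4)[of t x] *(6)[OF that] by simp
  ultimately show ?thesis using *(1-7) by (intro that[of H K])
qed

lemma ambient_isotopic_sym: "ambient_isotopic k Y W \<Longrightarrow> ambient_isotopic k W Y"
  by (elim ambient_isotopicE) (intro ambient_isotopicI; assumption)

lemma ambient_isotopic_refl: "ambient_isotopic k Y Y"
  by (rule ambient_isotopicI[where H = snd and K = snd]) (auto intro!: Ck_on_snd)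

lemma ambient_isotopic_trans:
  assumes "ambient_isotopic k X Y" "ambient_isotopic k Y Z"
  shows "ambient_isotopic k X Z"
proof -
  obtain H K where H: "Ck_on k UNIV H" "Ck_on k UNIV K" "\<And>t x. H (t::real, K (t, x)) = x"
    "\<And>t x. K (t, H (t, x)) = x" "\<And>x. H (0, x) = x"
    "\<And>t x. x \<notin> ball 0 1 \<Longrightarrow> H (t, x) = x" "(\<lambda>x. H (1, x)) ` X = Y"
    using assms(1) by (elim ambient_isotopicE) (rule that; assumption)
  obtain H' K' where H': "Ck_on k UNIV H'" "Ck_on k UNIV K'" "\<And>t x. H' (t::real, K' (t, x)) = x"
    "\<And>t x. K' (t, H' (t, x)) = x" "\<And>x. H' (0, x) = x"
    "\<And>t x. x \<notin> ball 0 1 \<Longrightarrow> H' (t, x) = x" "(\<lambda>x. H' (1, x)) ` Y = Z"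
    using assms(2) by (elim ambient_isotopicE) (rule that; assumption)
  show ?thesis
  proof (rule ambient_isotopicI[where H = "\<lambda>z. H' (fst z, H z)" and K = "\<lambda>z. K (fst z, K' z)"])
    show "Ck_on k UNIV (\<lambda>z. H' (fst z, H z))"
      by (intro Ck_on_compose[OF _ _ _ H'(1)] Ck_on_Pair Ck_on_fst H(1)) auto
    show "Ck_on k UNIV (\<lambda>z. K (fst z, K' z))"
      by (intro Ck_on_compose[OF _ _ _ H(2)] Ck_on_Pair Ck_on_fst H'(2)) auto
    show "(\<lambda>x. H' (fst (1, x), H (1, x))) ` X = Z"
      using H(7) H'(7) by (auto simp: image_image[symmetric])
  qed (simp_all add: H H')
qed

section \<open>Moves supported in a ball\<close>

lemma partial_on_add_cmult:
  fixes f g :: "'a::euclidean_space \<Rightarrow> real"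
  assumes "good_domain S" "x \<in> S" "Ck_on (Suc k) S f" "Ck_on (Suc k) S g"
  shows "partial_on S v (\<lambda>x. f x + c * g x) x = partial_on S v f x + c * partial_on S v g x"
  by (rule partial_on_eq[OF assms(1,2)])
    (intro has_derivative_add has_derivative_mult_right Ck_on_has_derivative[OF assms(3,2)]
      Ck_on_has_derivative[OF assms(4,2)])

lemma ball_line_exit:
  fixes p e :: "'a::euclidean_space"
  assumes "r < R" "norm e = 1" "x \<in> ball p R"
  shows "\<exists>a>0. x + a *\<^sub>R e \<in> ball p R - cball p r"
proof -
  \<comment> \<open>A radius strictly between \<open>max (dist p x) r\<close> and \<open>R\<close>.
    Along the ray the distance to \<open>p\<close> starts below it and has reached it at parameter
    \<open>2 * R\<close>, so it is attained at a positive parameter.\<close>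
  define v where "v = (max (dist p x) r + R) / 2"
  have v: "dist p x < v" "r < v" "v < R" using assms by (auto simp: v_def)
  have "dist p (x + (2 * R) *\<^sub>R e) \<ge> v"
  proof -
    have "norm ((2 * R) *\<^sub>R e) \<le> dist p x + dist p (x + (2 * R) *\<^sub>R e)"
      using dist_triangle[of x "x + (2 * R) *\<^sub>R e" p] by (simp add: dist_commute dist_norm)
    moreover have "norm ((2 * R) *\<^sub>R e) \<ge> 2 * R" by (simp add: assms(2))
    ultimately show ?thesis using v by linarith
  qed
  moreover have "0 \<le> 2 * R" using assms(3) zero_le_dist[of p x] unfolding mem_ball by linarith
  moreover have "continuous_on {0..2 * R} (\<lambda>a. dist p (x + a *\<^sub>R e))" by (intro continuous_intros)
  ultimately obtain a where a: "0 \<le> a" "dist p (x + a *\<^sub>R e) = v"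
    using IVT'[of "\<lambda>a. dist p (x + a *\<^sub>R e)" 0 v "2 * R"] v by auto
  moreover have "a \<noteq> 0" using a v by auto
  ultimately show ?thesis using v by (intro exI[of _ a]) auto
qed

text \<open>The transport is carried out in space-time: \<Omega> is the line times the ball, the
  direction is \<open>(0, e)\<close>, the source is \<open>A\<close> at all times and the target is
  \<open>A + \<theta> t * D\<close>. Such a transport preserves time, so its spatial part is the
  isotopy and its smoothness jointly in time and space comes from the general transport. As \<theta>
  takes all its values in [0,1], the condition \<open>pos\<close> suffices for all real times;
  \<open>\<theta> 0 = 0\<close> gives the identity at the start and \<open>\<theta> 1 = 1\<close>
  the zero set of \<open>A + D\<close> at time 1.\<close>

lemma ball_push:
  fixes A D :: "'a::euclidean_space \<Rightarrow> real"
  assumes r: "0 < r" "r < R" and e: "norm e = 1" and sub: "ball p R \<subseteq> ball 0 1" "ball p R \<subseteq> N"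
    and AD: "Ck_on (Suc k) (ball p R) A" "Ck_on (Suc k) (ball p R) D"
    and D0: "\<And>x. x \<notin> cball p r \<Longrightarrow> D x = 0"
    and pos: "\<And>x \<theta>. x \<in> ball p R \<Longrightarrow> 0 \<le> \<theta> \<Longrightarrow> \<theta> \<le> 1 \<Longrightarrow>
      partial_on (ball p R) e A x + \<theta> * partial_on (ball p R) e D x > 0"
  shows "ambient_isotopic (Suc k) {x \<in> N. A x = 0} {x \<in> N. A x + D x = 0}"
proof -
  obtain \<theta> :: "real \<Rightarrow> real" where \<theta>: "Ck_on (Suc k) UNIV \<theta>" "\<And>t. 0 \<le> \<theta> t" "\<And>t. \<theta> t \<le> 1"
    "\<And>t. t \<le> 0 \<Longrightarrow> \<theta> t = 0" "\<And>t. t \<ge> 1 \<Longrightarrow> \<theta> t = 1"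
    using Ck_step_exists by blast
  define B where "B = ball p R"
  define \<Omega> :: "(real \<times> 'a) set" where "\<Omega> = UNIV \<times> B"
  define C :: "(real \<times> 'a) set" where "C = UNIV \<times> cball p r"
  define e' :: "real \<times> 'a" where "e' = (0, e)"
  define \<alpha> where "\<alpha> = (\<lambda>z::real \<times> 'a. A (snd z))"
  define \<beta> where "\<beta> = (\<lambda>z::real \<times> 'a. A (snd z) + \<theta> (fst z) * D (snd z))"
  have Om: "open \<Omega>" "convex \<Omega>" and C: "closed C" "C \<subseteq> \<Omega>" and e': "norm e' = 1"
    using r e by (auto simp: \<Omega>_def B_def C_def e'_def open_Times convex_Times closed_Times norm_Pair)
  have snd\<Omega>: "snd ` \<Omega> \<subseteq> B" by (auto simp: \<Omega>_def)
  have ck: "Ck_on (Suc k) \<Omega> \<alpha>" "Ck_on (Suc k) \<Omega> \<beta>"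
    unfolding \<alpha>_def \<beta>_def using Om AD snd\<Omega> unfolding B_def
    by (auto intro!: Ck_on_add Ck_on_mult Ck_on_compose[OF _ snd\<Omega>[unfolded B_def]] Ck_on_snd
        Ck_on_compose[OF _ _ Ck_on_fst \<theta>(1)] simp del: Ck_on.simps)
  have D: "(A has_derivative (\<lambda>v. partial_on B v A x)) (at x)" "(D has_derivative (\<lambda>v. partial_on B v D x)) (at x)"
    if "x \<in> B" for x
    using Ck_on_open_has_derivative[OF _ AD(1)] Ck_on_open_has_derivative[OF _ AD(2)] that
    unfolding B_def by auto
  have d\<alpha>: "partial_on \<Omega> e' \<alpha> z = partial_on B e A (snd z)" if "z \<in> \<Omega>" for z
  proof -
    have "(\<alpha> has_derivative (\<lambda>v. partial_on B (snd v) A (snd z))) (at z within \<Omega>)"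
      unfolding \<alpha>_def using D[of "snd z"] that snd\<Omega>
      by (intro has_derivative_compose[where g = A and f = snd] has_derivative_snd has_derivative_ident) auto
    from partial_on_eq[OF _ that this] Om show ?thesis by (simp add: e'_def)
  qed
  have d\<beta>: "partial_on \<Omega> e' \<beta> z = partial_on B e A (snd z) + \<theta> (fst z) * partial_on B e D (snd z)"
    if "z \<in> \<Omega>" for z
  proof -
    have d\<theta>: "(\<theta> has_derivative (\<lambda>v. partial_on UNIV v \<theta> (fst z))) (at (fst z))"
      by (rule Ck_on_open_has_derivative[OF _ \<theta>(1)]) auto
    have "(\<beta> has_derivative (\<lambda>v. partial_on B (snd v) A (snd z) +
       (\<theta> (fst z) * partial_on B (snd v) D (snd z) + partial_on UNIV (fst v) \<theta> (fst z) * D (snd z)))) (at z within \<Omega>)"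
      unfolding \<beta>_def using D[of "snd z"] that snd\<Omega> 
      by (intro has_derivative_add has_derivative_mult
          has_derivative_compose[where g = A and f = snd] has_derivative_compose[where g = D and f = snd]
          has_derivative_compose[where g = \<theta> and f = fst, OF _ d\<theta>]
          has_derivative_snd has_derivative_fst has_derivative_ident) auto
    from partial_on_eq[OF _ that this] Om show ?thesis
      using linear_0[OF has_derivative_linear[OF d\<theta>]] by (simp add: e'_def)
  qed
  have pos': "partial_on \<Omega> e' \<alpha> w > 0" "partial_on \<Omega> e' \<beta> w > 0" if "w \<in> \<Omega>" for w
    using pos[of "snd w" 0] pos[of "snd w" "\<theta> (fst w)"] \<theta>(2,3) that snd\<Omega>
    unfolding d\<alpha>[OF that] d\<beta>[OF that] B_def by auto
  have eq: "\<alpha> w = \<beta> w" if "w \<in> \<Omega> - C" for w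
    using that D0[of "snd w"] by (auto simp: \<alpha>_def \<beta>_def C_def mem_Times_iff)
  have exit1: "\<exists>a>0. w + a *\<^sub>R e' \<in> \<Omega> - C" if "w \<in> \<Omega>" for w
  proof -
    have "snd w \<in> ball p R" using that by (auto simp: \<Omega>_def B_def)
    then obtain a where "a > 0" "snd w + a *\<^sub>R e \<in> ball p R - cball p r"
      using ball_line_exit[OF r(2) e, of "snd w" p] by blast
    then show ?thesis by (intro exI[of _ a]) (auto simp: \<Omega>_def B_def C_def e'_def mem_Times_iff)
  qed
  have exit2: "\<exists>a<0. w + a *\<^sub>R e' \<in> \<Omega> - C" if "w \<in> \<Omega>" for w
  proof -
    have "snd w \<in> ball p R" using that by (auto simp: \<Omega>_def B_def)
    moreover have "norm (- e) = 1" using e by simp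
    ultimately obtain a where "a > 0" "snd w + a *\<^sub>R (- e) \<in> ball p R - cball p r"
      using ball_line_exit[OF r(2), of "- e" "snd w" p] by blast
    then show ?thesis by (intro exI[of _ "- a"]) (auto simp: \<Omega>_def B_def C_def e'_def mem_Times_iff)
  qed
  obtain T where T: "Ck_on (Suc k) UNIV T" "\<And>w. \<exists>s. T w = w + s *\<^sub>R e'"
    "\<And>w. w \<notin> \<Omega> \<Longrightarrow> T w = w" "\<And>w. w \<in> \<Omega> \<Longrightarrow> T w \<in> \<Omega>" "\<And>w. w \<in> \<Omega> \<Longrightarrow> \<beta> (T w) = \<alpha> w"
    "\<And>w s. w \<in> \<Omega> \<Longrightarrow> w + s *\<^sub>R e' \<in> \<Omega> \<Longrightarrow> \<beta> (w + s *\<^sub>R e') = \<alpha> w \<Longrightarrow> T w = w + s *\<^sub>R e'"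
    using level_transport_exists[OF Om C e' ck pos' eq exit1 exit2] by blast
  obtain T' where T': "Ck_on (Suc k) UNIV T'" "\<And>w. \<exists>s. T' w = w + s *\<^sub>R e'"
    "\<And>w. w \<notin> \<Omega> \<Longrightarrow> T' w = w" "\<And>w. w \<in> \<Omega> \<Longrightarrow> T' w \<in> \<Omega>" "\<And>w. w \<in> \<Omega> \<Longrightarrow> \<alpha> (T' w) = \<beta> w"
    "\<And>w s. w \<in> \<Omega> \<Longrightarrow> w + s *\<^sub>R e' \<in> \<Omega> \<Longrightarrow> \<alpha> (w + s *\<^sub>R e') = \<beta> w \<Longrightarrow> T' w = w + s *\<^sub>R e'"
    using level_transport_exists[OF Om C e' ck(2,1) pos'(2,1) eq[symmetric] exit1 exit2] by blast
  have TT': "T (T' w) = w" for w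
  proof (cases "w \<in> \<Omega>")
    case True
    obtain s where s: "T' w = w + s *\<^sub>R e'" using T'(2) by blast
    then have "T (T' w) = T' w + (- s) *\<^sub>R e'"
      using True T'(4,5)[OF True] by (intro T(6)) auto
    then show ?thesis using s by simp
  qed (simp add: T(3) T'(3))
  have T'T: "T' (T w) = w" for w
  proof (cases "w \<in> \<Omega>")
    case True
    obtain s where s: "T w = w + s *\<^sub>R e'" using T(2) by blast
    then have "T' (T w) = T w + (- s) *\<^sub>R e'"
      using True T(4,5)[OF True] by (intro T'(6)) auto
    then show ?thesis using s by simp
  qed (simp add: T(3) T'(3))
  have fT: "T (t, x) = (t, snd (T (t, x)))" for t x using T(2)[of "(t, x)"] by (auto simp: e'_def)
  have fT': "T' (t, x) = (t, snd (T' (t, x)))" for t x using T'(2)[of "(t, x)"] by (auto simp: e'_def)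
  show ?thesis
  proof (rule ambient_isotopicI[where H = "\<lambda>z. snd (T z)" and K = "\<lambda>z. snd (T' z)"])
    show "Ck_on (Suc k) UNIV (\<lambda>z. snd (T z))" "Ck_on (Suc k) UNIV (\<lambda>z. snd (T' z))"
      by (intro Ck_on_compose[OF _ _ _ Ck_on_snd[of UNIV]] T T'; simp)+
    show "snd (T (t, snd (T' (t, x)))) = x" for t x
      using TT'[of "(t, x)"] by (simp add: fT'[symmetric])
    show "snd (T' (t, snd (T (t, x)))) = x" for t x
      using T'T[of "(t, x)"] by (simp add: fT[symmetric])
    show "snd (T (0, x)) = x" for x
    proof (cases "x \<in> B")
      case True
      then show ?thesis using T(6)[of "(0, x)" 0] \<theta>(4)[of 0] by (simp add: \<Omega>_def \<alpha>_def \<beta>_def)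
    qed (simp add: T(3) \<Omega>_def)
    show "snd (T (t, x)) = x" if "x \<notin> ball 0 1" for t x
      using that sub(1) by (subst T(3)) (auto simp: \<Omega>_def B_def)
    show "(\<lambda>x. snd (T (1, x))) ` {x \<in> N. A x = 0} = {x \<in> N. A x + D x = 0}"
    proof (intro equalityI subsetI)
      fix y assume "y \<in> (\<lambda>x. snd (T (1, x))) ` {x \<in> N. A x = 0}"
      then obtain x where x: "x \<in> N" "A x = 0" "y = snd (T (1, x))" by auto
      show "y \<in> {x \<in> N. A x + D x = 0}"
      proof (cases "x \<in> B")
        case True
        then have "T (1, x) \<in> \<Omega>" "\<beta> (T (1, x)) = 0"
          using T(4,5)[of "(1, x)"] x by (auto simp: \<Omega>_def \<alpha>_def)
        then have "(1, y) \<in> \<Omega>" "\<beta> (1, y) = 0" using fT x(3) by simp_all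
        then show ?thesis using sub \<theta>(5)[of 1] by (auto simp: \<Omega>_def \<beta>_def B_def)
      next
        case False
        then have "x \<notin> cball p r" using r by (auto simp: B_def)
        then show ?thesis using x False D0 T(3)[of "(1, x)"] by (simp add: \<Omega>_def)
      qed
    next
      fix y assume y: "y \<in> {x \<in> N. A x + D x = 0}"
      let ?x = "snd (T' (1, y))"
      have "?x \<in> {x \<in> N. A x = 0}"
      proof (cases "y \<in> B")
        case True
        then have "T' (1, y) \<in> \<Omega>" "\<alpha> (T' (1, y)) = 0"
          using T'(4,5)[of "(1, y)"] y \<theta>(5)[of 1] by (auto simp: \<Omega>_def \<beta>_def)
        then show ?thesis using sub by (auto simp: \<Omega>_def \<alpha>_def B_def)
      next
        case False
        then have "y \<notin> cball p r" using r by (auto simp: B_def)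
        then show ?thesis using y False D0[of y] T'(3)[of "(1, y)"] by (simp add: \<Omega>_def)
      qed
      moreover have "y = snd (T (1, ?x))"
        using TT'[of "(1, y)"] by (simp add: fT'[symmetric])
      ultimately show "y \<in> (\<lambda>x. snd (T (1, x))) ` {x \<in> N. A x = 0}" by blast
    qed
  qed
qed

section \<open>Isotopy of the zero sets in a regular family\<close>

lemma compact_continuous_pos_bound:
  fixes f :: "'a::topological_space \<Rightarrow> real"
  assumes "compact S" "continuous_on S f" "\<And>x. x \<in> S \<Longrightarrow> f x > 0"
  obtains c where "c > 0" "\<And>x. x \<in> S \<Longrightarrow> c \<le> f x"
proof (cases "S = {}")
  case True
  then show ?thesis using that[of 1] by simp
next
  case False
  then obtain x where "x \<in> S" "\<forall>y\<in>S. f x \<le> f y"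
    using continuous_attains_inf[OF assms(1) _ assms(2)] by blast
  then show ?thesis using that[of "f x"] assms(3) by auto
qed

lemma compact_continuous_abs_bound:
  fixes f :: "'a::topological_space \<Rightarrow> real"
  assumes "compact S" "continuous_on S f"
  obtains M where "M \<ge> 0" "\<And>x. x \<in> S \<Longrightarrow> \<bar>f x\<bar> \<le> M"
proof -
  have "bounded (f ` S)" by (intro compact_imp_bounded compact_continuous_image assms)
  then obtain b where "\<forall>y\<in>f ` S. norm y \<le> b" "b > 0" unfolding bounded_pos by blast
  then show ?thesis using that[of b] by auto
qed

text \<open>One more ball is switched on: \<open>\<Phi> + \<phi> * (1 - \<Phi>)\<close> equals
  \<open>1 - (1 - \<Phi>) * (1 - \<phi>)\<close>, so it is 1 where either cutoff is, and it differs
  from \<Phi> only on the support of \<phi>. On the compact ball the derivative of \<open>G\<close>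
  along \<open>e\<close> has a positive lower bound, which terms of size \<sigma> cannot destroy;
  the threshold is uniform in \<sigma>, as required for combining finitely many such moves.\<close>

lemma small_push:
  fixes G u :: "'a::euclidean_space \<Rightarrow> real"
  assumes N: "open N" "N \<subseteq> ball 0 1" and G: "Ck_on (Suc k) N G" and u: "Ck_on (Suc k) N u"
    and e: "norm e = 1" and r: "0 < r" "r < R" and R: "cball p R \<subseteq> N"
    and pos: "\<And>x. x \<in> cball p R \<Longrightarrow> partial_on N e G x > 0"
    and \<Phi>: "Ck_on (Suc k) N \<Phi>" and \<phi>: "Ck_on (Suc k) N \<phi>" and \<phi>0: "\<And>x. x \<notin> cball p r \<Longrightarrow> \<phi> x = 0"
  shows "\<exists>\<delta>>0. \<forall>\<sigma>. \<bar>\<sigma>\<bar> < \<delta> \<longrightarrow> ambient_isotopic (Suc k) {x \<in> N. G x + \<sigma> * (\<Phi> x * u x) = 0}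
    {x \<in> N. G x + \<sigma> * ((\<Phi> x + \<phi> x * (1 - \<Phi> x)) * u x) = 0}"
proof -
  have gN: "good_domain N" and gB: "good_domain (ball p R)" using N by auto
  have BN: "ball p R \<subseteq> N" using R by auto
  let ?a = "\<lambda>x. \<Phi> x * u x" and ?d = "\<lambda>x. \<phi> x * (1 - \<Phi> x) * u x"
  have ad: "Ck_on (Suc k) N ?a" "Ck_on (Suc k) N ?d"
    by (intro Ck_on_mult Ck_on_diff Ck_on_const gN \<Phi> \<phi> u)+
  have cont: "continuous_on (cball p R) (partial_on N e h)" if "Ck_on (Suc k) N h" for h :: "'a \<Rightarrow> real"
    using Ck_on_continuous[OF Ck_on_partial_any[OF gN that]] R continuous_on_subset by blast
  obtain c where c: "c > 0" "\<And>x. x \<in> cball p R \<Longrightarrow> c \<le> partial_on N e G x"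
    using compact_continuous_pos_bound[OF compact_cball cont[OF G] pos] by blast
  obtain M1 where M1: "M1 \<ge> 0" "\<And>x. x \<in> cball p R \<Longrightarrow> \<bar>partial_on N e ?a x\<bar> \<le> M1"
    using compact_continuous_abs_bound[OF compact_cball cont[OF ad(1)]] by blast
  obtain M2 where M2: "M2 \<ge> 0" "\<And>x. x \<in> cball p R \<Longrightarrow> \<bar>partial_on N e ?d x\<bar> \<le> M2"
    using compact_continuous_abs_bound[OF compact_cball cont[OF ad(2)]] by blast
  have "ambient_isotopic (Suc k) {x \<in> N. G x + \<sigma> * (\<Phi> x * u x) = 0}
      {x \<in> N. G x + \<sigma> * ((\<Phi> x + \<phi> x * (1 - \<Phi> x)) * u x) = 0}"
    if \<sigma>: "\<bar>\<sigma>\<bar> < c / (M1 + M2 + 1)" for \<sigma>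
  proof -
    have A: "Ck_on (Suc k) N (\<lambda>x. G x + \<sigma> * ?a x)" and D: "Ck_on (Suc k) N (\<lambda>x. 0 + \<sigma> * ?d x)"
      \<comment> \<open>The summand 0 in the second function gives it the shape treated by
        \<open>partial_on_add_cmult\<close>.\<close>
      by (intro Ck_on_add Ck_on_cmult Ck_on_const gN G ad)+
    have "ambient_isotopic (Suc k) {x \<in> N. G x + \<sigma> * ?a x = 0} {x \<in> N. (G x + \<sigma> * ?a x) + (0 + \<sigma> * ?d x) = 0}"
    proof (rule ball_push[OF r e _ BN])
      show "Ck_on (Suc k) (ball p R) (\<lambda>x. G x + \<sigma> * ?a x)" "Ck_on (Suc k) (ball p R) (\<lambda>x. 0 + \<sigma> * ?d x)"
        using Ck_on_subset[OF gB BN] A D by blast+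
      fix x \<theta> :: real and y assume x: "y \<in> ball p R" and \<theta>: "0 \<le> \<theta>" "\<theta> \<le> 1"
      have yN: "y \<in> N" "y \<in> cball p R" using x BN by auto
      have "partial_on N e (\<lambda>x. 0 + \<sigma> * ?d x) y = 0 + \<sigma> * partial_on N e ?d y"
      proof -
        have "partial_on N e (\<lambda>x. 0::real) y = 0"
          by (rule partial_on_eq[OF gN yN(1)]) (rule has_derivative_const)
        then show ?thesis
          using partial_on_add_cmult[OF gN yN(1) Ck_on_const[OF gN, of "Suc k" 0] ad(2)] by simp
      qed
      then have eq: "partial_on (ball p R) e (\<lambda>x. G x + \<sigma> * ?a x) y + \<theta> * partial_on (ball p R) e (\<lambda>x. 0 + \<sigma> * ?d x) y
        = partial_on N e G y + \<sigma> * (partial_on N e ?a y + \<theta> * partial_on N e ?d y)"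
        unfolding partial_on_subset[OF gB BN x A] partial_on_subset[OF gB BN x D]
          partial_on_add_cmult[OF gN yN(1) G ad(1)]
        by (simp add: algebra_simps)
      have "\<bar>partial_on N e ?a y + \<theta> * partial_on N e ?d y\<bar> \<le> M1 + M2"
      proof -
        have "\<bar>\<theta> * partial_on N e ?d y\<bar> \<le> 1 * M2"
          unfolding abs_mult using M2 yN \<theta> by (intro mult_mono) auto
        then show ?thesis using M1(2)[OF yN(2)] by linarith
      qed
      then have "\<bar>\<sigma> * (partial_on N e ?a y + \<theta> * partial_on N e ?d y)\<bar> \<le> \<bar>\<sigma>\<bar> * (M1 + M2 + 1)"
        unfolding abs_mult by (intro mult_left_mono) auto
      moreover have "\<bar>\<sigma>\<bar> * (M1 + M2 + 1) < c" using \<sigma> M1 M2 by (simp add: pos_less_divide_eq)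
      ultimately show "partial_on (ball p R) e (\<lambda>x. G x + \<sigma> * ?a x) y +
        \<theta> * partial_on (ball p R) e (\<lambda>x. 0 + \<sigma> * ?d x) y > 0"
        unfolding eq using c(2)[OF yN(2)] by linarith
    qed (use \<phi>0 N BN in auto)
    moreover have "(G x + \<sigma> * ?a x) + (0 + \<sigma> * ?d x) = G x + \<sigma> * ((\<Phi> x + \<phi> x * (1 - \<Phi> x)) * u x)" for x
      by (simp add: algebra_simps)
    ultimately show ?thesis by (simp only:)
  qed
  moreover have "c / (M1 + M2 + 1) > 0" using c M1 M2 by simp
  ultimately show ?thesis by blast
qed

lemma regular_direction:
  fixes G :: "'a::euclidean_space \<Rightarrow> real"
  assumes N: "open N" and G: "Ck_on (Suc k) N G" and p: "p \<in> N" and nz: "partial_on N v G p \<noteq> 0"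
  obtains e R where "norm e = 1" "R > 0" "cball p R \<subseteq> N" "\<And>x. x \<in> cball p R \<Longrightarrow> partial_on N e G x > 0"
proof -
  have lin: "linear (\<lambda>v. partial_on N v G p)"
    using has_derivative_linear[OF Ck_on_has_derivative[OF G p]] .
  then have v: "v \<noteq> 0" using linear_0 nz by auto
  define e where "e = (sgn (partial_on N v G p) / norm v) *\<^sub>R v"
  have "norm e = 1" using v nz by (simp add: e_def abs_sgn_eq)
  have "partial_on N e G p = \<bar>partial_on N v G p\<bar> / norm v"
    unfolding e_def linear_cmul[OF lin] by (simp add: abs_sgn mult.commute)
  then have ep: "partial_on N e G p > 0" using v nz by simp
  have "good_domain N" using N by simp
  then have "open (partial_on N e G -` {0<..} \<inter> N)"
    using Ck_on_continuous[OF Ck_on_partial_any[OF _ G]] N by (metis continuous_on_open_vimage open_greaterThan)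
  moreover have "p \<in> partial_on N e G -` {0<..} \<inter> N" using ep p by simp
  ultimately obtain R where "R > 0" "cball p R \<subseteq> partial_on N e G -` {0<..} \<inter> N"
    using open_contains_cball_eq by blast
  with \<open>norm e = 1\<close> show ?thesis by (intro that[of e R]) auto
qed

text \<open>Finitely many small balls cover the compact zero set of \<open>G\<close>, and in a
  larger concentric ball \<open>G\<close> increases in a fixed direction. Off the small balls
  \<open>\<bar>G\<bar>\<close> is bounded below on \<open>K\<close>, so a slight change of the
  parameter creates zeros only inside them. There the combined cutoff is 1; hence switching the
  parameter on the balls alone already produces the zero set of the new member of the
  family.\<close>

lemma regular_family_isotopic_local:
  fixes f u :: "'a::euclidean_space \<Rightarrow> real"
  assumes N: "open N" "N \<subseteq> ball 0 1" and K: "compact K" "K \<subseteq> N"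
    and f: "Ck_on (Suc k) N f" and u: "Ck_on (Suc k) N u"
    and trap: "\<And>s x. 0 \<le> s \<Longrightarrow> s \<le> 1 \<Longrightarrow> x \<in> N \<Longrightarrow> f x + s * u x = 0 \<Longrightarrow> x \<in> K"
    and reg: "\<And>s x. 0 \<le> s \<Longrightarrow> s \<le> 1 \<Longrightarrow> x \<in> N \<Longrightarrow> f x + s * u x = 0 \<Longrightarrow>
      \<exists>v. partial_on N v f x + s * partial_on N v u x \<noteq> 0"
    and s: "0 \<le> s" "s \<le> 1"
  shows "\<exists>\<delta>>0. \<forall>s'. 0 \<le> s' \<longrightarrow> s' \<le> 1 \<longrightarrow> \<bar>s' - s\<bar> < \<delta> \<longrightarrow>
    ambient_isotopic (Suc k) {x \<in> N. f x + s * u x = 0} {x \<in> N. f x + s' * u x = 0}"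
proof -
  have gN: "good_domain N" using N by auto
  define G where "G x = f x + s * u x" for x
  have G: "Ck_on (Suc k) N G" unfolding G_def by (intro Ck_on_add Ck_on_cmult f u gN)
  have contG: "continuous_on K G" and contu: "continuous_on K u"
    using Ck_on_continuous[OF G] Ck_on_continuous[OF u] K continuous_on_subset by blast+
  define Z where "Z = {x \<in> K. G x = 0}"
  have "closed Z"
    unfolding Z_def by (rule continuous_closed_preimage_constant[OF contG compact_imp_closed[OF K(1)]])
  moreover have "K \<inter> Z = Z" by (auto simp: Z_def)
  ultimately have "compact Z" using compact_Int_closed[OF K(1)] by metis
  have "\<exists>e R. norm e = 1 \<and> R > 0 \<and> cball p R \<subseteq> N \<and> (\<forall>x\<in>cball p R. partial_on N e G x > 0)" if "p \<in> Z" for p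
  proof -
    have p: "p \<in> N" "f p + s * u p = 0" using that K by (auto simp: Z_def G_def)
    from reg[OF s p] obtain v where "partial_on N v G p \<noteq> 0"
      unfolding G_def partial_on_add_cmult[OF gN p(1) f u] by blast
    from regular_direction[OF N(1) G p(1) this] show ?thesis by metis
  qed
  then obtain e R where eR: "\<And>p. p \<in> Z \<Longrightarrow> norm (e p) = 1" "\<And>p. p \<in> Z \<Longrightarrow> R p > 0"
    "\<And>p. p \<in> Z \<Longrightarrow> cball p (R p) \<subseteq> N" "\<And>p x. p \<in> Z \<Longrightarrow> x \<in> cball p (R p) \<Longrightarrow> partial_on N (e p) G x > 0"
    by metis
  obtain P where P: "P \<subseteq> Z" "finite P" "Z \<subseteq> (\<Union>p\<in>P. ball p (R p / 4))"
  proof (rule compactE_image[OF \<open>compact Z\<close>, of Z "\<lambda>p. ball p (R p / 4)"])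
    show "Z \<subseteq> (\<Union>c\<in>Z. ball c (R c / 4))" using eR(2) by force
  qed auto
  \<comment> \<open>The parameter is switched from \<open>s\<close> to \<open>s + \<sigma>\<close> ball by ball. Since \<open>0 \<le> \<Phi> \<le> 1\<close>, a zero \<open>x\<close> of
    \<open>G + \<sigma> \<Phi> u\<close> is a zero of the member of the family with parameter \<open>s + \<sigma> \<Phi> x\<close>, hence lies in \<open>K\<close>.\<close>
  have "\<exists>\<Phi>. Ck_on (Suc k) UNIV \<Phi> \<and> (\<forall>x. 0 \<le> \<Phi> x \<and> \<Phi> x \<le> 1) \<and> (\<forall>x\<in>(\<Union>p\<in>P. ball p (R p / 4)). \<Phi> x = 1) \<and>
    (\<exists>\<delta>>0. \<forall>\<sigma>. \<bar>\<sigma>\<bar> < \<delta> \<longrightarrow> ambient_isotopic (Suc k) {x \<in> N. G x = 0} {x \<in> N. G x + \<sigma> * (\<Phi> x * u x) = 0})"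
    using P(2,1)
  proof (induction P)
    case empty
    show ?case
      by (intro exI[of _ "\<lambda>_. 0"] conjI Ck_on_const exI[of _ "1::real"]) (auto intro: ambient_isotopic_refl)
  next
    case (insert p P)
    obtain \<Phi> \<delta> where \<Phi>: "Ck_on (Suc k) UNIV \<Phi>" "\<And>x. 0 \<le> \<Phi> x" "\<And>x. \<Phi> x \<le> 1"
      "\<And>x. x \<in> (\<Union>p\<in>P. ball p (R p / 4)) \<Longrightarrow> \<Phi> x = 1" and \<delta>: "\<delta> > 0"
      "\<And>\<sigma>. \<bar>\<sigma>\<bar> < \<delta> \<Longrightarrow> ambient_isotopic (Suc k) {x \<in> N. G x = 0} {x \<in> N. G x + \<sigma> * (\<Phi> x * u x) = 0}"
    proof -
      have "P \<subseteq> Z" using insert.prems by auto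
      from insert.IH[OF this] show thesis
        by (elim exE conjE) (rule that, assumption, blast, blast, blast, assumption, blast)
    qed
    have p: "p \<in> Z" using insert by auto
    note eR = eR[OF p]
    \<comment> \<open>Three radii: \<phi> is 1 on the ball of radius \<open>R p / 4\<close> from the
      cover, vanishes beyond \<open>R p / 2\<close>, and the shell up to \<open>R p\<close> is the
      room in which the moved lines return to the identity.\<close>
    have r: "0 < R p / 4" "0 < R p / 2" "R p / 2 < R p" using eR(2) by auto
    obtain \<phi> :: "'a \<Rightarrow> real" where \<phi>: "Ck_on (Suc k) UNIV \<phi>" "\<And>x. 0 \<le> \<phi> x" "\<And>x. \<phi> x \<le> 1"
      "\<And>x. x \<in> ball p (R p / 4) \<Longrightarrow> \<phi> x = 1" "\<And>x. x \<notin> cball p (2 * (R p / 4)) \<Longrightarrow> \<phi> x = 0"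
      using Ck_bump_exists[OF r(1)] by blast
    have sub: "Ck_on (Suc k) N h" if "Ck_on (Suc k) UNIV h" for h :: "'a \<Rightarrow> real"
      using Ck_on_subset[OF gN subset_UNIV that] .
    let ?\<Psi> = "\<lambda>x. \<Phi> x + \<phi> x * (1 - \<Phi> x)"
    have "\<phi> x = 0" if "x \<notin> cball p (R p / 2)" for x using \<phi>(5)[of x] that by simp
    from small_push[OF N G u eR(1) r(2,3) eR(3,4) sub[OF \<Phi>(1)] sub[OF \<phi>(1)] this]
    obtain \<delta>' where \<delta>': "\<delta>' > 0" "\<And>\<sigma>. \<bar>\<sigma>\<bar> < \<delta>' \<Longrightarrow> ambient_isotopic (Suc k)
      {x \<in> N. G x + \<sigma> * (\<Phi> x * u x) = 0} {x \<in> N. G x + \<sigma> * (?\<Psi> x * u x) = 0}"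
      by blast
    show ?case
    proof (intro exI[of _ ?\<Psi>] exI[of _ "min \<delta> \<delta>'"] conjI allI ballI impI)
      show "Ck_on (Suc k) UNIV ?\<Psi>"
        by (intro Ck_on_add Ck_on_mult Ck_on_diff Ck_on_const \<Phi>(1) \<phi>(1)) auto
      show "0 \<le> ?\<Psi> x" for x using \<Phi>(2,3)[of x] \<phi>(2,3)[of x] by simp
      show "?\<Psi> x \<le> 1" for x
      proof -
        have "\<phi> x * (1 - \<Phi> x) \<le> 1 * (1 - \<Phi> x)"
          using \<Phi>(2,3)[of x] \<phi>(2,3)[of x] by (intro mult_right_mono) auto
        then show ?thesis by simp
      qed
      show "?\<Psi> x = 1" if "x \<in> (\<Union>p\<in>insert p P. ball p (R p / 4))" for x
      proof (cases "x \<in> ball p (R p / 4)")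
        case True
        then show ?thesis using \<phi>(4) by simp
      next
        case False
        then have "x \<in> (\<Union>p\<in>P. ball p (R p / 4))" using that by blast
        then show ?thesis using \<Phi>(4) by simp
      qed
      show "min \<delta> \<delta>' > 0" using \<delta> \<delta>' by simp
      show "ambient_isotopic (Suc k) {x \<in> N. G x = 0} {x \<in> N. G x + \<sigma> * (?\<Psi> x * u x) = 0}"
        if "\<bar>\<sigma>\<bar> < min \<delta> \<delta>'" for \<sigma>
        using ambient_isotopic_trans[OF \<delta>(2) \<delta>'(2)] that by simp
    qed
  qed
  then obtain \<Phi> \<delta> where \<Phi>: "Ck_on (Suc k) UNIV \<Phi>" "\<And>x. 0 \<le> \<Phi> x" "\<And>x. \<Phi> x \<le> 1"
      "\<And>x. x \<in> (\<Union>p\<in>P. ball p (R p / 4)) \<Longrightarrow> \<Phi> x = 1" and \<delta>: "\<delta> > 0"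
      "\<And>\<sigma>. \<bar>\<sigma>\<bar> < \<delta> \<Longrightarrow> ambient_isotopic (Suc k) {x \<in> N. G x = 0} {x \<in> N. G x + \<sigma> * (\<Phi> x * u x) = 0}"
    by (elim exE conjE) (rule that, assumption, blast, blast, blast, assumption, blast)
  define J where "J = K - (\<Union>p\<in>P. ball p (R p / 4))"
  have J: "compact J" "J \<subseteq> K" using K(1) by (auto simp: J_def intro!: compact_diff)
  have "continuous_on J (\<lambda>x. \<bar>G x\<bar>)" using contG J(2) by (auto intro!: continuous_intros intro: continuous_on_subset)
  moreover have "\<bar>G x\<bar> > 0" if "x \<in> J" for x using that P(3) by (auto simp: J_def Z_def)
  ultimately obtain c where c: "c > 0" "\<And>x. x \<in> J \<Longrightarrow> c \<le> \<bar>G x\<bar>"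
    using compact_continuous_pos_bound[OF J(1)] by blast
  obtain M where M: "M \<ge> 0" "\<And>x. x \<in> K \<Longrightarrow> \<bar>u x\<bar> \<le> M"
    using compact_continuous_abs_bound[OF K(1) contu] by blast
  have "ambient_isotopic (Suc k) {x \<in> N. f x + s * u x = 0} {x \<in> N. f x + s' * u x = 0}"
    if s': "0 \<le> s'" "s' \<le> 1" "\<bar>s' - s\<bar> < min \<delta> (c / (M + 1))" for s'
  proof -
    have small: "\<bar>s' - s\<bar> * (M + 1) < c" using s' M by (simp add: pos_less_divide_eq)
    \<comment> \<open>Used for \<open>\<theta> = 1\<close> and for
      \<open>\<theta> = \<Phi> x\<close>: the zeros of the function with and without cutoff all lie
      where the cutoff is 1, so both zero sets coincide.\<close>
    have \<Phi>1: "\<Phi> x = 1" if x: "x \<in> N" and \<theta>: "0 \<le> \<theta>" "\<theta> \<le> 1" and 0: "G x + (s' - s) * (\<theta> * u x) = 0" for x \<theta>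
    proof (rule \<Phi>(4), rule ccontr)
      assume not: "x \<notin> (\<Union>p\<in>P. ball p (R p / 4))"
      have "s + \<theta> * (s' - s) = (1 - \<theta>) * s + \<theta> * s'" by (simp add: algebra_simps)
      moreover have "(1 - \<theta>) * s + \<theta> * s' \<le> (1 - \<theta>) * 1 + \<theta> * 1"
        using s s' \<theta> by (intro add_mono mult_left_mono) auto
      ultimately have "0 \<le> s + \<theta> * (s' - s)" "s + \<theta> * (s' - s) \<le> 1"
        using s s' \<theta> by auto
      moreover have "f x + (s + \<theta> * (s' - s)) * u x = 0" using 0 by (simp add: G_def algebra_simps)
      ultimately have xK: "x \<in> K" using trap x by blast
      then have "c \<le> \<bar>G x\<bar>" using c(2) not by (simp add: J_def)
      moreover have "\<bar>G x\<bar> = \<bar>s' - s\<bar> * (\<theta> * \<bar>u x\<bar>)"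
        using 0 \<theta> by (metis abs_minus_cancel abs_mult abs_of_nonneg add_eq_0_iff)
      moreover have "\<theta> * \<bar>u x\<bar> \<le> 1 * M" using \<theta> M xK by (intro mult_mono) auto
      then have "\<bar>s' - s\<bar> * (\<theta> * \<bar>u x\<bar>) \<le> \<bar>s' - s\<bar> * (M + 1)" by (intro mult_left_mono) auto
      ultimately show False using small by linarith
    qed
    have "{x \<in> N. G x + (s' - s) * (\<Phi> x * u x) = 0} = {x \<in> N. G x + (s' - s) * (1 * u x) = 0}"
      using \<Phi>1[of _ 1] \<Phi>1[of _ "\<Phi> _"] \<Phi>(2,3) by (intro Collect_cong conj_cong refl) (metis zero_le_one order_refl)
    moreover have "G x + (s' - s) * (1 * u x) = f x + s' * u x" for x by (simp add: G_def algebra_simps)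
    ultimately have "ambient_isotopic (Suc k) {x \<in> N. G x = 0} {x \<in> N. f x + s' * u x = 0}"
      using \<delta>(2)[of "s' - s"] s' by (simp only: min_less_iff_conj)
    then show ?thesis by (simp only: G_def)
  qed
  moreover have "min \<delta> (c / (M + 1)) > 0" using \<delta> c M by simp
  ultimately show ?thesis by blast
qed

text \<open>By the local statement the classes of parameters with isotopic zero sets are relatively
  open in [0,1], so by connectedness there is one class.\<close>

lemma regular_family_isotopic:
  fixes f u :: "'a::euclidean_space \<Rightarrow> real"
  assumes N: "open N" "N \<subseteq> ball 0 1" and K: "compact K" "K \<subseteq> N"
    and f: "Ck_on (Suc k) N f" and u: "Ck_on (Suc k) N u"
    and trap: "\<And>s x. 0 \<le> s \<Longrightarrow> s \<le> 1 \<Longrightarrow> x \<in> N \<Longrightarrow> f x + s * u x = 0 \<Longrightarrow> x \<in> K"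
    and reg: "\<And>s x. 0 \<le> s \<Longrightarrow> s \<le> 1 \<Longrightarrow> x \<in> N \<Longrightarrow> f x + s * u x = 0 \<Longrightarrow>
      \<exists>v. partial_on N v f x + s * partial_on N v u x \<noteq> 0"
  shows "ambient_isotopic (Suc k) {x \<in> N. f x = 0} {x \<in> N. f x + u x = 0}"
proof -
  define Q where "Q s s' = ambient_isotopic (Suc k) {x \<in> N. f x + s * u x = 0} {x \<in> N. f x + s' * u x = 0}" for s s' :: real
  have "Q 0 1"
  proof (rule connected_equivalence_relation[where S = "{0..1}"])
    show "Q x z" if "Q x y" "Q y z" for x y z
      using that unfolding Q_def by (rule ambient_isotopic_trans)
    fix s :: real assume "s \<in> {0..1}"
    then have s: "0 \<le> s" "s \<le> 1" by auto
    have "\<exists>\<delta>>0. \<forall>s'. 0 \<le> s' \<longrightarrow> s' \<le> 1 \<longrightarrow> \<bar>s' - s\<bar> < \<delta> \<longrightarrow> Q s s'"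
      unfolding Q_def by (rule regular_family_isotopic_local[OF N K f u trap reg s])
    then obtain \<delta> where \<delta>: "\<delta> > 0" "\<And>s'. 0 \<le> s' \<Longrightarrow> s' \<le> 1 \<Longrightarrow> \<bar>s' - s\<bar> < \<delta> \<Longrightarrow> Q s s'"
      by auto
    show "\<exists>T. openin (top_of_set {0..1}) T \<and> s \<in> T \<and> (\<forall>s'\<in>T. Q s s')"
      using \<delta> \<open>s \<in> {0..1}\<close>
      by (intro exI[of _ "{0..1} \<inter> ball s \<delta>"]) (auto simp: dist_real_def abs_minus_commute)
  qed (auto simp: Q_def intro: ambient_isotopic_sym)
  then show ?thesis by (simp add: Q_def)
qed

section \<open>Taylor polynomials on the unit ball\<close>

lemma partial_on_cong_interior:
  assumes "open U" "U \<subseteq> S" "z \<in> U" "\<And>x. x \<in> U \<Longrightarrow> f x = g x"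
  shows "partial_on S b f z = partial_on S b g z"
proof -
  have "at z within S = at z" using assms by (intro at_within_interior) (auto simp: interior_def)
  moreover have "(f has_derivative f') (at z) \<longleftrightarrow> (g has_derivative f') (at z)" for f'
    using assms by (auto intro: has_derivative_transform_within_open)
  ultimately show ?thesis by (simp add: partial_on_def frechet_derivative_def)
qed

lemma second_difference_mvt:
  fixes f :: "'a::euclidean_space \<Rightarrow> real"
  assumes S: "good_domain S" and f: "Ck_on (Suc (Suc k)) S f" and r: "ball x r \<subseteq> interior S"
    and t: "t > 0" "t * (norm u + norm v) < r"
  obtains z where "dist x z \<le> t * (norm u + norm v)" "z \<in> S"
    "f (x + t *\<^sub>R u + t *\<^sub>R v) - f (x + t *\<^sub>R u) - f (x + t *\<^sub>R v) + f x = t\<^sup>2 * partial_on S v (partial_on S u f) z"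
proof -
  have d: "dist x (x + a *\<^sub>R u + b *\<^sub>R v) \<le> t * (norm u + norm v)"
    if "0 \<le> a" "a \<le> t" "0 \<le> b" "b \<le> t" for a b
  proof -
    have "dist x (x + a *\<^sub>R u + b *\<^sub>R v) = norm (a *\<^sub>R u + b *\<^sub>R v)"
      by (subst dist_commute) (simp add: dist_norm add.assoc)
    also have "\<dots> \<le> a * norm u + b * norm v"
      using norm_triangle_ineq[of "a *\<^sub>R u" "b *\<^sub>R v"] that by simp
    also have "\<dots> \<le> t * norm u + t * norm v" using that by (intro add_mono mult_right_mono) auto
    finally show ?thesis by (simp add: distrib_left)
  qed
  have in_S: "x + a *\<^sub>R u + b *\<^sub>R v \<in> interior S" if "0 \<le> a" "a \<le> t" "0 \<le> b" "b \<le> t" for a b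
    using d[OF that] t r by (intro subsetD[OF r]) auto
  have "\<exists>l>0. l < t \<and> (f (x + t *\<^sub>R v + t *\<^sub>R u) - f (x + t *\<^sub>R u)) - (f (x + t *\<^sub>R v + 0 *\<^sub>R u) - f (x + 0 *\<^sub>R u)) =
      (t - 0) * (partial_on S u f (x + t *\<^sub>R v + l *\<^sub>R u) - partial_on S u f (x + l *\<^sub>R u))"
    using in_S[of _ t] in_S[of _ 0] t(1)
    by (intro MVT2 DERIV_diff Ck_on_line_DERIV[OF f]) (auto simp: ac_simps)
  then obtain l where l: "0 < l" "l < t"
    "(f (x + t *\<^sub>R v + t *\<^sub>R u) - f (x + t *\<^sub>R u)) - (f (x + t *\<^sub>R v) - f x) =
      t * (partial_on S u f (x + l *\<^sub>R u + t *\<^sub>R v) - partial_on S u f (x + l *\<^sub>R u + 0 *\<^sub>R v))"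
    by (auto simp: ac_simps)
  have fu: "Ck_on (Suc k) S (partial_on S u f)" by (rule Ck_on_partial_any[OF S f])
  have "\<exists>m>0. m < t \<and> partial_on S u f (x + l *\<^sub>R u + t *\<^sub>R v) - partial_on S u f (x + l *\<^sub>R u + 0 *\<^sub>R v) =
      (t - 0) * partial_on S v (partial_on S u f) (x + l *\<^sub>R u + m *\<^sub>R v)"
    using in_S[of l] l t(1) by (intro MVT2 Ck_on_line_DERIV[OF fu]) auto
  then obtain m where m: "0 < m" "m < t"
    "partial_on S u f (x + l *\<^sub>R u + t *\<^sub>R v) - partial_on S u f (x + l *\<^sub>R u + 0 *\<^sub>R v) =
      t * partial_on S v (partial_on S u f) (x + l *\<^sub>R u + m *\<^sub>R v)"
    by auto
  show ?thesis
  proof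
    show "dist x (x + l *\<^sub>R u + m *\<^sub>R v) \<le> t * (norm u + norm v)" using d l m by auto
    show "x + l *\<^sub>R u + m *\<^sub>R v \<in> S" using in_S[of l m] l m interior_subset by auto
    show "f (x + t *\<^sub>R u + t *\<^sub>R v) - f (x + t *\<^sub>R u) - f (x + t *\<^sub>R v) + f x =
        t\<^sup>2 * partial_on S v (partial_on S u f) (x + l *\<^sub>R u + m *\<^sub>R v)"
      using l(3) unfolding m(3) by (simp add: power2_eq_square ac_simps)
  qed
qed

text \<open>The second difference is symmetric in \<open>u\<close> and \<open>v\<close>. Applying
  the mean value theorem twice, in either order, shows that the two mixed derivatives take a common
  value at points arbitrarily close to \<open>x\<close>, and continuity excludes a gap at
  \<open>x\<close>.\<close>

lemma partial_on_commute:
  fixes f :: "'a::euclidean_space \<Rightarrow> real"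
  assumes S: "good_domain S" and f: "Ck_on (Suc (Suc k)) S f" and x: "x \<in> interior S"
  shows "partial_on S u (partial_on S v f) x = partial_on S v (partial_on S u f) x" (is "?a x = ?b x")
proof (rule ccontr)
  assume ne: "?a x \<noteq> ?b x"
  define \<epsilon> where "\<epsilon> = \<bar>?a x - ?b x\<bar> / 2"
  have \<epsilon>: "\<epsilon> > 0" using ne by (simp add: \<epsilon>_def)
  have xS: "x \<in> S" using x interior_subset by auto
  have "continuous_on S ?a" "continuous_on S ?b"
    using f S by (auto intro!: Ck_on_continuous Ck_on_partial_any simp del: Ck_on.simps(2))
  then obtain d1 d2 where d: "d1 > 0" "\<And>z. z \<in> S \<Longrightarrow> dist z x < d1 \<Longrightarrow> dist (?a z) (?a x) < \<epsilon>"
    "d2 > 0" "\<And>z. z \<in> S \<Longrightarrow> dist z x < d2 \<Longrightarrow> dist (?b z) (?b x) < \<epsilon>"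
    unfolding continuous_on_iff using xS \<epsilon> by metis
  obtain r where r: "r > 0" "ball x r \<subseteq> interior S"
    using x open_contains_ball_eq[OF open_interior] by blast
  define q where "q = min r (min d1 d2)"
  have q: "q > 0" using r d by (simp add: q_def)
  define t where "t = q / (norm u + norm v + 1)"
  have n: "norm u + norm v + 1 > 0" using norm_ge_zero[of u] norm_ge_zero[of v] by linarith
  have t: "t > 0" "t * (norm u + norm v) < q"
    using q n mult_strict_left_mono[of "norm u + norm v" "norm u + norm v + 1" t] by (auto simp: t_def)
  then have tr: "t * (norm u + norm v) < r" "t * (norm v + norm u) < r" by (auto simp: q_def add.commute)
  obtain z where z: "dist x z \<le> t * (norm u + norm v)" "z \<in> S"
    "f (x + t *\<^sub>R u + t *\<^sub>R v) - f (x + t *\<^sub>R u) - f (x + t *\<^sub>R v) + f x = t\<^sup>2 * ?b z"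
    using second_difference_mvt[OF S f r(2) t(1) tr(1)] by blast
  obtain y where y: "dist x y \<le> t * (norm v + norm u)" "y \<in> S"
    "f (x + t *\<^sub>R v + t *\<^sub>R u) - f (x + t *\<^sub>R v) - f (x + t *\<^sub>R u) + f x = t\<^sup>2 * ?a y"
    using second_difference_mvt[OF S f r(2) t(1) tr(2)] by blast
  have "t\<^sup>2 * ?b z = t\<^sup>2 * ?a y" unfolding y(3)[symmetric] z(3)[symmetric] by (simp add: algebra_simps)
  then have "?b z = ?a y" using t by simp
  moreover have "dist (?b z) (?b x) < \<epsilon>" "dist (?a y) (?a x) < \<epsilon>"
    using d(4)[OF z(2)] d(2)[OF y(2)] z(1) y(1) t by (auto simp: q_def dist_commute add.commute)
  ultimately show False unfolding \<epsilon>_def dist_real_def by (auto simp: abs_if split: if_splits)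
qed

section \<open>Higher derivatives as multilinear forms, and Taylor's formula\<close>

abbreviation coord_partial :: "'n::finite \<Rightarrow> (real^'n \<Rightarrow> real) \<Rightarrow> real^'n \<Rightarrow> real" where
  "coord_partial i \<equiv> partial_on (cball 0 1) (axis i 1)"

text \<open>\<open>iter_dir [u\<^sub>1, \<dots>, u\<^sub>l] f z\<close> is the \<open>l\<close>-th derivative of \<open>f\<close> at \<open>z\<close>, as a multilinear form
  in the directions \<open>u\<^sub>1, \<dots>, u\<^sub>l\<close>.\<close>

primrec iter_dir :: "(real^'n) list \<Rightarrow> (real^'n \<Rightarrow> real) \<Rightarrow> real^'n \<Rightarrow> real" where
  "iter_dir [] f z = f z"
| "iter_dir (u # us) f z = (\<Sum>i\<in>UNIV. u $ i * iter_dir us (coord_partial i f) z)"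

text \<open>\<open>m\<close> counts the terms, so the polynomial of degree \<open>d\<close> is
  \<open>taylor_poly (Suc d) f\<close>. With this count, a partial derivative of the polynomial with
  \<open>Suc m\<close> terms is the polynomial with \<open>m\<close> terms of the partial
  derivative, also for \<open>m = 0\<close>.\<close>

definition taylor_poly :: "nat \<Rightarrow> (real^'n \<Rightarrow> real) \<Rightarrow> real^'n \<Rightarrow> real" where
  "taylor_poly m f x = (\<Sum>l<m. iter_dir (replicate l x) f 0 / fact l)"

lemma good_cball: "good_domain (cball 0 1 :: 'a::euclidean_space set)"
proof -
  have "interior (cball 0 1 :: 'a set) = ball 0 1" by simp
  then have "interior (cball 0 1 :: 'a set) \<noteq> {}" by (metis ball_eq_empty not_one_le_zero)
  then show ?thesis by simp
qed

lemma Ck_on_coord_partial: "Ck_on (Suc k) (cball 0 1) f \<Longrightarrow> Ck_on k (cball 0 1) (coord_partial i f)"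
  by (intro Ck_on_partial) (auto simp: axis_in_Basis_iff)

lemma partial_on_sum_coord:
  fixes f :: "real^'n \<Rightarrow> real"
  assumes "Ck_on (Suc k) S f" "x \<in> S"
  shows "partial_on S v f x = (\<Sum>i\<in>UNIV. v $ i * partial_on S (axis i 1) f x)"
proof -
  have lin: "linear (\<lambda>v. partial_on S v f x)"
    by (rule has_derivative_linear[OF Ck_on_has_derivative[OF assms]])
  have "partial_on S v f x = partial_on S (\<Sum>i\<in>UNIV. (v $ i) *\<^sub>R axis i 1) f x"
    using basis_expansion[of v] by (simp add: scalar_mult_eq_scaleR)
  then show ?thesis by (simp add: linear_sum[OF lin] linear_cmul[OF lin])
qed

text \<open>Lets identities between derivatives that are known on the open ball, such as the
  symmetry of mixed partials, be used underneath further derivatives.\<close>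

lemma iter_dir_cong:
  assumes "open U" "U \<subseteq> cball 0 1" "z \<in> U" "\<And>x. x \<in> U \<Longrightarrow> f x = g x"
  shows "iter_dir us f z = iter_dir us g z"
  using assms(4)
proof (induction us arbitrary: f g)
  case (Cons u us)
  have "coord_partial i f x = coord_partial i g x" if "x \<in> U" for x i
    using partial_on_cong_interior[OF assms(1,2) that] Cons.prems by blast
  then have "iter_dir us (coord_partial i f) z = iter_dir us (coord_partial i g) z" for i
    by (rule Cons.IH)
  then show ?case by simp
qed (use assms(3) in simp)

text \<open>The head of the list is the direction differentiated first, so one more differentiation
  appends its direction at the end.\<close>

lemma iter_dir_DERIV:
  assumes "Ck_on (Suc (length us)) (cball 0 1) f" "y + t *\<^sub>R x \<in> ball 0 1"
  shows "((\<lambda>t. iter_dir us f (y + t *\<^sub>R x)) has_real_derivative iter_dir (us @ [x]) f (y + t *\<^sub>R x)) (at t)"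
  using assms(1)
proof (induction us arbitrary: f)
  case Nil
  have "((\<lambda>t. f (y + t *\<^sub>R x)) has_real_derivative partial_on (cball 0 1) x f (y + t *\<^sub>R x)) (at t)"
    using assms(2) by (intro Ck_on_line_DERIV[OF Nil]) auto
  moreover have "partial_on (cball 0 1) x f (y + t *\<^sub>R x) = (\<Sum>i\<in>UNIV. x $ i * coord_partial i f (y + t *\<^sub>R x))"
    using assms(2) by (intro partial_on_sum_coord[OF Nil]) auto
  ultimately show ?case by simp
next
  case (Cons u us)
  then have "Ck_on (Suc (length us)) (cball 0 1) (coord_partial i f)" for i
    by (intro Ck_on_coord_partial) simp
  from Cons.IH[OF this] show ?case by (auto intro!: DERIV_sum DERIV_cmult)
qed

lemma Ck_on_iter_partial:
  "Ck_on (k + length js) (cball 0 1) f \<Longrightarrow> Ck_on k (cball 0 1) (iter_partial js f)"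
proof (induction js arbitrary: k)
  case (Cons i js)
  then have "Ck_on (Suc k) (cball 0 1) (iter_partial js f)" by (intro Cons.IH) simp
  then show ?case by (simp add: Ck_on_coord_partial del: Ck_on.simps)
qed simp

text \<open>In \<open>iter_partial\<close> the last index is differentiated first, in
  \<open>iter_dir\<close> the head. Index lists are therefore split at their end when the two are
  compared.\<close>

lemma iter_partial_snoc: "iter_partial (js @ [i]) f = iter_partial js (coord_partial i f)"
  by (induction js) simp_all

lemma sum_lists_snoc:
  "(\<Sum>js | length js = Suc l. h js) = (\<Sum>i\<in>(UNIV::'n::finite set). \<Sum>js | length js = l. h (js @ [i]))"
proof -
  have "(\<Sum>js | length js = Suc l. h js) = (\<Sum>(i, js)\<in>UNIV \<times> {js :: 'n list. length js = l}. h (js @ [i]))"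
    by (rule sum.reindex_bij_witness[where i = "\<lambda>(i, js). js @ [i]" and j = "\<lambda>js. (last js, butlast js)"])
      (auto simp: length_Suc_conv_rev)
  then show ?thesis by (simp add: sum.cartesian_product)
qed

lemma abs_iter_dir_le:
  assumes "\<And>u. u \<in> set us \<Longrightarrow> norm u \<le> 1"
  shows "\<bar>iter_dir us f z\<bar> \<le> (\<Sum>js | length js = length us. \<bar>iter_partial js f z\<bar>)"
  using assms
proof (induction us arbitrary: f)
  case (Cons u us)
  have "\<bar>u $ i\<bar> \<le> 1" for i using component_le_norm_cart[of u i] Cons.prems[of u] by simp
  then have "\<bar>u $ i * iter_dir us (coord_partial i f) z\<bar> \<le>
      1 * (\<Sum>js | length js = length us. \<bar>iter_partial js (coord_partial i f) z\<bar>)" for i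
    unfolding abs_mult using Cons by (intro mult_mono Cons.IH) auto
  then have "(\<Sum>i\<in>UNIV. \<bar>u $ i * iter_dir us (coord_partial i f) z\<bar>) \<le>
      (\<Sum>i\<in>UNIV. \<Sum>js | length js = length us. \<bar>iter_partial js (coord_partial i f) z\<bar>)"
    by (intro sum_mono) simp
  then have "\<bar>iter_dir (u # us) f z\<bar> \<le> (\<Sum>i\<in>UNIV. \<Sum>js | length js = length us. \<bar>iter_partial (js @ [i]) f z\<bar>)"
    unfolding iter_dir.simps iter_partial_snoc by (rule order_trans[OF sum_abs])
  then show ?case by (simp add: sum_lists_snoc)
qed (simp add: sum.neutral)

lemma sum_iter_partial_le_Mnorm:
  assumes "Ck_on l (cball 0 1) f" "z \<in> cball 0 1"
  shows "(\<Sum>js | length js = l. \<bar>iter_partial js f z\<bar>) \<le> Mnorm l f"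
proof -
  have "continuous_on (cball 0 1) (\<lambda>z. \<Sum>js | length js = l. \<bar>iter_partial js f z\<bar>)"
    using assms(1) by (intro continuous_intros Ck_on_continuous[of 0] Ck_on_iter_partial) auto
  then have "bdd_above ((\<lambda>z. \<Sum>js | length js = l. \<bar>iter_partial js f z\<bar>) ` cball 0 1)"
    by (intro bounded_imp_bdd_above compact_imp_bounded compact_continuous_image compact_cball)
  then show ?thesis unfolding Mnorm_def by (rule cSUP_upper[OF assms(2)])
qed

lemma Mnorm_le:
  assumes "\<And>z. z \<in> cball 0 1 \<Longrightarrow> (\<Sum>js | length js = l. \<bar>iter_partial js f z\<bar>) \<le> c"
  shows "Mnorm l f \<le> c"
  unfolding Mnorm_def by (rule cSUP_least) (use assms in auto)

lemma abs_iter_dir_le_Mnorm: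
  assumes "Ck_on (length us) (cball 0 1) f" "z \<in> cball 0 1" "\<And>u. u \<in> set us \<Longrightarrow> norm u \<le> 1"
  shows "\<bar>iter_dir us f z\<bar> \<le> Mnorm (length us) f"
  using abs_iter_dir_le[OF assms(3)] sum_iter_partial_le_Mnorm[OF assms(1,2)] by (rule order_trans)

text \<open>The product rule inserts \<open>v\<close> into each of the \<open>Suc l\<close> slots of
  the multilinear form; by symmetry of the mixed partials every slot may be exchanged with the head,
  whence the factor \<open>Suc l\<close>.\<close>

lemma has_derivative_iter_dir_replicate:
  assumes "Ck_on (Suc l) (cball 0 1) f"
  shows "((\<lambda>x. iter_dir (replicate (Suc l) x) f 0) has_derivative
    (\<lambda>v. real (Suc l) * iter_dir (v # replicate l x) f 0)) (at x)"
  using assms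
proof (induction l arbitrary: f)
  case 0
  have "((\<lambda>x. \<Sum>i\<in>UNIV. x $ i * coord_partial i f 0) has_derivative
      (\<lambda>v. \<Sum>i\<in>UNIV. v $ i * coord_partial i f 0)) (at x)"
    by (intro has_derivative_sum has_derivative_mult_left bounded_linear_imp_has_derivative bounded_linear_vec_nth)
  then show ?case by simp
next
  case (Suc l)
  let ?D = "\<lambda>i v. real (Suc l) * iter_dir (v # replicate l x) (coord_partial i f) 0"
  have IH: "((\<lambda>x. iter_dir (replicate (Suc l) x) (coord_partial i f) 0) has_derivative ?D i) (at x)" for i
    by (rule Suc.IH[OF Ck_on_coord_partial[OF Suc.prems]])
  have "((\<lambda>x. \<Sum>i\<in>UNIV. x $ i * iter_dir (replicate (Suc l) x) (coord_partial i f) 0) has_derivative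
     (\<lambda>v. \<Sum>i\<in>UNIV. x $ i * ?D i v + v $ i * iter_dir (replicate (Suc l) x) (coord_partial i f) 0)) (at x)"
    by (intro has_derivative_sum has_derivative_mult IH bounded_linear_imp_has_derivative bounded_linear_vec_nth)
  moreover have "(\<Sum>i\<in>UNIV. x $ i * ?D i v + v $ i * iter_dir (replicate (Suc l) x) (coord_partial i f) 0)
      = real (Suc (Suc l)) * iter_dir (v # replicate (Suc l) x) f 0" for v
  proof -
    have sym: "iter_dir us (coord_partial j (coord_partial i f)) 0 = iter_dir us (coord_partial i (coord_partial j f)) 0"
      for us i j
      by (rule iter_dir_cong[of "ball 0 1"]) (auto intro!: partial_on_commute[OF good_cball Suc.prems])
    have "(\<Sum>i\<in>UNIV. x $ i * ?D i v) =
        real (Suc l) * (\<Sum>i\<in>UNIV. \<Sum>j\<in>UNIV. x $ i * (v $ j * iter_dir (replicate l x) (coord_partial j (coord_partial i f)) 0))"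
      by (simp add: sum_distrib_left mult_ac)
    also have "\<dots> = real (Suc l) * (\<Sum>j\<in>UNIV. \<Sum>i\<in>UNIV. x $ i * (v $ j * iter_dir (replicate l x) (coord_partial j (coord_partial i f)) 0))"
      by (subst sum.swap) (rule refl)
    also have "\<dots> = real (Suc l) * iter_dir (v # replicate (Suc l) x) f 0"
      by (simp add: sum_distrib_left sym mult_ac)
    finally have "(\<Sum>i\<in>UNIV. x $ i * ?D i v) = real (Suc l) * iter_dir (v # replicate (Suc l) x) f 0" .
    then show ?thesis by (simp only: sum.distrib iter_dir.simps(2)[of v]) (simp add: algebra_simps)
  qed
  ultimately show ?case by (simp only: replicate_Suc[of "Suc l"] iter_dir.simps(2)[of _ "replicate (Suc l) _"])
qed

lemma has_derivative_taylor_poly: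
  assumes "Ck_on m (cball 0 1) f"
  shows "(taylor_poly (Suc m) f has_derivative (\<lambda>v. \<Sum>i\<in>UNIV. v $ i * taylor_poly m (coord_partial i f) x)) (at x)"
proof -
  have "((\<lambda>x. f 0 + (\<Sum>l<m. iter_dir (replicate (Suc l) x) f 0 * (1 / fact (Suc l)))) has_derivative
     (\<lambda>v. 0 + (\<Sum>l<m. real (Suc l) * iter_dir (v # replicate l x) f 0 * (1 / fact (Suc l))))) (at x)"
    using assms
    by (intro has_derivative_add has_derivative_const has_derivative_sum has_derivative_mult_left
        has_derivative_iter_dir_replicate) (auto intro: Ck_on_mono simp del: Ck_on.simps)
  moreover have "f 0 + (\<Sum>l<m. iter_dir (replicate (Suc l) x) f 0 * (1 / fact (Suc l))) = taylor_poly (Suc m) f x" for x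
    unfolding taylor_poly_def sum.lessThan_Suc_shift by simp
  moreover have "0 + (\<Sum>l<m. real (Suc l) * iter_dir (v # replicate l x) f 0 * (1 / fact (Suc l))) =
      (\<Sum>i\<in>UNIV. v $ i * taylor_poly m (coord_partial i f) x)" for v
  proof -
    have "real (Suc l) * a * (1 / fact (Suc l)) = a / fact l" for l and a :: real
      by (simp add: field_simps del: of_nat_Suc)
    then have "0 + (\<Sum>l<m. real (Suc l) * iter_dir (v # replicate l x) f 0 * (1 / fact (Suc l))) =
        (\<Sum>l<m. \<Sum>i\<in>UNIV. v $ i * iter_dir (replicate l x) (coord_partial i f) 0 / fact l)"
      by (simp add: sum_divide_distrib)
    also have "\<dots> = (\<Sum>i\<in>UNIV. \<Sum>l<m. v $ i * iter_dir (replicate l x) (coord_partial i f) 0 / fact l)"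
      by (rule sum.swap)
    finally show ?thesis by (simp add: taylor_poly_def sum_distrib_left)
  qed
  ultimately show ?thesis by (simp only:)
qed

lemma coord_partial_taylor_poly:
  assumes "Ck_on m (cball 0 1) f" "x \<in> cball 0 1"
  shows "coord_partial j (taylor_poly (Suc m) f) x = taylor_poly m (coord_partial j f) x"
proof -
  have "coord_partial j (taylor_poly (Suc m) f) x = (\<Sum>i\<in>UNIV. axis j 1 $ i * taylor_poly m (coord_partial i f) x)"
    by (rule partial_on_eq[OF good_cball assms(2) has_derivative_at_withinI[OF has_derivative_taylor_poly[OF assms(1)]]])
  also have "\<dots> = (\<Sum>i\<in>UNIV. if i = j then taylor_poly m (coord_partial i f) x else 0)"
    by (intro sum.cong) (auto simp: axis_def)
  finally show ?thesis by simp
qed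

text \<open>Differentiating the Taylor polynomial gives the Taylor polynomial of the derivative. Its
  terms are written with \<open>us @ replicate l x\<close>, which are the successive derivatives of
  \<open>iter_dir us f\<close> along the ray through \<open>x\<close>.\<close>

lemma iter_dir_taylor_poly:
  assumes "Ck_on (m + length us) (cball 0 1) f" "x \<in> ball 0 1"
  shows "iter_dir us (taylor_poly (m + length us) f) x = (\<Sum>l<m. iter_dir (us @ replicate l x) f 0 / fact l)"
  using assms(1)
proof (induction us arbitrary: f)
  case Nil
  then show ?case by (simp add: taylor_poly_def)
next
  case (Cons u us)
  let ?n = "m + length us"
  have f: "Ck_on (Suc ?n) (cball 0 1) f" using Cons.prems by simp
  have "iter_dir us (coord_partial i (taylor_poly (Suc ?n) f)) x = iter_dir us (taylor_poly ?n (coord_partial i f)) x" for i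
    using assms(2) by (intro iter_dir_cong[of "ball 0 1"] coord_partial_taylor_poly Ck_on_SucD[OF f]) auto
  also have "\<dots> i = (\<Sum>l<m. iter_dir (us @ replicate l x) (coord_partial i f) 0 / fact l)" for i
    by (rule Cons.IH[OF Ck_on_coord_partial[OF f]])
  finally have "iter_dir (u # us) (taylor_poly (Suc ?n) f) x =
      (\<Sum>i\<in>UNIV. u $ i * (\<Sum>l<m. iter_dir (us @ replicate l x) (coord_partial i f) 0 / fact l))"
    by simp
  also have "\<dots> = (\<Sum>i\<in>UNIV. \<Sum>l<m. u $ i * iter_dir (us @ replicate l x) (coord_partial i f) 0 / fact l)"
    by (simp add: sum_distrib_left)
  also have "\<dots> = (\<Sum>l<m. \<Sum>i\<in>UNIV. u $ i * iter_dir (us @ replicate l x) (coord_partial i f) 0 / fact l)"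
    by (rule sum.swap)
  also have "\<dots> = (\<Sum>l<m. iter_dir ((u # us) @ replicate l x) f 0 / fact l)"
    by (simp add: sum_divide_distrib)
  finally show ?case by simp
qed

text \<open>Maclaurin's formula for \<open>iter_dir us f\<close> along the ray from 0 to
  \<open>x\<close>. After \<open>n = Suc d - length us\<close> terms the remainder is a derivative
  of total order \<open>Suc d\<close> in directions of norm at most 1. The empty list gives the
  estimate for the values, lists of length 1 and 2 those for the gradient and the second
  derivative.\<close>

lemma taylor_remainder_le:
  assumes f: "Ck_on (Suc d) (cball 0 1) f" and x: "x \<in> ball 0 1"
    and us: "length us \<le> d" "\<And>u. u \<in> set us \<Longrightarrow> norm u \<le> 1"
  shows "\<bar>iter_dir us f x - iter_dir us (taylor_poly (Suc d) f) x\<bar> \<le> Mnorm (Suc d) f / fact (Suc d - length us)"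
proof -
  define n where "n = Suc d - length us"
  have n: "n + length us = Suc d" "0 < n" using us by (auto simp: n_def)
  let ?diff = "\<lambda>l t. iter_dir (us @ replicate l x) f (t *\<^sub>R x)"
  have tx: "t *\<^sub>R x \<in> ball 0 1" if "0 \<le> t" "t \<le> 1" for t
    using that x mult_left_le_one_le[of "norm x" t] by simp
  have "\<exists>t>0. t < 1 \<and> iter_dir us f (1 *\<^sub>R x) = (\<Sum>l<n. ?diff l 0 / fact l * 1 ^ l) + ?diff n t / fact n * 1 ^ n"
  proof (rule Maclaurin)
    show "\<forall>l t. l < n \<and> 0 \<le> t \<and> t \<le> 1 \<longrightarrow> (?diff l has_real_derivative ?diff (Suc l) t) (at t)"
    proof (intro allI impI)
      fix l :: nat and t :: real assume *: "l < n \<and> 0 \<le> t \<and> t \<le> 1"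
      then have "Ck_on (Suc (length (us @ replicate l x))) (cball 0 1) f"
        using n by (intro Ck_on_mono[OF f]) auto
      from iter_dir_DERIV[OF this, of 0 t x] tx show "(?diff l has_real_derivative ?diff (Suc l) t) (at t)"
        using * by (simp add: replicate_append_same del: ball_simps)
    qed
  qed (use n in auto)
  then obtain t where t: "0 < t" "t < 1" "iter_dir us f x = (\<Sum>l<n. ?diff l 0 / fact l) + ?diff n t / fact n"
    by auto
  have "iter_dir us (taylor_poly (Suc d) f) x = (\<Sum>l<n. ?diff l 0 / fact l)"
    using iter_dir_taylor_poly[of n us f x] f x n(1) by (simp del: Ck_on.simps)
  then have "\<bar>iter_dir us f x - iter_dir us (taylor_poly (Suc d) f) x\<bar> = \<bar>?diff n t\<bar> / fact n"
    using t(3) by simp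
  moreover have "\<bar>?diff n t\<bar> \<le> Mnorm (length (us @ replicate n x)) f"
    using f n(1) tx[of t] t us x
    by (intro abs_iter_dir_le_Mnorm) (auto simp: add.commute simp del: Ck_on.simps)
  ultimately show ?thesis using n(1) by (simp add: divide_right_mono add.commute flip: n_def)
qed

section \<open>Polynomial functions\<close>

lemma poly_fun_mono:
  assumes "poly_fun d P" "d \<le> d'"
  shows "poly_fun d' P"
proof -
  obtain c where c: "\<And>x. P x = (\<Sum>\<alpha> | sum \<alpha> UNIV \<le> d. c \<alpha> * (\<Prod>i\<in>UNIV. x $ i ^ \<alpha> i))"
    using assms(1) unfolding poly_fun_def by blast
  have "P x = (\<Sum>\<alpha> | sum \<alpha> UNIV \<le> d'. (if sum \<alpha> UNIV \<le> d then c \<alpha> else 0) * (\<Prod>i\<in>UNIV. x $ i ^ \<alpha> i))" for x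
    unfolding c using assms(2) by (intro sum.mono_neutral_cong_left finite_exponents) auto
  then show ?thesis unfolding poly_fun_def
    by (intro exI[of _ "\<lambda>\<alpha>. if sum \<alpha> UNIV \<le> d then c \<alpha> else 0"]) blast
qed

lemma poly_fun_monomial:
  assumes "sum \<alpha> UNIV \<le> d"
  shows "poly_fun d (\<lambda>x. \<Prod>i\<in>UNIV. x $ i ^ \<alpha> i)"
proof -
  have "(\<Prod>i\<in>UNIV. x $ i ^ \<alpha> i) = (\<Sum>\<beta> | sum \<beta> UNIV \<le> d. (if \<beta> = \<alpha> then 1 else 0) * (\<Prod>i\<in>UNIV. x $ i ^ \<beta> i))" for x :: "real^'a"
  proof -
    have "(\<Sum>\<beta> | sum \<beta> UNIV \<le> d. (if \<beta> = \<alpha> then 1 else 0) * (\<Prod>i\<in>UNIV. x $ i ^ \<beta> i)) =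
        (\<Sum>\<beta> | sum \<beta> UNIV \<le> d. if \<beta> = \<alpha> then (\<Prod>i\<in>UNIV. x $ i ^ \<beta> i) else 0)"
      by (intro sum.cong) auto
    then show ?thesis using assms by (simp add: finite_exponents)
  qed
  then show ?thesis unfolding poly_fun_def by (intro exI[of _ "\<lambda>\<beta>. if \<beta> = \<alpha> then 1 else 0"]) blast
qed

lemma poly_fun_cmult:
  assumes "poly_fun d P"
  shows "poly_fun d (\<lambda>x. a * P x)"
proof -
  obtain c where c: "\<And>x. P x = (\<Sum>\<alpha> | sum \<alpha> UNIV \<le> d. c \<alpha> * (\<Prod>i\<in>UNIV. x $ i ^ \<alpha> i))"
    using assms unfolding poly_fun_def by blast
  show ?thesis unfolding poly_fun_def
    by (intro exI[of _ "\<lambda>\<alpha>. a * c \<alpha>"]) (simp add: c sum_distrib_left mult.assoc)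
qed

lemma poly_fun_add:
  assumes "poly_fun d P" "poly_fun d Q"
  shows "poly_fun d (\<lambda>x. P x + Q x)"
proof -
  obtain c where c: "\<And>x. P x = (\<Sum>\<alpha> | sum \<alpha> UNIV \<le> d. c \<alpha> * (\<Prod>i\<in>UNIV. x $ i ^ \<alpha> i))"
    using assms unfolding poly_fun_def by blast
  obtain c' where c': "\<And>x. Q x = (\<Sum>\<alpha> | sum \<alpha> UNIV \<le> d. c' \<alpha> * (\<Prod>i\<in>UNIV. x $ i ^ \<alpha> i))"
    using assms unfolding poly_fun_def by blast
  show ?thesis unfolding poly_fun_def
    by (intro exI[of _ "\<lambda>\<alpha>. c \<alpha> + c' \<alpha>"]) (simp add: c c' sum.distrib distrib_right)
qed

lemma poly_fun_const: "poly_fun d (\<lambda>_. a)"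
  using poly_fun_cmult[OF poly_fun_monomial[of "\<lambda>_. 0" d], of a] by simp

lemma poly_fun_sum:
  "(\<And>i. i \<in> I \<Longrightarrow> poly_fun d (P i)) \<Longrightarrow> poly_fun d (\<lambda>x. \<Sum>i\<in>I. P i x)"
  by (induction I rule: infinite_finite_induct) (auto intro: poly_fun_const poly_fun_add)

lemma poly_fun_coord_mult:
  assumes "poly_fun d P"
  shows "poly_fun (Suc d) (\<lambda>x. x $ j * P x)"
proof -
  obtain c where c: "\<And>x. P x = (\<Sum>\<alpha> | sum \<alpha> UNIV \<le> d. c \<alpha> * (\<Prod>i\<in>UNIV. x $ i ^ \<alpha> i))"
    using assms unfolding poly_fun_def by blast
  have *: "x $ j * (\<Prod>i\<in>UNIV. x $ i ^ \<alpha> i) = (\<Prod>i\<in>UNIV. x $ i ^ (\<alpha>(j := Suc (\<alpha> j))) i)" for x :: "real^'a" and \<alpha>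
    by (subst (1 2) prod.remove[of _ j]) (auto intro!: prod.cong)
  have "sum (\<alpha>(j := Suc (\<alpha> j))) UNIV \<le> Suc d" if "sum \<alpha> UNIV \<le> d" for \<alpha>
  proof -
    have "sum (\<alpha>(j := Suc (\<alpha> j))) UNIV = Suc (\<alpha> j) + sum \<alpha> (UNIV - {j})"
      by (subst sum.remove[of _ j]) (auto intro!: sum.cong)
    also have "\<dots> = Suc (sum \<alpha> UNIV)" by (subst sum.remove[of UNIV j \<alpha>]) auto
    finally show ?thesis using that by simp
  qed
  then have "poly_fun (Suc d) (\<lambda>x. \<Sum>\<alpha> | sum \<alpha> UNIV \<le> d. c \<alpha> * (x $ j * (\<Prod>i\<in>UNIV. x $ i ^ \<alpha> i)))"
    unfolding * by (intro poly_fun_sum poly_fun_cmult poly_fun_monomial) auto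
  then show ?thesis by (simp add: c sum_distrib_left mult_ac)
qed

lemma Ck_on_poly_fun:
  assumes "poly_fun d P" "good_domain S"
  shows "Ck_on k S P"
proof -
  obtain c where c: "\<And>x. P x = (\<Sum>\<alpha> | sum \<alpha> UNIV \<le> d. c \<alpha> * (\<Prod>i\<in>UNIV. x $ i ^ \<alpha> i))"
    using assms unfolding poly_fun_def by blast
  have "Ck_on k S (\<lambda>x. \<Sum>\<alpha> | sum \<alpha> UNIV \<le> d. c \<alpha> * (\<Prod>i\<in>UNIV. x $ i ^ \<alpha> i))"
    using assms(2)
    by (intro Ck_on_sum Ck_on_cmult Ck_on_prod Ck_on_power Ck_on_bounded_linear bounded_linear_vec_nth)
  then show ?thesis by (subst Ck_on_cong) (rule c)
qed

lemma poly_fun_iter_dir_replicate: "poly_fun l (\<lambda>x. iter_dir (replicate l x) f 0)"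
  by (induction l arbitrary: f) (auto intro!: poly_fun_const poly_fun_sum poly_fun_coord_mult)

lemma poly_fun_taylor_poly: "poly_fun d (taylor_poly (Suc d) f)"
proof -
  have "poly_fun d (\<lambda>x. \<Sum>l<Suc d. (1 / fact l) * iter_dir (replicate l x) f 0)"
    by (intro poly_fun_sum poly_fun_cmult poly_fun_mono[OF poly_fun_iter_dir_replicate]) auto
  then show ?thesis by (simp add: taylor_poly_def[abs_def])
qed

section \<open>Components of regular zero sets\<close>

lemma openin_component_if_locally_connected_at:
  assumes loc: "\<And>p. p \<in> X \<Longrightarrow> \<exists>U V. open U \<and> p \<in> U \<and> connected V \<and> X \<inter> U \<subseteq> V \<and> V \<subseteq> X"
    and C: "C \<in> components X"
  shows "openin (top_of_set X) C"
proof (subst openin_subopen, intro ballI)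
  fix p assume p: "p \<in> C"
  then have pX: "p \<in> X" using in_components_subset[OF C] by auto
  then obtain U V where U: "open U" "p \<in> U" "connected V" "X \<inter> U \<subseteq> V" "V \<subseteq> X" using loc[OF pX] by blast
  then have "V \<subseteq> C" using p pX by (intro components_maximal[OF C]) auto
  then show "\<exists>T. openin (top_of_set X) T \<and> p \<in> T \<and> T \<subseteq> C"
    using U pX by (intro exI[of _ "X \<inter> U"]) auto
qed

lemma finite_components_if_open:
  assumes "compact X" "\<And>C. C \<in> components X \<Longrightarrow> openin (top_of_set X) C"
  shows "finite (components X)"
proof -
  obtain U where U: "\<And>C. C \<in> components X \<Longrightarrow> open (U C) \<and> C = X \<inter> U C"
    using assms(2) unfolding openin_open by metis
  have "X \<subseteq> \<Union> (U ` components X)" using U Union_components[of X] by blast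
  then obtain F where F: "F \<subseteq> components X" "finite F" "X \<subseteq> \<Union> (U ` F)"
    using compactE_image[OF assms(1), of "components X" U] U by metis
  have "components X \<subseteq> F"
  proof
    fix C assume C: "C \<in> components X"
    then obtain x where x: "x \<in> C" using in_components_nonempty by blast
    then have "x \<in> X" using in_components_subset[OF C] by auto
    then obtain D where D: "D \<in> F" "x \<in> U D" using F by auto
    then have "x \<in> D" using U F \<open>x \<in> X\<close> by blast
    then show "C \<in> F" using components_eq[OF C, of D] D F x by auto
  qed
  then show ?thesis using F finite_subset by blast
qed

text \<open>A connected subset of \<open>X\<close> that meets the clopen set \<open>S\<close> lies
  in \<open>S\<close>, so a maximal connected subset of \<open>S\<close> is also maximal in
  \<open>X\<close>.\<close>

lemma components_clopen_subset:
  assumes "openin (top_of_set X) S" "closedin (top_of_set X) S"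
  shows "components S \<subseteq> components X"
proof
  fix C assume C: "C \<in> components S"
  have SX: "S \<subseteq> X" using assms(1) by (rule openin_imp_subset)
  have C': "C \<noteq> {}" "C \<subseteq> S" "connected C" "\<And>D. D \<noteq> {} \<Longrightarrow> C \<subseteq> D \<Longrightarrow> D \<subseteq> S \<Longrightarrow> connected D \<Longrightarrow> D = C"
    using C by (simp_all add: in_components_maximal)
  have "D = C" if D: "D \<noteq> {}" "C \<subseteq> D" "D \<subseteq> X" "connected D" for D
  proof -
    have "openin (top_of_set D) (D \<inter> S)" "closedin (top_of_set D) (D \<inter> S)"
      using assms D(3) by (auto simp: openin_open closedin_closed)
    moreover have "D \<inter> S \<noteq> {}" using C'(1,2) D(2) by auto
    ultimately have "D \<inter> S = D" using D(4)[unfolded connected_clopen] by auto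
    then show ?thesis using D by (intro C'(4)) auto
  qed
  then show "C \<in> components X"
    using C'(1-3) SX by (simp add: in_components_maximal subset_trans[of C S X])
qed

lemma components_homeomorphic_image:
  assumes "homeomorphism S T h h'"
  shows "components T = (\<lambda>C. h ` C) ` components S"
proof -
  have "components T = connected_component_set T ` (h ` S)"
    using assms by (simp add: components_def homeomorphism_def)
  also have "\<dots> = (\<lambda>x. h ` connected_component_set S x) ` S"
    unfolding image_image by (intro image_cong refl connected_component_set_homeomorphism[OF assms])
  finally show ?thesis by (simp add: components_def image_image)
qed

lemma card_components_homeomorphic:
  assumes "homeomorphism S T h h'"
  shows "card (components T) = card (components S)"
proof -
  have "inj_on (\<lambda>C. h ` C) (components S)"
  proof (rule inj_on_inverseI)
    fix C assume "C \<in> components S"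
    then have "C \<subseteq> S" by (rule in_components_subset)
    then show "h' ` (h ` C) = C"
      using homeomorphism_apply1[OF assms] by (auto simp: image_image subset_iff intro!: image_eqI)
  qed
  then show ?thesis
    unfolding components_homeomorphic_image[OF assms] by (rule card_image)
qed

text \<open>Near a regular zero \<open>p\<close>, moving each point along a fixed transversal direction to the zero
  set is a continuous retraction of a ball around \<open>p\<close>, whence local connectedness.\<close>

lemma zero_set_locally_connected:
  fixes G :: "'a::euclidean_space \<Rightarrow> real"
  assumes N: "open N" and G: "Ck_on (Suc k) N G" and p: "p \<in> N" "G p = 0" and nz: "partial_on N v G p \<noteq> 0"
  shows "\<exists>U V. open U \<and> p \<in> U \<and> connected V \<and> {x \<in> N. G x = 0} \<inter> U \<subseteq> V \<and> V \<subseteq> {x \<in> N. G x = 0}"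
proof -
  obtain e R where e: "norm e = 1" and R: "R > 0" "cball p R \<subseteq> N" and pos: "\<And>x. x \<in> cball p R \<Longrightarrow> partial_on N e G x > 0"
    using regular_direction[OF N G p(1) nz] by blast
  define B where "B = ball p R"
  have BN: "B \<subseteq> N" using R by (auto simp: B_def)
  have GB: "Ck_on (Suc k) B G" using Ck_on_subset[OF _ BN G] by (simp add: B_def del: Ck_on.simps)
  have mono: "G (q + a *\<^sub>R e) < G (q + b *\<^sub>R e)"
    if "q + a *\<^sub>R e \<in> B" "q + b *\<^sub>R e \<in> B" "a < b" for q a b
  proof (rule line_strict_mono[OF _ _ GB _ that])
    fix w assume "w \<in> B"
    then show "partial_on B e G w > 0"
      using pos[of w] partial_on_subset[OF _ BN _ G, of w e] by (simp add: B_def)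
  qed (auto simp: B_def)
  define \<eta> where "\<eta> = R / 2"
  have inB: "q + a *\<^sub>R e \<in> B" if "dist p q < R / 2" "\<bar>a\<bar> \<le> \<eta>" for q a
  proof -
    have "dist p (q + a *\<^sub>R e) \<le> dist p q + norm (a *\<^sub>R e)"
      using dist_triangle[of p "q + a *\<^sub>R e" q] by (simp add: dist_norm)
    then show ?thesis using that by (simp add: B_def \<eta>_def e)
  qed
  have \<eta>: "\<eta> > 0" using R by (simp add: \<eta>_def)
  have cont: "continuous_on (ball p (R / 2)) (\<lambda>q. G (q + a *\<^sub>R e))" if "\<bar>a\<bar> \<le> \<eta>" for a
    using that inB by (intro continuous_on_compose2[OF Ck_on_continuous[OF GB]] continuous_intros) auto
  \<comment> \<open>For \<open>q\<close> in \<open>D\<close> the line through \<open>q\<close>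
    crosses the zero set at a parameter between \<open>- \<eta>\<close> and \<eta>; the sign
    conditions are open and hold at \<open>p\<close> by monotonicity.\<close>
  define D where "D = {q \<in> ball p (R / 2). G (q + \<eta> *\<^sub>R e) > 0} \<inter> {q \<in> ball p (R / 2). G (q + (- \<eta>) *\<^sub>R e) < 0}"
  have "open D" unfolding D_def
    using continuous_open_preimage[OF cont[of \<eta>] open_ball, of "{0<..}"]
      continuous_open_preimage[OF cont[of "- \<eta>"] open_ball, of "{..<0}"] \<eta>
    by (intro open_Int) (auto simp: vimage_def Int_def)
  moreover have "p \<in> D"
    using mono[of p 0 \<eta>] mono[of p "- \<eta>" 0] inB[of p 0] inB[of p \<eta>] inB[of p "- \<eta>"] p R \<eta> by (simp add: D_def)
  ultimately obtain \<delta> where \<delta>: "\<delta> > 0" "ball p \<delta> \<subseteq> D" using open_contains_ball_eq by blast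
  let ?S = "ball p \<delta>"
  have "\<exists>t. \<bar>t\<bar> < \<eta> \<and> G (q + t *\<^sub>R e) = 0" if "q \<in> D" for q
  proof -
    have q: "dist p q < R / 2" "G (q + \<eta> *\<^sub>R e) > 0" "G (q + (- \<eta>) *\<^sub>R e) < 0" using that by (auto simp: D_def)
    have "continuous_on {- \<eta>..\<eta>} (\<lambda>t. G (q + t *\<^sub>R e))"
      using inB q(1) by (intro continuous_on_compose2[OF Ck_on_continuous[OF GB]] continuous_intros) auto
    then obtain t where "- \<eta> \<le> t" "t \<le> \<eta>" "G (q + t *\<^sub>R e) = 0"
      using IVT'[of "\<lambda>t. G (q + t *\<^sub>R e)" "- \<eta>" 0 \<eta>] q \<eta> by auto
    moreover then have "t \<noteq> \<eta>" "t \<noteq> - \<eta>" using q by auto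
    ultimately show ?thesis by (intro exI[of _ t]) auto
  qed
  then obtain t where t: "\<And>q. q \<in> ?S \<Longrightarrow> \<bar>t q\<bar> < \<eta>" "\<And>q. q \<in> ?S \<Longrightarrow> G (q + t q *\<^sub>R e) = 0"
    using \<delta>(2) by (metis subsetD)
  have dS: "dist p q < R / 2" if "q \<in> ?S" for q using that \<delta>(2) by (auto simp: D_def)
  have SR: "?S \<subseteq> ball p (R / 2)" using dS by (meson mem_ball subsetI)
  have lt: "a < t q" if "q \<in> ?S" "\<bar>a\<bar> \<le> \<eta>" "G (q + a *\<^sub>R e) < 0" for q a
    using mono[of q "t q" a] that t[of q] inB[OF dS[OF that(1)]] by (cases a "t q" rule: linorder_cases) auto
  have gt: "t q < a" if "q \<in> ?S" "\<bar>a\<bar> \<le> \<eta>" "G (q + a *\<^sub>R e) > 0" for q a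
    using mono[of q a "t q"] that t[of q] inB[OF dS[OF that(1)]] by (cases a "t q" rule: linorder_cases) auto
  \<comment> \<open>For parameters \<open>a\<close> in \<open>[- \<eta>, \<eta>]\<close>,
    \<open>a < t q\<close> means \<open>G (q + a *\<^sub>R e) < 0\<close>, which is an open
    condition on \<open>q\<close>, and likewise on the other side. Below, \<open>b\<close> is
    \<open>a\<close> cut off at \<open>- \<eta>\<close> or \<eta>, so that the points stay in the
    ball.\<close>
  have tcont: "continuous_on ?S t"
    unfolding continuous_on_def
  proof (intro ballI order_tendstoI)
    fix q a assume q: "q \<in> ?S" and a: "a < t q"
    define b where "b = max a (- \<eta>)"
    have b: "\<bar>b\<bar> \<le> \<eta>" "b < t q" "a \<le> b" using a t(1)[OF q] by (auto simp: b_def)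
    have "G (q + b *\<^sub>R e) < G (q + t q *\<^sub>R e)" using b t(1)[OF q] by (intro mono inB dS[OF q]) auto
    then have "((\<lambda>q. G (q + b *\<^sub>R e)) \<longlongrightarrow> G (q + b *\<^sub>R e)) (at q within ?S)" "G (q + b *\<^sub>R e) < 0"
      using continuous_on_subset[OF cont[OF b(1)] SR] q t(2)[OF q] by (auto simp: continuous_on_def)
    then have "eventually (\<lambda>x. G (x + b *\<^sub>R e) < 0) (at q within ?S)" by (rule order_tendstoD)
    then show "eventually (\<lambda>x. a < t x) (at q within ?S)"
      using b lt[of _ b] by (auto simp: eventually_at_filter elim!: eventually_mono intro: order_le_less_trans)
  next
    fix q a assume q: "q \<in> ?S" and a: "t q < a"
    define b where "b = min a \<eta>"
    have b: "\<bar>b\<bar> \<le> \<eta>" "t q < b" "b \<le> a" using a t(1)[OF q] by (auto simp: b_def)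
    have "G (q + t q *\<^sub>R e) < G (q + b *\<^sub>R e)" using b t(1)[OF q] by (intro mono inB dS[OF q]) auto
    then have "((\<lambda>q. G (q + b *\<^sub>R e)) \<longlongrightarrow> G (q + b *\<^sub>R e)) (at q within ?S)" "G (q + b *\<^sub>R e) > 0"
      using continuous_on_subset[OF cont[OF b(1)] SR] q t(2)[OF q] by (auto simp: continuous_on_def)
    then have "eventually (\<lambda>x. G (x + b *\<^sub>R e) > 0) (at q within ?S)" by (rule order_tendstoD)
    then show "eventually (\<lambda>x. t x < a) (at q within ?S)"
      using b gt[of _ b] by (auto simp: eventually_at_filter elim!: eventually_mono intro: order_less_le_trans)
  qed
  define V where "V = (\<lambda>q. q + t q *\<^sub>R e) ` ?S"
  have "connected V"
    unfolding V_def by (intro connected_continuous_image continuous_intros tcont connected_ball)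
  moreover have "V \<subseteq> {x \<in> N. G x = 0}"
    using t inB dS BN less_imp_le unfolding V_def by blast
  moreover have "{x \<in> N. G x = 0} \<inter> ?S \<subseteq> V"
  proof
    fix q assume q: "q \<in> {x \<in> N. G x = 0} \<inter> ?S"
    have "t q = 0"
      using mono[of q 0 "t q"] mono[of q "t q" 0] q t[of q] inB[OF dS, of q 0] inB[OF dS, of q "t q"] \<eta>
      by (cases "t q" "0::real" rule: linorder_cases) auto
    then show "q \<in> V" unfolding V_def using q by (intro image_eqI[of _ _ q]) auto
  qed
  ultimately show ?thesis using \<delta> by (intro exI[of _ ?S] exI[of _ V]) auto
qed

section \<open>From ambient isotopies to isotopies of the ball\<close>

lemma ambient_isotopic_homeomorphism:
  assumes "ambient_isotopic k Y W"
  obtains h h' where "homeomorphism Y W h h'"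
proof -
  obtain H K where H: "Ck_on k UNIV H" "Ck_on k UNIV K" "\<And>t x. H (t::real, K (t, x)) = x"
    "\<And>t x. K (t, H (t, x)) = x" "(\<lambda>x. H (1, x)) ` Y = W"
    using assms by (elim ambient_isotopicE) (rule that; assumption)
  have c: "continuous_on S (\<lambda>x. F (1, x))" if "Ck_on k UNIV F" for S and F :: "real \<times> 'a \<Rightarrow> 'a"
    using Ck_on_continuous[OF that] by (rule continuous_on_compose2) (auto intro!: continuous_intros)
  have "homeomorphism Y W (\<lambda>x. H (1, x)) (\<lambda>x. K (1, x))"
    using H(5) by (intro homeomorphismI c H(1,2)) (auto simp: H(3,4))
  then show ?thesis by (rule that)
qed

text \<open>The maps are bijective and fix every point outside the open ball, so they preserve the
  closed ball; \<open>K\<close> provides the smooth inverses.\<close>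

lemma ambient_isotopic_imp_Ck_isotopic:
  assumes "ambient_isotopic k Y W"
  shows "Ck_isotopic k (cball 0 1) Y W"
proof -
  obtain H K where H: "Ck_on k UNIV H" "Ck_on k UNIV K" "\<And>t x. H (t::real, K (t, x)) = x"
    "\<And>t x. K (t, H (t, x)) = x" "\<And>x. H (0, x) = x"
    "\<And>t x. x \<notin> ball 0 1 \<Longrightarrow> H (t, x) = x" "\<And>t x. x \<notin> ball 0 1 \<Longrightarrow> K (t, x) = x" "(\<lambda>x. H (1, x)) ` Y = W"
    using assms by (elim ambient_isotopicE) (rule that; assumption)
  let ?S = "cball 0 1 :: 'a set"
  have maps: "F (t, x) \<in> ?S" if "x \<in> ?S" and F: "\<And>t x. F (t, F' (t, x)) = x" "\<And>t x. F' (t, F (t, x)) = x"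
      "\<And>t x. x \<notin> ball 0 1 \<Longrightarrow> F (t, x) = x" "\<And>t x. x \<notin> ball 0 1 \<Longrightarrow> F' (t, x) = x"
    for t :: real and x :: 'a and F F' :: "real \<times> 'a \<Rightarrow> 'a"
  proof (rule ccontr)
    assume "F (t, x) \<notin> ?S"
    then have "F' (t, F (t, x)) = F (t, x)" by (intro F(4)) auto
    then show False using F(2)[of t x] \<open>x \<in> ?S\<close> \<open>F (t, x) \<notin> ?S\<close> by simp
  qed
  have HS: "H (t, x) \<in> ?S" and KS: "K (t, x) \<in> ?S" if "x \<in> ?S" for t x
    using maps[OF that, of H K t] maps[OF that, of K H t] H by blast+
  have slice: "Ck_on k ?S (\<lambda>x. F (t, x))" if "Ck_on k UNIV F" for t and F :: "real \<times> 'a \<Rightarrow> 'a"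
    by (intro Ck_on_compose[OF good_cball _ _ that] Ck_on_Pair Ck_on_const Ck_on_id good_cball) auto
  have "Ck_on k ({0..1} \<times> ?S) H"
  proof (rule Ck_on_subset[OF _ subset_UNIV H(1)])
    have "interior ({0..1} \<times> ?S :: (real \<times> 'a) set) = {0<..<1} \<times> ball 0 1"
      by (simp add: interior_Times)
    moreover have "(1 / 2, 0) \<in> {0<..<1::real} \<times> ball (0::'a) 1" by simp
    ultimately show "good_domain ({0..1} \<times> ?S :: (real \<times> 'a) set)"
      by (metis convex_Times convex_cball convex_real_interval(5) empty_iff)
  qed
  moreover have "Ck_diffeo k ?S (\<lambda>x. H (t, x))" for t
    unfolding Ck_diffeo_def
  proof (intro conjI)
    show b: "bij_betw (\<lambda>x. H (t, x)) ?S ?S"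
      by (rule bij_betw_byWitness[where f' = "\<lambda>x. K (t, x)"]) (use H(3,4) HS KS in auto)
    show "Ck_on k ?S (\<lambda>x. H (t, x))" by (rule slice[OF H(1)])
    have "inv_into ?S (\<lambda>x. H (t, x)) x = K (t, x)" if "x \<in> ?S" for x
      using bij_betw_imp_inj_on[OF b] KS[OF that] H(3) by (intro inv_into_f_eq) auto
    then show "Ck_on k ?S (inv_into ?S (\<lambda>x. H (t, x)))"
      using slice[OF H(2)] by (subst Ck_on_cong) 
  qed
  ultimately show ?thesis
    unfolding Ck_isotopic_def using H(5,8) by (intro exI[of _ H]) auto
qed

section \<open>Zeros near a regular zero set\<close>

lemma iter_dir_single_eq_inner: "iter_dir [v] f x = v \<bullet> grad_on (cball 0 1) f x"
  by (simp add: inner_vec_def grad_on_def)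

lemma iter_dir_single_eq_partial:
  assumes "Ck_on (Suc k) (cball 0 1) f" "x \<in> cball 0 1"
  shows "iter_dir [v] f x = partial_on (cball 0 1) v f x"
  by (subst partial_on_sum_coord[OF assms]) simp

lemma abs_iter_dir_pair_le:
  fixes f :: "real^'n \<Rightarrow> real"
  assumes "\<And>u v. norm u \<le> 1 \<Longrightarrow> norm v \<le> 1 \<Longrightarrow> \<bar>iter_dir [u, v] f z\<bar> \<le> C"
  shows "\<bar>iter_dir [u, v] f z\<bar> \<le> C * (norm u * norm v)"
proof (cases "u = 0 \<or> v = 0")
  case True
  then show ?thesis by (auto simp: sum.neutral)
next
  case False
  have "iter_dir [a *\<^sub>R u, b *\<^sub>R v] f z = a * b * iter_dir [u, v] f z" for a b
    by (simp add: sum_distrib_left mult_ac)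
  moreover have "\<bar>iter_dir [(1 / norm u) *\<^sub>R u, (1 / norm v) *\<^sub>R v] f z\<bar> \<le> C"
    using False by (intro assms) auto
  ultimately have "\<bar>iter_dir [u, v] f z\<bar> / (norm u * norm v) \<le> C"
    using False by (simp add: abs_mult del: iter_dir.simps)
  then show ?thesis using False by (simp add: pos_divide_le_eq del: iter_dir.simps)
qed

text \<open>That \<open>x - y\<close> and the gradient \<open>g\<close> are parallel appears as the
  equality case of the Cauchy-Schwarz inequality, with the sign of \<open>f x\<close>. So along the
  segment from \<open>y\<close> to \<open>x\<close> the linear term of \<sigma> \<open>f\<close> is
  the full \<open>norm v * norm g\<close>, and the second-order remainder costs at most
  \<open>C / 2 * (dist x y)^2\<close>.\<close>

lemma nearest_zero_lower_bound:
  fixes f :: "real^'n \<Rightarrow> real"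
  assumes f: "Ck_on 2 (cball 0 1) f"
    and hess: "\<And>u v z. norm u \<le> 1 \<Longrightarrow> norm v \<le> 1 \<Longrightarrow> z \<in> ball 0 1 \<Longrightarrow> \<bar>iter_dir [u, v] f z\<bar> \<le> C"
    and x: "x \<in> ball 0 1" and y: "y \<in> ball 0 1" "f y = 0"
    and near: "\<And>z. z \<in> ball 0 1 \<Longrightarrow> f z = 0 \<Longrightarrow> dist x y \<le> dist x z"
    and grad: "\<gamma> \<le> norm (grad_on (cball 0 1) f y)" "\<gamma> > 0"
  shows "\<gamma> * dist x y - C / 2 * (dist x y)\<^sup>2 \<le> \<bar>f x\<bar>"
proof (cases "x = y")
  case True
  then show ?thesis by simp
next
  case False
  define v where "v = x - y"
  define g where "g = grad_on (cball 0 1) f y"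
  have v: "v \<noteq> 0" "norm v = dist x y" using False by (auto simp: v_def dist_norm)
  have g: "norm g > 0" using grad by (auto simp: g_def)
  have "f x \<noteq> 0" using near[OF x] False by auto
  define \<sigma> where "\<sigma> = sgn (f x)"
  have \<sigma>: "\<bar>\<sigma>\<bar> = 1" "\<sigma> * f x = \<bar>f x\<bar>" "\<sigma> * \<sigma> = 1" using \<open>f x \<noteq> 0\<close> by (auto simp: \<sigma>_def sgn_if)
  have seg: "y + t *\<^sub>R v \<in> ball 0 1" if "0 \<le> t" "t \<le> 1" for t
    using convexD_alt[OF convex_ball y(1) x that] by (simp add: v_def algebra_simps)
  \<comment> \<open>\<open>f\<close> does not vanish in the ball around \<open>x\<close> through \<open>y\<close>, so that \<open>\<sigma> f\<close> does not decrease
    from \<open>y\<close> towards the inside of that ball.\<close>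
  have inward: "\<sigma> * (w \<bullet> g) \<ge> 0" if w: "w \<bullet> v > 0" for w
  proof (rule ccontr)
    assume "\<not> \<sigma> * (w \<bullet> g) \<ge> 0"
    then have neg: "\<sigma> * (w \<bullet> g) < 0" by simp
    have "((\<lambda>t. iter_dir [] f (y + t *\<^sub>R w)) has_real_derivative iter_dir ([] @ [w]) f (y + 0 *\<^sub>R w)) (at 0)"
      using f y by (intro iter_dir_DERIV) (auto intro: Ck_on_mono simp del: Ck_on.simps)
    then have "((\<lambda>t. f (y + t *\<^sub>R w)) has_real_derivative w \<bullet> g) (at 0)"
      by (simp add: iter_dir_single_eq_inner g_def del: iter_dir.simps(2))
    then have "((\<lambda>t. \<sigma> * f (y + t *\<^sub>R w)) has_real_derivative \<sigma> * (w \<bullet> g)) (at 0)"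
      by (rule DERIV_cmult)
    from DERIV_neg_dec_right[OF this neg] obtain d where d: "d > 0"
      "\<And>h. 0 < h \<Longrightarrow> h < d \<Longrightarrow> \<sigma> * f (y + h *\<^sub>R w) < 0"
      using y(2) by auto
    have "w \<noteq> 0" using w by auto
    \<comment> \<open>The three bounds ensure, in this order, that \<sigma> \<open>f\<close> is
      negative at \<open>y + t *\<^sub>R w\<close>, that this point is closer to \<open>x\<close>
      than \<open>y\<close> is, and that it lies in the unit ball.\<close>
    define t where "t = Min {d / 2, (w \<bullet> v) / (norm w)\<^sup>2, (1 - norm y) / (2 * norm w)}"
    have t: "0 < t" "t < d" "t \<le> (w \<bullet> v) / (norm w)\<^sup>2" "t \<le> (1 - norm y) / (2 * norm w)"
      using d w \<open>w \<noteq> 0\<close> y(1) by (auto simp: t_def)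
    define q where "q = y + t *\<^sub>R w"
    have qneg: "\<sigma> * f q < 0" using d t by (simp add: q_def)
    have "norm (t *\<^sub>R w) \<le> (1 - norm y) / 2" using t \<open>w \<noteq> 0\<close> by (simp add: field_simps)
    moreover have "(1 - norm y) / 2 < 1 - norm y" using y(1) by simp
    ultimately have q: "q \<in> ball 0 1" using norm_triangle_ineq[of y "t *\<^sub>R w"] by (simp add: q_def)
    have "t * (norm w)\<^sup>2 \<le> w \<bullet> v" using t(3) \<open>w \<noteq> 0\<close> by (simp add: pos_le_divide_eq)
    have "(dist x q)\<^sup>2 = (norm v)\<^sup>2 - 2 * t * (w \<bullet> v) + t * (t * (norm w)\<^sup>2)"
    proof -
      have "(dist x q)\<^sup>2 = (norm (v - t *\<^sub>R w))\<^sup>2" by (simp add: dist_norm q_def v_def algebra_simps)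
      then show ?thesis
        unfolding power2_norm_eq_inner
        by (simp add: inner_diff_left inner_diff_right inner_commute algebra_simps)
    qed
    also have "\<dots> \<le> (norm v)\<^sup>2 - 2 * t * (w \<bullet> v) + t * (w \<bullet> v)"
      using \<open>t * (norm w)\<^sup>2 \<le> w \<bullet> v\<close> t(1) by simp
    also have "\<dots> < (norm v)\<^sup>2" using t(1) w by simp
    finally have dq: "dist x q < dist x y" using v(2) by (simp add: power_less_imp_less_base)
    have segq: "x + s *\<^sub>R (q - x) \<in> ball 0 1 \<and> dist x (x + s *\<^sub>R (q - x)) \<le> dist x q"
      if "0 \<le> s" "s \<le> 1" for s
    proof
      show "x + s *\<^sub>R (q - x) \<in> ball 0 1"
        using convexD_alt[OF convex_ball x q that] by (simp add: algebra_simps)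
      show "dist x (x + s *\<^sub>R (q - x)) \<le> dist x q"
        using that by (simp add: dist_norm norm_minus_commute[of x q] mult_left_le_one_le)
    qed
    \<comment> \<open>\<open>f\<close> has opposite signs at \<open>x\<close> and \<open>q\<close>,
      so it vanishes on the segment between them, closer to \<open>x\<close> than the nearest
      zero.\<close>
    have "continuous_on {0..1} (\<lambda>s. \<sigma> * f (x + s *\<^sub>R (q - x)))"
      using segq by (intro continuous_intros continuous_on_compose2[OF Ck_on_continuous[OF f]]) (auto simp: less_imp_le)
    then obtain s where "0 \<le> s" "s \<le> 1" "\<sigma> * f (x + s *\<^sub>R (q - x)) = 0"
      using IVT2'[of "\<lambda>s. \<sigma> * f (x + s *\<^sub>R (q - x))" 1 0 0] \<sigma>(2) qneg by auto
    then have "f (x + s *\<^sub>R (q - x)) = 0" using \<sigma>(1) by auto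
    then show False using near[of "x + s *\<^sub>R (q - x)"] segq \<open>0 \<le> s\<close> \<open>s \<le> 1\<close> dq by fastforce
  qed
  have "norm v * norm g \<le> \<sigma> * (v \<bullet> g)"
  proof (rule ccontr)
    assume less: "\<not> norm v * norm g \<le> \<sigma> * (v \<bullet> g)"
    define a where "a = norm v * norm g"
    define b where "b = \<sigma> * (v \<bullet> g)"
    have ab: "b < a" "a > 0" using less v(1) g by (simp_all add: a_def b_def)
    have "\<bar>b\<bar> \<le> a" using Cauchy_Schwarz_ineq2[of v g] \<sigma>(1) by (simp add: a_def b_def abs_mult)
    \<comment> \<open>Chosen so that \<open>w \<bullet> v = norm v * (a - b)\<close> while
      \<open>\<sigma> * (w \<bullet> g) = norm g * (b - a)\<close>: strict inequality
      \<open>b < a\<close> would make \<open>w\<close> point inward with \<sigma> \<open>f\<close>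
      decreasing.\<close>
    define w where "w = norm g *\<^sub>R v - (\<sigma> * norm v) *\<^sub>R g"
    have "w \<bullet> v = norm v * (a - b)"
      by (simp add: w_def inner_diff_left a_def b_def power2_eq_square inner_commute[of g]
          power2_norm_eq_inner[symmetric] algebra_simps)
    then have "w \<bullet> v > 0" using ab v(1) by simp
    then have "\<sigma> * (w \<bullet> g) \<ge> 0" by (rule inward)
    moreover have "\<sigma> * (w \<bullet> g) = norm g * b - (\<sigma> * \<sigma>) * (norm v * (norm g)\<^sup>2)"
      by (simp add: w_def inner_diff_left b_def power2_norm_eq_inner algebra_simps)
    moreover have "norm g * b - (\<sigma> * \<sigma>) * (norm v * (norm g)\<^sup>2) = norm g * (b - a)"
      by (simp add: \<sigma>(3) a_def power2_eq_square algebra_simps)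
    ultimately show False using ab g by (simp add: zero_le_mult_iff)
  qed
  moreover have "\<exists>t>0. t < 1 \<and> iter_dir [] f (y + 1 *\<^sub>R v) =
      (\<Sum>m<2. iter_dir (replicate m v) f (y + 0 *\<^sub>R v) / fact m * 1 ^ m) +
      iter_dir (replicate 2 v) f (y + t *\<^sub>R v) / fact 2 * 1 ^ 2"
  proof (rule Maclaurin[where diff = "\<lambda>m t. iter_dir (replicate m v) f (y + t *\<^sub>R v)"])
    show "\<forall>m t. m < 2 \<and> 0 \<le> t \<and> t \<le> 1 \<longrightarrow> ((\<lambda>t. iter_dir (replicate m v) f (y + t *\<^sub>R v))
      has_real_derivative iter_dir (replicate (Suc m) v) f (y + t *\<^sub>R v)) (at t)"
    proof (intro allI impI)
      fix m :: nat and t :: real assume *: "m < 2 \<and> 0 \<le> t \<and> t \<le> 1"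
      then have "Ck_on (Suc (length (replicate m v))) (cball 0 1) f" by (intro Ck_on_mono[OF f]) auto
      from iter_dir_DERIV[OF this seg] * show "((\<lambda>t. iter_dir (replicate m v) f (y + t *\<^sub>R v))
        has_real_derivative iter_dir (replicate (Suc m) v) f (y + t *\<^sub>R v)) (at t)"
        by (simp only: replicate_append_same replicate_Suc)
    qed
  qed auto
  then obtain t where t: "0 < t" "t < 1" "f x = v \<bullet> g + iter_dir [v, v] f (y + t *\<^sub>R v) / 2"
    by (auto simp: numeral_2_eq_2 y(2) v_def g_def iter_dir_single_eq_inner[symmetric])
  moreover have "\<bar>\<sigma> * iter_dir [v, v] f (y + t *\<^sub>R v)\<bar> \<le> C * (norm v * norm v)"
    unfolding abs_mult \<sigma>(1) mult_1 using t seg hess by (intro abs_iter_dir_pair_le) auto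
  moreover have "\<gamma> * norm v \<le> norm v * norm g" using grad by (simp add: g_def mult.commute[of \<gamma>] mult_left_mono)
  moreover have "\<bar>f x\<bar> = \<sigma> * (v \<bullet> g) + \<sigma> * iter_dir [v, v] f (y + t *\<^sub>R v) / 2"
  proof -
    have "\<sigma> * f x = \<sigma> * (v \<bullet> g) + \<sigma> * iter_dir [v, v] f (y + t *\<^sub>R v) / 2"
      by (subst t(3)) (simp only: distrib_left times_divide_eq_right)
    then show ?thesis by (simp only: \<sigma>(2))
  qed
  ultimately show ?thesis unfolding v(2)[symmetric] power2_eq_square by linarith
qed

lemma grad_direction_lower_bound:
  fixes f :: "real^'n \<Rightarrow> real"
  assumes f: "Ck_on 2 (cball 0 1) f"
    and hess: "\<And>u v z. norm u \<le> 1 \<Longrightarrow> norm v \<le> 1 \<Longrightarrow> z \<in> ball 0 1 \<Longrightarrow> \<bar>iter_dir [u, v] f z\<bar> \<le> C"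
    and x: "x \<in> ball 0 1" and y: "y \<in> ball 0 1" and w: "norm w = 1"
  shows "iter_dir [w] f y - C * dist x y \<le> iter_dir [w] f x"
proof -
  define v where "v = x - y"
  have seg: "y + t *\<^sub>R v \<in> ball 0 1" if "0 \<le> t" "t \<le> 1" for t
    using convexD_alt[OF convex_ball y x that] by (simp add: v_def algebra_simps)
  have "\<exists>t>0. t < 1 \<and> iter_dir [w] f (y + 1 *\<^sub>R v) - iter_dir [w] f (y + 0 *\<^sub>R v) =
      (1 - 0) * iter_dir ([w] @ [v]) f (y + t *\<^sub>R v)"
  proof (rule MVT2)
    fix t :: real assume "0 \<le> t" "t \<le> 1"
    then show "((\<lambda>t. iter_dir [w] f (y + t *\<^sub>R v)) has_real_derivative iter_dir ([w] @ [v]) f (y + t *\<^sub>R v)) (at t)"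
      using f seg by (intro iter_dir_DERIV) (auto simp: numeral_2_eq_2 simp del: Ck_on.simps)
  qed simp
  then obtain t where t: "0 < t" "t < 1" "iter_dir [w] f x - iter_dir [w] f y = iter_dir [w, v] f (y + t *\<^sub>R v)"
    by (auto simp: v_def simp del: iter_dir.simps)
  moreover have "\<bar>iter_dir [w, v] f (y + t *\<^sub>R v)\<bar> \<le> C * (norm w * norm v)"
    using t seg hess by (intro abs_iter_dir_pair_le) auto
  ultimately show ?thesis using w by (simp add: v_def dist_norm del: iter_dir.simps)
qed

section \<open>The estimates for the Taylor polynomial and the conclusion\<close>

text \<open>Tested on the constant polynomial 1. The sign yields \<open>C3 Cbar d \<ge> 1\<close>,
  on which the later estimates rely.\<close>

lemma Cbar_nonneg:
  assumes "\<And>(P :: real^'n \<Rightarrow> real) k. poly_fun d P \<Longrightarrow> 1 \<le> k \<Longrightarrow> k \<le> d \<Longrightarrow> Mnorm k P \<le> Cbar * Mnorm 0 P"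
    and "d \<ge> 1"
  shows "Cbar \<ge> 0"
proof -
  let ?P = "\<lambda>_ :: real^'n. 1 :: real"
  have "0 \<le> (\<Sum>js | length js = 1. \<bar>iter_partial js ?P 0\<bar>)" by (intro sum_nonneg) auto
  also have "\<dots> \<le> Mnorm 1 ?P"
    by (intro sum_iter_partial_le_Mnorm Ck_on_poly_fun[OF poly_fun_const] good_cball) auto
  also have "\<dots> \<le> Cbar * Mnorm 0 ?P" using assms by (intro assms(1) poly_fun_const) auto
  also have "Mnorm 0 ?P = 1" by (simp add: Mnorm_def)
  finally show ?thesis by simp
qed

lemma hessian_bound:
  fixes f :: "real^'n \<Rightarrow> real"
  assumes d: "d \<ge> 1"
    and Cbar: "\<And>(P :: real^'n \<Rightarrow> real) k. poly_fun d P \<Longrightarrow> 1 \<le> k \<Longrightarrow> k \<le> d \<Longrightarrow> Mnorm k P \<le> Cbar * Mnorm 0 P"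
    and f: "Ck_on (Suc d) (cball 0 1) f" and M0: "Mnorm 0 f \<le> 1" and small: "Mnorm (Suc d) f \<le> 1"
    and u: "norm u \<le> 1" "norm v \<le> 1" and z: "z \<in> ball 0 1"
  shows "\<bar>iter_dir [u, v] f z\<bar> \<le> C3 Cbar d"
proof -
  have Cbar0: "Cbar \<ge> 0" using Cbar_nonneg[OF Cbar d] .
  then have C3: "C3 Cbar d \<ge> 1" by (simp add: C3_def C1_def C2_def)
  let ?\<epsilon> = "Mnorm (Suc d) f"
  have \<epsilon>0: "?\<epsilon> \<ge> 0"
    using sum_iter_partial_le_Mnorm[OF f, of 0] by (rule order_trans[rotated]) (auto intro: sum_nonneg)
  show ?thesis
  \<comment> \<open>For \<open>d = 1\<close> the constant \<open>Cbar\<close> controls first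
    derivatives only, but then the second derivative is the one of order \<open>d + 1\<close>,
    bounded by 1. For larger \<open>d\<close> the Taylor polynomial contributes
    \<open>Cbar * (1 + 1 / (d+1)!)\<close> and the remainder at most 1, in total exactly
    \<open>C3\<close>.\<close>
  proof (cases "d = 1")
    case True
    then have "\<bar>iter_dir [u, v] f z\<bar> \<le> ?\<epsilon>"
      using abs_iter_dir_le_Mnorm[of "[u, v]" f z] f u z by (auto simp del: Ck_on.simps iter_dir.simps)
    then show ?thesis using small C3 by linarith
  next
    case False
    then have d2: "2 \<le> d" using d by simp
    let ?P = "taylor_poly (Suc d) f"
    have P: "poly_fun d ?P" by (rule poly_fun_taylor_poly)
    have CkP: "Ck_on k (cball 0 1) ?P" for k by (rule Ck_on_poly_fun[OF P good_cball])
    have fact1: "?\<epsilon> / fact (Suc d) \<le> 1 / fact (Suc d)" using small by (intro divide_right_mono) auto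
    have "\<bar>?P x\<bar> \<le> 1 + 1 / fact (Suc d)" if "x \<in> ball 0 1" for x
      using taylor_remainder_le[OF f that, of "[]"] abs_iter_dir_le_Mnorm[of "[]" f x] that M0 fact1
        Ck_on_continuous[OF f] by simp
    \<comment> \<open>The Taylor estimate is available on the open ball; continuity carries the
      bound to the closed ball, over which \<open>Mnorm\<close> is taken.\<close>
    moreover have "continuous_on (closure (ball 0 1)) (\<lambda>x. \<bar>?P x\<bar>)"
      using Ck_on_continuous[OF CkP] by (simp add: continuous_on_rabs)
    ultimately have "\<bar>?P x\<bar> \<le> 1 + 1 / fact (Suc d)" if "x \<in> cball 0 1" for x
      using that continuous_le_on_closure[of "ball 0 1" "\<lambda>x. \<bar>?P x\<bar>" x "1 + 1 / fact (Suc d)"] by simp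
    then have "Mnorm 0 ?P \<le> 1 + 1 / fact (Suc d)" by (intro Mnorm_le) simp
    then have "Cbar * Mnorm 0 ?P \<le> Cbar * (1 + 1 / fact (Suc d))" using Cbar0 by (rule mult_left_mono)
    moreover have "Mnorm 2 ?P \<le> Cbar * Mnorm 0 ?P" using d2 by (intro Cbar P) auto
    moreover have "\<bar>iter_dir [u, v] ?P z\<bar> \<le> Mnorm 2 ?P"
      using abs_iter_dir_le_Mnorm[of "[u, v]" ?P z] CkP u z
      by (auto simp: numeral_2_eq_2 simp del: Ck_on.simps iter_dir.simps)
    moreover have "\<bar>iter_dir [u, v] f z - iter_dir [u, v] ?P z\<bar> \<le> ?\<epsilon> / fact (Suc d - length [u, v])"
      using d2 u by (intro taylor_remainder_le[OF f z]) auto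
    moreover have "?\<epsilon> / fact (Suc d - length [u, v]) \<le> 1"
    proof -
      have "?\<epsilon> \<le> 1 * fact (Suc d - length [u, v])"
        using small order_trans[OF small fact_ge_1] by simp
      then show ?thesis by (simp add: pos_divide_le_eq)
    qed
    ultimately have "\<bar>iter_dir [u, v] f z\<bar> \<le> Cbar * (1 + 1 / fact (Suc d)) + 1" by linarith
    also have "\<dots> = C3 Cbar d" by (simp add: C3_def C1_def C2_def algebra_simps)
    finally show ?thesis .
  qed
qed

lemma distance_dichotomy:
  fixes \<gamma> C s :: real
  assumes "\<gamma> > 0" "C > 0" "0 \<le> s" "s < \<gamma> / (2 * C)" "\<gamma> * s - C / 2 * s\<^sup>2 < \<gamma>\<^sup>2 / (8 * C)"
  shows "s \<le> \<gamma> / (4 * C)"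
proof (rule ccontr)
  assume far: "\<not> s \<le> \<gamma> / (4 * C)"
  define a where "a = C * s / \<gamma>"
  have s: "s = a * \<gamma> / C" using assms by (simp add: a_def)
  have a: "1 / 4 < a" "a < 1 / 2"
    using assms far by (auto simp: a_def field_simps)
  have "\<gamma> * s - C / 2 * s\<^sup>2 = (a - a\<^sup>2 / 2) * (\<gamma>\<^sup>2 / C)"
    using assms by (simp add: s power2_eq_square field_simps)
  moreover have "a - a\<^sup>2 / 2 > 1 / 8"
  proof -
    \<comment> \<open>Gives \<open>a^2 < 3 * a / 4 - 1 / 8\<close>, hence
      \<open>a - a^2 / 2 > 5 * a / 8 + 1 / 16\<close>, which exceeds \<open>1 / 8\<close> as
      \<open>a > 1 / 4\<close>.\<close>
    have "(a - 1 / 4) * (1 / 2 - a) > 0" using a by simp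
    then show ?thesis using a by (simp add: power2_eq_square algebra_simps)
  qed
  then have "(a - a\<^sup>2 / 2) * (\<gamma>\<^sup>2 / C) > 1 / 8 * (\<gamma>\<^sup>2 / C)"
    using assms by (intro mult_strict_right_mono) auto
  ultimately show False using assms(5) by simp
qed

lemma near_taylor_zero_set:
  fixes f :: "real^'n \<Rightarrow> real"
  assumes d: "d \<ge> 1"
    and Cbar: "\<And>(P :: real^'n \<Rightarrow> real) k. poly_fun d P \<Longrightarrow> 1 \<le> k \<Longrightarrow> k \<le> d \<Longrightarrow> Mnorm k P \<le> Cbar * Mnorm 0 P"
    and f: "Ck_on (Suc d) (cball 0 1) f" and M0: "Mnorm 0 f = 1"
    and half: "\<And>x. x \<in> cball 0 1 \<Longrightarrow> x \<notin> cball 0 (1/2) \<Longrightarrow> f x \<noteq> 0"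
    and \<gamma>: "0 < \<gamma>" "\<gamma> < 1" and reg: "regular_value \<gamma> f 0"
    and small: "Mnorm (Suc d) f < 1" "Mnorm (Suc d) f < fact d * \<gamma>\<^sup>2 / (4 * C3 Cbar d)"
  defines "P \<equiv> taylor_poly (Suc d) f"
  shows "\<exists>N K. open N \<and> N \<subseteq> ball 0 1 \<and> compact K \<and> K \<subseteq> N \<and> {x \<in> N. P x = 0} \<subseteq> K \<and>
    (\<forall>x\<in>N. P x = 0 \<longrightarrow> (\<exists>v. partial_on N v P x \<noteq> 0)) \<and> ambient_isotopic (Suc d) (zero_set f) {x \<in> N. P x = 0}"
proof -
  define C where "C = C3 Cbar d"
  have C: "C \<ge> 1" using Cbar_nonneg[OF Cbar d] by (simp add: C_def C3_def C1_def C2_def)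
  have f2: "Ck_on 2 (cball 0 1) f" using d by (intro Ck_on_mono[OF f]) simp
  have hess: "\<bar>iter_dir [u, v] f z\<bar> \<le> C" if "norm u \<le> 1" "norm v \<le> 1" "z \<in> ball 0 1" for u v z
    unfolding C_def using hessian_bound[OF d Cbar f _ _ that] M0 small by simp
  define Y where "Y = zero_set f"
  have Y: "y \<in> cball 0 (1/2)" "f y = 0" "y \<in> ball 0 1" "\<gamma> \<le> norm (grad_on (cball 0 1) f y)" if "y \<in> Y" for y
  proof -
    show y: "y \<in> cball 0 (1/2)" "f y = 0" using that half by (auto simp: Y_def zero_set_def)
    then show "y \<in> ball 0 1" by simp
    show "\<gamma> \<le> norm (grad_on (cball 0 1) f y)"
      using that reg by (simp add: Y_def zero_set_def regular_value_def)
  qed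
  have "closed Y"
    unfolding Y_def zero_set_def
    by (rule continuous_closed_preimage_constant[OF Ck_on_continuous[OF f] closed_cball])
  moreover have "Y = cball 0 1 \<inter> Y" by (auto simp: Y_def zero_set_def)
  ultimately have "compact Y" using compact_Int_closed[OF compact_cball] by metis
  \<comment> \<open>Since the zeros of \<open>f\<close> lie in the ball of radius
    \<open>1 / 2\<close> and \<open>\<gamma> / (2 * C) < 1 / 2\<close>, \<open>N\<close> stays
    inside the open unit ball. \<open>K\<close> is written as a sum of two compact sets to obtain
    its compactness.\<close>
  define N where "N = (\<Union>y\<in>Y. ball y (\<gamma> / (2 * C)))"
  define K where "K = {y + z | y z. y \<in> Y \<and> z \<in> cball 0 (\<gamma> / (4 * C))}"
  have rad: "\<gamma> / (2 * C) < 1 / 2" "\<gamma> / (4 * C) < \<gamma> / (2 * C)" "\<gamma> / (4 * C) > 0"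
    using \<gamma> C by (auto simp: field_simps)
  have N: "open N" "N \<subseteq> ball 0 1"
  proof -
    show "open N" by (auto simp: N_def)
    show "N \<subseteq> ball 0 1"
    proof
      fix x assume "x \<in> N"
      then obtain y where "y \<in> Y" "dist y x < \<gamma> / (2 * C)" by (auto simp: N_def)
      then show "x \<in> ball 0 1"
        using Y(1)[of y] rad(1) dist_triangle[of 0 x y] by simp
    qed
  qed
  have "compact K" unfolding K_def by (intro compact_sums \<open>compact Y\<close> compact_cball)
  have KI: "x \<in> K" if "y \<in> Y" "dist x y \<le> \<gamma> / (4 * C)" for x y
  proof -
    have "x = y + (x - y)" "x - y \<in> cball 0 (\<gamma> / (4 * C))"
      using that by (simp_all add: dist_norm norm_minus_commute)
    then show ?thesis unfolding K_def using that by blast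
  qed
  have "K \<subseteq> N"
    using rad(2) unfolding K_def N_def by (auto simp: dist_norm intro!: order_le_less_trans[OF _ rad(2)])
  have YN: "Y \<subseteq> N" using rad unfolding N_def by force
  have gN: "good_domain N" using N by simp
  have Nc: "N \<subseteq> cball 0 1" using N(2) ball_subset_cball by blast
  have poly: "poly_fun d P" unfolding P_def by (rule poly_fun_taylor_poly)
  have fN: "Ck_on (Suc d) N f" by (rule Ck_on_subset[OF gN Nc f])
  have PN: "Ck_on (Suc d) N P" by (rule Ck_on_poly_fun[OF poly gN])
  have Pc: "Ck_on (Suc d) (cball 0 1) P" by (rule Ck_on_poly_fun[OF poly good_cball])
  let ?u = "\<lambda>x. P x - f x"
  have uN: "Ck_on (Suc d) N ?u" by (rule Ck_on_diff[OF gN PN fN])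
  have rem0: "\<bar>P x - f x\<bar> < \<gamma>\<^sup>2 / (8 * C)" if x: "x \<in> N" for x
  proof -
    have "\<bar>f x - P x\<bar> \<le> Mnorm (Suc d) f / fact (Suc d)"
      using taylor_remainder_le[OF f, of x "[]"] N(2) x by (auto simp: P_def)
    also have "\<dots> < fact d * \<gamma>\<^sup>2 / (4 * C) / fact (Suc d)"
      using small by (intro divide_strict_right_mono) (auto simp: C_def)
    also have "\<dots> = \<gamma>\<^sup>2 / (4 * C) / real (Suc d)" by (simp add: field_simps del: of_nat_Suc)
    also have "\<dots> \<le> \<gamma>\<^sup>2 / (4 * C) / 2" using d C by (intro divide_left_mono) auto
    finally show ?thesis by (simp add: abs_minus_commute)
  qed
  have rem1: "\<bar>iter_dir [w] f x - iter_dir [w] P x\<bar> < \<gamma> / 4" if x: "x \<in> N" and w: "norm w = 1" for x w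
  proof -
    have "\<bar>iter_dir [w] f x - iter_dir [w] P x\<bar> \<le> Mnorm (Suc d) f / fact (Suc d - length [w])"
      unfolding P_def using N(2) x w d by (intro taylor_remainder_le[OF f]) auto
    also have "\<dots> < fact d * \<gamma>\<^sup>2 / (4 * C) / fact d"
      using divide_strict_right_mono[OF small(2), of "fact d"] by (simp add: C_def)
    also have "\<dots> = \<gamma>\<^sup>2 / (4 * C)" by simp
    also have "\<dots> \<le> \<gamma> / 4"
    proof -
      have "\<gamma> * \<gamma> \<le> \<gamma> * C" using \<gamma> C by (intro mult_left_mono) auto
      then show ?thesis using \<gamma> C by (simp add: power2_eq_square field_simps)
    qed
    finally show ?thesis .
  qed
  have nearest: "\<exists>y\<in>Y. dist x y \<le> \<gamma> / (4 * C)"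
    if s: "0 \<le> s" "s \<le> 1" and x: "x \<in> N" and 0: "f x + s * ?u x = 0" for s x
  proof -
    obtain y0 where y0: "y0 \<in> Y" "dist y0 x < \<gamma> / (2 * C)" using x by (auto simp: N_def)
    obtain y where y: "y \<in> Y" "\<And>z. z \<in> Y \<Longrightarrow> dist x y \<le> dist x z"
      using distance_attains_inf[OF \<open>closed Y\<close>, of x] y0 by blast
    have "\<gamma> * dist x y - C / 2 * (dist x y)\<^sup>2 \<le> \<bar>f x\<bar>"
    proof (rule nearest_zero_lower_bound[OF f2 hess])
      show "dist x y \<le> dist x z" if "z \<in> ball 0 1" "f z = 0" for z
        using that by (intro y) (auto simp: Y_def zero_set_def)
    qed (use x N Y[OF y(1)] \<gamma> in auto)
    also have "\<bar>f x\<bar> = \<bar>s * ?u x\<bar>" using 0 by (metis abs_minus_cancel add_eq_0_iff)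
    also have "\<dots> = s * \<bar>?u x\<bar>" using s by (simp add: abs_mult)
    also have "\<dots> \<le> 1 * \<bar>?u x\<bar>" using s by (intro mult_right_mono) auto
    also have "\<dots> < \<gamma>\<^sup>2 / (8 * C)" using rem0[OF x] by simp
    finally have "\<gamma> * dist x y - C / 2 * (dist x y)\<^sup>2 < \<gamma>\<^sup>2 / (8 * C)" .
    moreover have "dist x y < \<gamma> / (2 * C)" using y(2)[OF y0(1)] y0(2) by (simp add: dist_commute)
    ultimately have "dist x y \<le> \<gamma> / (4 * C)" using \<gamma> C by (intro distance_dichotomy) auto
    then show ?thesis using y by blast
  qed
  have trap: "x \<in> K" if "0 \<le> s" "s \<le> 1" "x \<in> N" "f x + s * ?u x = 0" for s x
    using nearest[OF that] KI by blast
  have reg: "\<exists>v. partial_on N v f x + s * partial_on N v ?u x \<noteq> 0"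
    if s: "0 \<le> s" "s \<le> 1" and x: "x \<in> N" and 0: "f x + s * ?u x = 0" for s x
  proof -
    obtain y where y: "y \<in> Y" "dist x y \<le> \<gamma> / (4 * C)" using nearest[OF s x 0] by blast
    define g where "g = grad_on (cball 0 1) f y"
    have g: "norm g \<ge> \<gamma>" using Y[OF y(1)] by (simp add: g_def)
    \<comment> \<open>The unit gradient direction at a nearby zero \<open>y\<close>. The derivative
      of \<open>f\<close> along it is at least \<gamma> at \<open>y\<close> and loses at most
      \<open>C * \<gamma> / (4 * C)\<close> on the way to \<open>x\<close>; the perturbation costs
      at most another \<open>\<gamma> / 4\<close>, so \<open>\<gamma> / 2\<close> remains.\<close>
    define w where "w = (1 / norm g) *\<^sub>R g"
    have w: "norm w = 1" using g \<gamma> by (auto simp: w_def)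
    have "w \<bullet> g = norm g"
      by (simp add: w_def power2_norm_eq_inner[symmetric] power2_eq_square)
    then have "iter_dir [w] f y \<ge> \<gamma>" using g by (simp add: iter_dir_single_eq_inner g_def del: iter_dir.simps)
    moreover have "iter_dir [w] f y - C * dist x y \<le> iter_dir [w] f x"
      using x N Y[OF y(1)] w by (intro grad_direction_lower_bound[OF f2 hess]) auto
    moreover have "C * dist x y \<le> \<gamma> / 4" using y(2) C by (simp add: field_simps)
    ultimately have fw: "iter_dir [w] f x \<ge> 3 / 4 * \<gamma>" by linarith
    have xc: "x \<in> cball 0 1" using x Nc by auto
    have pf: "partial_on N w f x = iter_dir [w] f x"
      by (simp only: partial_on_subset[OF gN Nc x f] iter_dir_single_eq_partial[OF f xc])
    have pP: "partial_on N w P x = iter_dir [w] P x"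
      by (simp only: partial_on_subset[OF gN Nc x Pc] iter_dir_single_eq_partial[OF Pc xc])
    have pu: "partial_on N w ?u x = iter_dir [w] P x - iter_dir [w] f x"
      using partial_on_add_cmult[OF gN x PN fN, of w "-1"] pf pP by simp
    have "\<bar>s * (iter_dir [w] P x - iter_dir [w] f x)\<bar> \<le> 1 * (\<gamma> / 4)"
      unfolding abs_mult using s rem1[OF x w]
      by (intro mult_mono) (auto simp: abs_minus_commute simp del: iter_dir.simps)
    then have "partial_on N w f x + s * partial_on N w ?u x > 0"
      unfolding pf pu using fw \<gamma>(1) by linarith
    then show ?thesis by (intro exI[of _ w]) simp
  qed
  have iso: "ambient_isotopic (Suc d) {x \<in> N. f x = 0} {x \<in> N. f x + ?u x = 0}"
    by (rule regular_family_isotopic[OF N \<open>compact K\<close> \<open>K \<subseteq> N\<close> fN uN trap reg])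
  have "{x \<in> N. P x = 0} \<subseteq> K" using trap[of 1] by auto
  moreover have "{x \<in> N. f x = 0} = zero_set f" using YN Nc by (auto simp: Y_def zero_set_def)
  then have "ambient_isotopic (Suc d) (zero_set f) {x \<in> N. P x = 0}" using iso by simp
  moreover have "\<exists>v. partial_on N v P x \<noteq> 0" if x: "x \<in> N" "P x = 0" for x
  proof -
    obtain v where v: "partial_on N v f x + 1 * partial_on N v ?u x \<noteq> 0" using reg[of 1 x] x by auto
    have "partial_on N v ?u x = partial_on N v P x - partial_on N v f x"
      using partial_on_add_cmult[OF gN x(1) PN fN, of v "-1"] by simp
    then show ?thesis using v by (intro exI[of _ v]) simp
  qed
  ultimately show ?thesis
    using N \<open>compact K\<close> \<open>K \<subseteq> N\<close> by (intro exI[of _ N] exI[of _ K]) simp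
qed

theorem theorem7p2:
  fixes f :: "real^'n \<Rightarrow> real" and d :: nat and \<gamma> Cbar :: real
  assumes "d \<ge> 1"
    and Cbar: "\<And>(P :: real^'n \<Rightarrow> real) k. poly_fun d P \<Longrightarrow> 1 \<le> k \<Longrightarrow> k \<le> d \<Longrightarrow>
                 Mnorm k P \<le> Cbar * Mnorm 0 P"
    and "Ck_on (d + 1) (cball 0 1) f"
    and "Mnorm 0 f = 1"
    and "\<And>x. x \<in> cball 0 1 \<Longrightarrow> x \<notin> cball 0 (1/2) \<Longrightarrow> f x \<noteq> 0"
    and "0 < \<gamma>" "\<gamma> < 1"
    and "regular_value \<gamma> f 0"
    and "\<not> (\<exists>(P :: real^'n \<Rightarrow> real) \<W>.
             poly_fun d P \<and>
             \<W> \<subseteq> components (zero_set P) \<and>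
             finite \<W> \<and> card \<W> = card (components (zero_set f)) \<and>
             (\<forall>W\<in>\<W>. smooth_hypersurface W) \<and>
             Ck_isotopic (d + 1) (cball 0 1) (zero_set f) (\<Union>\<W>))"
  shows "Mnorm (d + 1) f \<ge> min 1 (fact d * \<gamma>\<^sup>2 / (4 * C3 Cbar d))"
proof (rule ccontr)
  assume "\<not> Mnorm (d + 1) f \<ge> min 1 (fact d * \<gamma>\<^sup>2 / (4 * C3 Cbar d))"
  then have small: "Mnorm (Suc d) f < 1" "Mnorm (Suc d) f < fact d * \<gamma>\<^sup>2 / (4 * C3 Cbar d)" by auto
  define P where "P = taylor_poly (Suc d) f"
  have poly: "poly_fun d P" unfolding P_def by (rule poly_fun_taylor_poly)
  have f: "Ck_on (Suc d) (cball 0 1) f" using assms(3) by (simp only: Suc_eq_plus1)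
  have "\<exists>N K. open N \<and> N \<subseteq> ball 0 1 \<and> compact K \<and> K \<subseteq> N \<and> {x \<in> N. P x = 0} \<subseteq> K \<and>
    (\<forall>x\<in>N. P x = 0 \<longrightarrow> (\<exists>v. partial_on N v P x \<noteq> 0)) \<and> ambient_isotopic (Suc d) (zero_set f) {x \<in> N. P x = 0}"
    unfolding P_def
    by (rule near_taylor_zero_set[OF assms(1) _ f assms(4) _ assms(6,7,8) small])
      (rule Cbar assms(5); assumption)+
  then obtain N K where N: "open N" "N \<subseteq> ball 0 1" and K: "compact K" "K \<subseteq> N" "{x \<in> N. P x = 0} \<subseteq> K"
    and nz: "\<forall>x\<in>N. P x = 0 \<longrightarrow> (\<exists>v. partial_on N v P x \<noteq> 0)"
    and iso': "ambient_isotopic (Suc d) (zero_set f) {x \<in> N. P x = 0}"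
    by (elim exE conjE)
  define W where "W = {x \<in> N. P x = 0}"
  have W: "W = {x \<in> N. P x = 0}" "W \<subseteq> K" "\<And>x. x \<in> W \<Longrightarrow> \<exists>v. partial_on N v P x \<noteq> 0"
    using K(3) nz by (auto simp: W_def)
  have iso: "ambient_isotopic (Suc d) (zero_set f) W" using iso' by (simp only: W_def)
  have PN: "Ck_on (Suc 0) N P" using N by (intro Ck_on_poly_fun[OF poly]) simp
  have contP: "continuous_on K P" using Ck_on_continuous[OF PN] K(2) by (rule continuous_on_subset)
  \<comment> \<open>As a zero set in the compact \<open>K\<close>, \<open>W\<close> is closed; as
    the zero set of \<open>P\<close> in the open \<open>N\<close>, it is relatively open in
    \<open>zero_set P\<close>.\<close>
  have WK: "W = {x \<in> K. P x = 0}" using W(1,2) K(2) by auto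
  have "closed W"
    unfolding WK by (rule continuous_closed_preimage_constant[OF contP compact_imp_closed[OF K(1)]])
  then have "compact W" using W(2) compact_Int_closed[OF K(1), of W] by (simp add: Int_absorb1)
  have WX: "W = zero_set P \<inter> N" using N(2) by (auto simp: W(1) zero_set_def)
  then have clopen: "openin (top_of_set (zero_set P)) W" "closedin (top_of_set (zero_set P)) W"
    using N(1) \<open>closed W\<close> by (auto simp: openin_open closedin_closed)
  have op: "openin (top_of_set W) C" if "C \<in> components W" for C
  proof (rule openin_component_if_locally_connected_at[OF _ that])
    fix p assume p: "p \<in> W"
    then obtain v where "partial_on N v P p \<noteq> 0" using W(3) by blast
    then show "\<exists>U V. open U \<and> p \<in> U \<and> connected V \<and> W \<inter> U \<subseteq> V \<and> V \<subseteq> W"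
      using p zero_set_locally_connected[OF N(1) PN, of p v] unfolding W(1) by blast
  qed
  have smooth: "smooth_hypersurface C" if C: "C \<in> components W" for C
    unfolding smooth_hypersurface_def
  proof
    fix p assume p: "p \<in> C"
    obtain U0 where U0: "open U0" "C = W \<inter> U0" using op[OF C] by (auto simp: openin_open)
    define g where "g = grad_on UNIV P"
    \<comment> \<open>\<open>P\<close> itself is the local equation of \<open>C\<close>:
      \<open>U0\<close> separates \<open>C\<close> from the other components of \<open>W\<close>,
      and the last set keeps the gradient nonzero on all of \<open>U\<close>, also off the zero
      set.\<close>
    define U where "U = N \<inter> U0 \<inter> {x. g x \<noteq> 0}"
    have "Ck_on 0 UNIV (partial_on UNIV (axis i 1) P)" for i
      by (intro Ck_on_partial_any Ck_on_poly_fun[OF poly]) auto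
    then have "continuous_on UNIV g"
      unfolding g_def grad_on_def by (intro continuous_on_vec_lambda) simp
    then have "open {x. g x \<noteq> 0}" by (intro open_Collect_neq continuous_on_const)
    then have U: "open U" using N U0 by (auto simp: U_def)
    have PU: "Ck_on (Suc k) UNIV P" for k by (rule Ck_on_poly_fun[OF poly]) simp
    have "g p \<noteq> 0"
    proof
      assume g0: "g p = 0"
      have pN: "p \<in> N" "p \<in> W" using p U0(2) WX by auto
      obtain v where "partial_on N v P p \<noteq> 0" using W(3)[OF pN(2)] by blast
      moreover have "partial_on N v P p = partial_on UNIV v P p"
        using N by (intro partial_on_subset[OF _ subset_UNIV pN(1) PU[of 0]]) simp
      moreover have "partial_on UNIV v P p = (\<Sum>i\<in>UNIV. v $ i * g p $ i)"
        using partial_on_sum_coord[OF PU[of 0], of p v] by (simp add: g_def grad_on_def)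
      ultimately show False using g0 by simp
    qed
    then have "p \<in> U" using p U0(2) WX by (auto simp: U_def)
    moreover have "grad_on U P x \<noteq> 0" if "x \<in> U" for x
    proof -
      have "grad_on U P x = g x"
        unfolding g_def grad_on_def
        by (simp only: partial_on_subset[OF disjI2[OF U] subset_UNIV that PU[of 0]])
      then show ?thesis using that by (simp add: U_def)
    qed
    moreover have "C \<inter> U = {x \<in> U. P x = 0}" using U0(2) by (auto simp: U_def W(1))
    moreover have "Ck_on k U P" for k by (rule Ck_on_poly_fun[OF poly]) (simp add: U)
    ultimately show "\<exists>U g. open U \<and> p \<in> U \<and> (\<forall>k. Ck_on k U g) \<and> (\<forall>x\<in>U. grad_on U g x \<noteq> 0) \<and>
        C \<inter> U = {x \<in> U. g x = 0}"
      using U by (intro exI[of _ U] exI[of _ P]) simp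
  qed
  obtain h h' where "homeomorphism (zero_set f) W h h'" using ambient_isotopic_homeomorphism[OF iso] .
  then have "card (components W) = card (components (zero_set f))" by (rule card_components_homeomorphic)
  moreover have "Ck_isotopic (d + 1) (cball 0 1) (zero_set f) (\<Union> (components W))"
    using ambient_isotopic_imp_Ck_isotopic[OF iso] by simp
  ultimately show False
    using assms(9) poly components_clopen_subset[OF clopen] finite_components_if_open[OF \<open>compact W\<close> op] smooth
    by blast
qed

end
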